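(* Let $H,K$ be complex Hilbert spaces and let $A=(A_1,\dots,A_d)\in \mathcal B(H)^d$ and $B=(B_1,\dots,B_d)\in \mathcal B(K)^d$ be $d$-tuples of bounded operators. (1) Given $n\in\mathbb N$, if there exists a unital $n$-positive map $\phi:S_A\to S_B$ with $\phi(A_i)=B_i$ for all $i$, then $\mathcal W_n(B)\subseteq \mathcal W_n(A)$. (2) There exists a unital completely positive (UCP) map $\phi:S_A\to S_B$ with $\phi(A_i)=B_i$ for all $i$ if and only if $\mathcal W(B)\subseteq\mathcal W(A)$ (that is, $\mathcal W_n(B)\subseteq \mathcal W_n(A)$ for all $n$). If $B$ is a commuting tuple of normal operators, then this inclusion is equivalent to $\sigma(B)\subseteq \mathcal W_1(A)$, which is also equivalent to $\mathcal W_1(B)\subseteq \mathcal W_1(A)$. (3) There exists a unital completely isometric map $\phi:S_A\to S_B$ with $\phi(A_i)=B_i$ for all $i$ if and only if $\mathcal W(B)=\mathcal W(A)$.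
   Context: $M_n$ denotes the $n\times n$ complex matrices. For $A\in\mathcal B(H)^d$, $S_A$ is the operator system generated by $A$, i.e. the linear span of $I, A_i, A_i^*$ ($1\le i\le d$), and $C^*(S_A)$ is the unital C*-algebra generated by $A$. The matrix range of $A$ is $\mathcal W(A)=\bigcup_n \mathcal W_n(A)$ with $\mathcal W_n(A)=\{(\phi(A_1),\dots,\phi(A_d)) : \phi: C^*(S_A)\to M_n \text{ UCP}\}\subseteq M_n^d$; in particular $\mathcal W_1(A)\subseteq\mathbb C^d$. For a tuple $B$ of commuting normal operators, $\sigma(B)\subseteq\mathbb C^d$ is the joint spectrum. *)

theory Defs
  imports "HOL-Analysis.Analysis" "Jordan_Normal_Form.Matrix"
begin

section \<open>Complex Hilbert spaces\<close>

class complex_vector = real_vector +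
  fixes scaleC :: "complex \<Rightarrow> 'a \<Rightarrow> 'a"  (infixr \<open>*\<^sub>C\<close> 75)
  assumes scaleC_add_right: "a *\<^sub>C (x + y) = a *\<^sub>C x + a *\<^sub>C y"
    and scaleC_add_left: "(a + b) *\<^sub>C x = a *\<^sub>C x + b *\<^sub>C x"
    and scaleC_scaleC: "a *\<^sub>C b *\<^sub>C x = (a * b) *\<^sub>C x"
    and scaleC_of_real: "complex_of_real r *\<^sub>C x = r *\<^sub>R x"

lemma scaleC_one: "1 *\<^sub>C (x :: 'a :: complex_vector) = x"
  using scaleC_of_real[of 1 x] by simp

global_interpretation complex_vector: vector_space
  "scaleC :: complex \<Rightarrow> 'a \<Rightarrow> 'a :: complex_vector"
  by unfold_locales
    (simp_all add: scaleC_add_right scaleC_add_left scaleC_scaleC scaleC_one)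

text \<open>The inner product is linear in the first argument and conjugate linear in the second one.
  The axiom \<open>cinner_self\<close> gives positivity and definiteness, and says that the norm is the one
  induced by the inner product. Completeness is inherited from \<^class>\<open>banach\<close>.
  The zero space is allowed.\<close>

class chilbert_space = complex_vector + banach +
  fixes cinner :: "'a \<Rightarrow> 'a \<Rightarrow> complex"
  assumes cinner_add_left: "cinner (x + y) z = cinner x z + cinner y z"
    and cinner_scaleC_left: "cinner (a *\<^sub>C x) y = a * cinner x y"
    and cinner_commute: "cinner x y = cnj (cinner y x)"
    and cinner_self: "cinner x x = complex_of_real ((norm x)\<^sup>2)"

lemma norm_scaleC: "norm (a *\<^sub>C (x :: 'a :: chilbert_space)) = cmod a * norm x"
proof -
  have r: "cinner x (a *\<^sub>C x) = cnj a * cinner x x"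
    by (metis cinner_commute cinner_scaleC_left complex_cnj_mult)
  have "complex_of_real ((norm (a *\<^sub>C x))\<^sup>2) = a * (cnj a * cinner x x)"
    by (metis r cinner_self cinner_scaleC_left)
  also have "\<dots> = complex_of_real ((cmod a * norm x)\<^sup>2)"
    by (simp add: cinner_self mult.assoc[symmetric] complex_norm_square[symmetric] power_mult_distrib)
  finally have "(norm (a *\<^sub>C x))\<^sup>2 = (cmod a * norm x)\<^sup>2"
    by (simp only: of_real_eq_iff)
  then show ?thesis
    by (rule power2_eq_imp_eq) simp_all
qed

instantiation complex :: chilbert_space
begin

definition scaleC_complex :: "complex \<Rightarrow> complex \<Rightarrow> complex" where
  "scaleC_complex = (*)"

definition cinner_complex :: "complex \<Rightarrow> complex \<Rightarrow> complex" where
  "cinner_complex x y = x * cnj y"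

instance
  by standard
    (simp_all add: scaleC_complex_def cinner_complex_def algebra_simps scaleR_conv_of_real
      complex_norm_square[symmetric])

end

instantiation blinfun :: (chilbert_space, chilbert_space) complex_vector
begin

lift_definition scaleC_blinfun :: "complex \<Rightarrow> 'a \<Rightarrow>\<^sub>L 'b \<Rightarrow> 'a \<Rightarrow>\<^sub>L 'b"
  is "\<lambda>c T x. c *\<^sub>C T x"
proof -
  fix c :: complex and T :: "'a \<Rightarrow> 'b"
  assume "bounded_linear T"
  moreover have "bounded_linear (\<lambda>x :: 'b. c *\<^sub>C x)"
    by (rule bounded_linear_intro[where K = "cmod c"])
      (simp_all add: scaleC_add_right norm_scaleC scaleC_scaleC mult.commute
        flip: scaleC_of_real)
  ultimately show "bounded_linear (\<lambda>x. c *\<^sub>C T x)"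
    by (rule bounded_linear_compose[rotated])
qed

instance
  by standard
    (transfer, simp add: scaleC_add_right scaleC_add_left scaleC_scaleC scaleC_of_real)+

end

definition clinear_on :: "'a :: complex_vector set \<Rightarrow> ('a \<Rightarrow> 'b :: complex_vector) \<Rightarrow> bool" where
  "clinear_on S f \<longleftrightarrow>
     (\<forall>x\<in>S. \<forall>y\<in>S. f (x + y) = f x + f y) \<and> (\<forall>c. \<forall>x\<in>S. f (c *\<^sub>C x) = c *\<^sub>C f x)"


section \<open>Bounded operators, operator systems and C*-algebras\<close>

text \<open>The type \<open>'h \<Rightarrow>\<^sub>L 'h\<close> consists of the bounded \<^emph>\<open>real\<close>-linear maps; \<open>bounded_ops\<close> is
  the algebra of bounded complex-linear operators on the Hilbert space \<open>'h\<close>.\<close>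

definition bounded_ops :: "('h :: chilbert_space \<Rightarrow>\<^sub>L 'h) set" where
  "bounded_ops = {T. \<forall>c x. blinfun_apply T (c *\<^sub>C x) = c *\<^sub>C blinfun_apply T x}"

definition cadjoint :: "('h :: chilbert_space \<Rightarrow>\<^sub>L 'h) \<Rightarrow> ('h \<Rightarrow>\<^sub>L 'h)" where
  "cadjoint T =
     (THE S. \<forall>x y. cinner (blinfun_apply T x) y = cinner x (blinfun_apply S y))"

definition normal_op :: "('h :: chilbert_space \<Rightarrow>\<^sub>L 'h) \<Rightarrow> bool" where
  "normal_op T \<longleftrightarrow> T o\<^sub>L cadjoint T = cadjoint T o\<^sub>L T"

text \<open>A \<open>d\<close>-tuple is a function on a finite index type \<open>'d\<close> with \<open>d\<close> elements.\<close>

definition op_system :: "('d :: finite \<Rightarrow> 'h :: chilbert_space \<Rightarrow>\<^sub>L 'h) \<Rightarrow> ('h \<Rightarrow>\<^sub>L 'h) set" where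
  "op_system A =
     complex_vector.span ({id_blinfun} \<union> range A \<union> range (\<lambda>i. cadjoint (A i)))"

definition unital_cstar_subalgebra :: "('h :: chilbert_space \<Rightarrow>\<^sub>L 'h) set \<Rightarrow> bool" where
  "unital_cstar_subalgebra \<A> \<longleftrightarrow>
     \<A> \<subseteq> bounded_ops \<and> complex_vector.subspace \<A> \<and> id_blinfun \<in> \<A> \<and>
     (\<forall>S\<in>\<A>. \<forall>T\<in>\<A>. S o\<^sub>L T \<in> \<A>) \<and> (\<forall>T\<in>\<A>. cadjoint T \<in> \<A>) \<and> closed \<A>"

definition cstar_algebra :: "('d :: finite \<Rightarrow> 'h :: chilbert_space \<Rightarrow>\<^sub>L 'h) \<Rightarrow> ('h \<Rightarrow>\<^sub>L 'h) set" where
  "cstar_algebra A = unital_cstar_subalgebra hull (range A)"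


section \<open>Matrices over operators, and completely positive and completely isometric maps\<close>

text \<open>An \<open>n \<times> n\<close> matrix over \<open>\<B>(H)\<close> is a function \<open>X :: nat \<Rightarrow> nat \<Rightarrow> _\<close> of which only the
  entries with indices below \<open>n\<close> matter. It acts on \<open>H\<^sup>n\<close> by
  \<open>(X \<xi>) i = (\<Sum>j<n. X i j (\<xi> j))\<close>; positivity and the norm are those of this operator.
  The order on \<^typ>\<open>complex\<close> is the one where \<open>0 \<le> z\<close> means that \<open>z\<close> is real and nonnegative.\<close>

definition op_matrix_pos :: "nat \<Rightarrow> (nat \<Rightarrow> nat \<Rightarrow> 'h :: chilbert_space \<Rightarrow>\<^sub>L 'h) \<Rightarrow> bool" where
  "op_matrix_pos n X \<longleftrightarrow>
     (\<forall>\<xi> :: nat \<Rightarrow> 'h. 0 \<le> (\<Sum>i<n. cinner (\<Sum>j<n. blinfun_apply (X i j) (\<xi> j)) (\<xi> i)))"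

definition op_matrix_norm :: "nat \<Rightarrow> (nat \<Rightarrow> nat \<Rightarrow> 'h :: chilbert_space \<Rightarrow>\<^sub>L 'h) \<Rightarrow> real" where
  "op_matrix_norm n X =
     Sup {L2_set (\<lambda>i. norm (\<Sum>j<n. blinfun_apply (X i j) (\<xi> j))) {..<n} | \<xi> :: nat \<Rightarrow> 'h.
       L2_set (\<lambda>j. norm (\<xi> j)) {..<n} \<le> 1}"

text \<open>The algebra \<open>M\<^sub>k\<close> is \<open>carrier_mat k k\<close>; positivity of an \<open>n \<times> n\<close> matrix over \<open>M\<^sub>k\<close>
  is positivity as an operator on \<open>(\<complex>\<^sup>k)\<^sup>n\<close>.\<close>

definition mat_matrix_pos :: "nat \<Rightarrow> nat \<Rightarrow> (nat \<Rightarrow> nat \<Rightarrow> complex mat) \<Rightarrow> bool" where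
  "mat_matrix_pos k n Y \<longleftrightarrow>
     (\<forall>\<xi>. (\<forall>i<n. \<xi> i \<in> carrier_vec k) \<longrightarrow>
       0 \<le> (\<Sum>i<n. \<Sum>j<n. (Y i j *\<^sub>v \<xi> j) \<bullet>c \<xi> i))"

text \<open>The amplification of \<open>\<phi>\<close> to \<open>n \<times> n\<close> matrices over \<open>S\<close> is positive, where \<open>P\<close> and
  \<open>Q\<close> are the positivity predicates for matrices over the domain and the codomain.\<close>

definition n_positive_on ::
    "(nat \<Rightarrow> (nat \<Rightarrow> nat \<Rightarrow> 'a) \<Rightarrow> bool) \<Rightarrow> (nat \<Rightarrow> (nat \<Rightarrow> nat \<Rightarrow> 'b) \<Rightarrow> bool) \<Rightarrow>
     nat \<Rightarrow> 'a set \<Rightarrow> ('a \<Rightarrow> 'b) \<Rightarrow> bool" where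
  "n_positive_on P Q n S \<phi> \<longleftrightarrow>
     (\<forall>X. (\<forall>i<n. \<forall>j<n. X i j \<in> S) \<longrightarrow> P n X \<longrightarrow> Q n (\<lambda>i j. \<phi> (X i j)))"

definition unital_linear_map ::
    "('h :: chilbert_space \<Rightarrow>\<^sub>L 'h) set \<Rightarrow> ('k :: chilbert_space \<Rightarrow>\<^sub>L 'k) set \<Rightarrow>
     ('h \<Rightarrow>\<^sub>L 'h \<Rightarrow> 'k \<Rightarrow>\<^sub>L 'k) \<Rightarrow> bool" where
  "unital_linear_map S S' \<phi> \<longleftrightarrow>
     \<phi> ` S \<subseteq> S' \<and> clinear_on S \<phi> \<and> \<phi> id_blinfun = id_blinfun"

definition unital_n_positive_map ::
    "nat \<Rightarrow> ('h :: chilbert_space \<Rightarrow>\<^sub>L 'h) set \<Rightarrow> ('k :: chilbert_space \<Rightarrow>\<^sub>L 'k) set \<Rightarrow>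
     ('h \<Rightarrow>\<^sub>L 'h \<Rightarrow> 'k \<Rightarrow>\<^sub>L 'k) \<Rightarrow> bool" where
  "unital_n_positive_map n S S' \<phi> \<longleftrightarrow>
     unital_linear_map S S' \<phi> \<and> n_positive_on op_matrix_pos op_matrix_pos n S \<phi>"

definition ucp_map ::
    "('h :: chilbert_space \<Rightarrow>\<^sub>L 'h) set \<Rightarrow> ('k :: chilbert_space \<Rightarrow>\<^sub>L 'k) set \<Rightarrow>
     ('h \<Rightarrow>\<^sub>L 'h \<Rightarrow> 'k \<Rightarrow>\<^sub>L 'k) \<Rightarrow> bool" where
  "ucp_map S S' \<phi> \<longleftrightarrow>
     unital_linear_map S S' \<phi> \<and> (\<forall>n\<ge>1. n_positive_on op_matrix_pos op_matrix_pos n S \<phi>)"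

definition unital_complete_isometry ::
    "('h :: chilbert_space \<Rightarrow>\<^sub>L 'h) set \<Rightarrow> ('k :: chilbert_space \<Rightarrow>\<^sub>L 'k) set \<Rightarrow>
     ('h \<Rightarrow>\<^sub>L 'h \<Rightarrow> 'k \<Rightarrow>\<^sub>L 'k) \<Rightarrow> bool" where
  "unital_complete_isometry S S' \<phi> \<longleftrightarrow>
     unital_linear_map S S' \<phi> \<and>
     (\<forall>n\<ge>1. \<forall>X. (\<forall>i<n. \<forall>j<n. X i j \<in> S) \<longrightarrow>
        op_matrix_norm n (\<lambda>i j. \<phi> (X i j)) = op_matrix_norm n X)"

definition ucp_mat_map ::
    "nat \<Rightarrow> ('h :: chilbert_space \<Rightarrow>\<^sub>L 'h) set \<Rightarrow> ('h \<Rightarrow>\<^sub>L 'h \<Rightarrow> complex mat) \<Rightarrow> bool" where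
  "ucp_mat_map k S \<phi> \<longleftrightarrow>
     \<phi> ` S \<subseteq> carrier_mat k k \<and>
     (\<forall>x\<in>S. \<forall>y\<in>S. \<phi> (x + y) = \<phi> x + \<phi> y) \<and>
     (\<forall>c. \<forall>x\<in>S. \<phi> (c *\<^sub>C x) = c \<cdot>\<^sub>m \<phi> x) \<and>
     \<phi> id_blinfun = 1\<^sub>m k \<and>
     (\<forall>n\<ge>1. n_positive_on op_matrix_pos (mat_matrix_pos k) n S \<phi>)"


section \<open>Matrix ranges and the joint spectrum\<close>

definition matrix_range_level ::
    "nat \<Rightarrow> ('d :: finite \<Rightarrow> 'h :: chilbert_space \<Rightarrow>\<^sub>L 'h) \<Rightarrow> ('d \<Rightarrow> complex mat) set" where
  "matrix_range_level n A = {\<lambda>i. \<phi> (A i) | \<phi>. ucp_mat_map n (cstar_algebra A) \<phi>}"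

definition matrix_range ::
    "('d :: finite \<Rightarrow> 'h :: chilbert_space \<Rightarrow>\<^sub>L 'h) \<Rightarrow> ('d \<Rightarrow> complex mat) set" where
  "matrix_range A = (\<Union>n\<in>{1..}. matrix_range_level n A)"

lemma matrix_range_level_carrier:
  assumes "W \<in> matrix_range_level n A"
  shows "W i \<in> carrier_mat n n"
proof -
  obtain \<phi> where "ucp_mat_map n (cstar_algebra A) \<phi>" "W = (\<lambda>i. \<phi> (A i))"
    using assms by (auto simp: matrix_range_level_def)
  moreover have "A i \<in> cstar_algebra A"
    using hull_subset[of "range A" unital_cstar_subalgebra] by (auto simp: cstar_algebra_def)
  ultimately show ?thesis
    by (auto simp: ucp_mat_map_def)
qed

text \<open>The levels are recovered from the union, since matrices carry their dimension
  and the tuples are nonempty.\<close>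

lemma matrix_range_subset_iff:
  "matrix_range B \<subseteq> matrix_range A \<longleftrightarrow>
     (\<forall>n\<ge>1. matrix_range_level n B \<subseteq> matrix_range_level n A)"
proof
  assume sub: "matrix_range B \<subseteq> matrix_range A"
  show "\<forall>n\<ge>1. matrix_range_level n B \<subseteq> matrix_range_level n A"
  proof (intro allI impI subsetI)
    fix n :: nat and W
    assume n: "n \<ge> 1" and W: "W \<in> matrix_range_level n B"
    then have "W \<in> matrix_range A"
      using sub by (auto simp: matrix_range_def)
    then obtain m where m: "W \<in> matrix_range_level m A"
      by (auto simp: matrix_range_def)
    have "m = n"
      using matrix_range_level_carrier[OF W, of undefined]
        matrix_range_level_carrier[OF m, of undefined] by auto
    with m show "W \<in> matrix_range_level n A" by simp
  qed
qed (auto simp: matrix_range_def)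

text \<open>The identification of \<open>\<complex>\<^sup>d\<close> with \<open>d\<close>-tuples of \<open>1 \<times> 1\<close> matrices.\<close>

definition scalar_tuple :: "('d :: finite \<Rightarrow> complex) \<Rightarrow> 'd \<Rightarrow> complex mat" where
  "scalar_tuple z = (\<lambda>i. mat 1 1 (\<lambda>_. z i))"

definition character_on :: "('h :: chilbert_space \<Rightarrow>\<^sub>L 'h) set \<Rightarrow> ('h \<Rightarrow>\<^sub>L 'h \<Rightarrow> complex) \<Rightarrow> bool" where
  "character_on \<A> \<omega> \<longleftrightarrow>
     clinear_on \<A> \<omega> \<and> (\<forall>S\<in>\<A>. \<forall>T\<in>\<A>. \<omega> (S o\<^sub>L T) = \<omega> S * \<omega> T) \<and> \<omega> id_blinfun = 1"

text \<open>The joint (Gelfand) spectrum, intended for commuting normal tuples: then \<open>cstar_algebra B\<close>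
  is commutative and \<open>\<omega> \<mapsto> (\<omega> (B i))\<^sub>i\<close> identifies its character space with this set.\<close>

definition joint_spectrum ::
    "('d :: finite \<Rightarrow> 'h :: chilbert_space \<Rightarrow>\<^sub>L 'h) \<Rightarrow> ('d \<Rightarrow> complex) set" where
  "joint_spectrum B = {\<lambda>i. \<omega> (B i) | \<omega>. character_on (cstar_algebra B) \<omega>}"

end

theory Submission
  imports Defs "HOL-Complex_Analysis.Cauchy_Integral_Formula" "HOL-Library.Function_Algebras"
begin

text \<open>An \<open>n\<close>-positive unital map into \<open>M\<^sub>n\<close> amounts to a positive functional on matrices of size
  \<open>n\<close> over the operator system; extending that functional to all operators (Krein) yields a UCP
  extension of the map, which gives (1). For the converse in (2), positivity of a matrix over
  \<open>S\<^sub>B\<close> is tested on finitely many vectors, hence on the compression of \<open>B\<close> to their span. This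
  compression lies in \<open>\<W>(B)\<close>, so if \<open>\<W>(B) \<subseteq> \<W>(A)\<close> it is a UCP image of \<open>A\<close>, and
  positive linear combinations of \<open>I\<close>, \<open>A\<^sub>i\<close>, \<open>A\<^sub>i\<^sup>*\<close> with matrix coefficients stay positive when \<open>A\<close>
  is replaced by \<open>B\<close>. Part (3) follows since a unital complete isometry is completely positive
  and, by the usual \<open>2 \<times> 2\<close> block trick, UCP maps are completely contractive.

  For commuting normal \<open>B\<close>, Fuglede's theorem lets a self-adjoint matrix over \<open>S\<^sub>B\<close> and the real
  and imaginary parts of the \<open>B\<^sub>i\<close>, acting diagonally, have joint approximate eigenvectors that
  almost attain the infimum of the matrix. Such a sequence defines a character, which thus
  detects a failure of positivity of the matrix.\<close>

section \<open>Inner products and adjoints\<close>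

text \<open>Two features of the setting shape the details. Elements of a direct sum of
  \<open>n\<close> copies of a Hilbert space are functions on \<open>nat\<close> of which only the
  first \<open>n\<close> values count, so the forms on them are degenerate; the estimates are
  therefore made for positive semidefinite forms. Also, the generators of an operator system may be
  linearly dependent, so \<open>A\<close> and \<open>B\<close> are compared through families of
  coefficients, and that sending \<open>A i\<close> to \<open>B i\<close> is well defined is itself
  deduced from the transfer of positivity or of norms. Operator square roots, functional calculus
  and spectral measures are avoided: contractions are related to positivity through discs in the
  complex plane, and the exponentials usual in Fuglede's theorem become powers of
  \<open>1 + u S\<close>. Krein's extension takes place in the real space of all matrices. Positive
  matrices are hermitian and cannot dominate the others, hence the larger cone of accretive
  matrices, those whose form has nonnegative real part.\<close>

lemma scaleC_zero_left [simp]: "0 *\<^sub>C (x :: 'a :: complex_vector) = 0"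
  by (rule complex_vector.scale_zero_left)

lemma scaleC_zero_right [simp]: "c *\<^sub>C (0 :: 'a :: complex_vector) = 0"
  by (rule complex_vector.scale_zero_right)

lemma scaleC_one_left [simp]: "1 *\<^sub>C (x :: 'a :: complex_vector) = x"
  by (rule scaleC_one)

lemma scaleC_minus_one: "(-1) *\<^sub>C (x :: 'a :: complex_vector) = - x"
  by (metis complex_vector.scale_minus_left scaleC_one)

lemma cinner_add_right: "cinner x (y + z) = cinner x y + cinner x (z :: 'a :: chilbert_space)"
  by (metis cinner_add_left cinner_commute complex_cnj_add)

lemma cinner_scaleC_right: "cinner x (a *\<^sub>C y) = cnj a * cinner x (y :: 'a :: chilbert_space)"
  by (metis cinner_commute cinner_scaleC_left complex_cnj_mult)

lemma cinner_zero_left [simp]: "cinner 0 (y :: 'a :: chilbert_space) = 0"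
  using cinner_scaleC_left[of 0 0 y] by simp

lemma cinner_zero_right [simp]: "cinner (y :: 'a :: chilbert_space) 0 = 0"
  using cinner_scaleC_right[of y 0 0] by simp

lemma cinner_minus_left [simp]: "cinner (- x) (y :: 'a :: chilbert_space) = - cinner x y"
  using cinner_scaleC_left[of "-1" x y] by (simp add: scaleC_minus_one)

lemma cinner_minus_right [simp]: "cinner x (- y :: 'a :: chilbert_space) = - cinner x y"
  using cinner_scaleC_right[of x "-1" y] by (simp add: scaleC_minus_one)

lemma cinner_diff_left: "cinner (x - y) z = cinner x z - cinner y (z :: 'a :: chilbert_space)"
  using cinner_add_left[of x "- y" z] by simp

lemma cinner_diff_right: "cinner x (y - z) = cinner x y - cinner x (z :: 'a :: chilbert_space)"
  using cinner_add_right[of x y "- z"] by simp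

lemma cinner_scaleR_left: "cinner (r *\<^sub>R x) (y :: 'a :: chilbert_space) = r * cinner x y"
  by (metis cinner_scaleC_left scaleC_of_real)

lemma cinner_scaleR_right: "cinner x (r *\<^sub>R y :: 'a :: chilbert_space) = r * cinner x y"
  by (metis cinner_scaleC_right scaleC_of_real complex_cnj_complex_of_real)

lemma cinner_sum_left: "cinner (\<Sum>i\<in>I. f i) (y :: 'a :: chilbert_space) = (\<Sum>i\<in>I. cinner (f i) y)"
  by (induction I rule: infinite_finite_induct) (simp_all add: cinner_add_left)

lemma cinner_sum_right: "cinner y (\<Sum>i\<in>I. f i :: 'a :: chilbert_space) = (\<Sum>i\<in>I. cinner y (f i))"
  by (induction I rule: infinite_finite_induct) (simp_all add: cinner_add_right)

lemmas cinner_simps = cinner_add_left cinner_add_right cinner_scaleC_left cinner_scaleC_right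
  cinner_diff_left cinner_diff_right cinner_scaleR_left cinner_scaleR_right

lemma Re_cinner_commute: "Re (cinner x y) = Re (cinner y (x :: 'a :: chilbert_space))"
  by (subst cinner_commute) simp

lemma norm_square_eq_cinner: "(norm (x :: 'a :: chilbert_space))\<^sup>2 = Re (cinner x x)"
  by (simp add: cinner_self)

lemma cinner_eq_zeroD: "(\<And>y. cinner x y = 0) \<Longrightarrow> x = (0 :: 'a :: chilbert_space)"
  using cinner_self[of x] by simp

lemma cinner_eqI: "(\<And>y. cinner x y = cinner z y) \<Longrightarrow> x = (z :: 'a :: chilbert_space)"
  using cinner_eq_zeroD[of "x - z"] by (simp add: cinner_simps)

text \<open>Tuples of vectors and matrices of operators are plain functions; with the pointwise
  structure, the results on real forms and on extension of functionals apply to them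
  directly.\<close>

instantiation "fun" :: (type, real_vector) real_vector
begin

definition scaleR_fun :: "real \<Rightarrow> ('a \<Rightarrow> 'b) \<Rightarrow> 'a \<Rightarrow> 'b" where
  "scaleR_fun r f = (\<lambda>x. r *\<^sub>R f x)"

instance
  by standard (auto simp: scaleR_fun_def fun_eq_iff scaleR_add_right scaleR_add_left)

end

lemma scaleR_fun_apply [simp]: "(r *\<^sub>R f) x = r *\<^sub>R f x"
  by (simp add: scaleR_fun_def)

text \<open>Definiteness is not assumed: a form on tuples that sees only the entries below
  \<open>n\<close> may vanish at a nonzero function. Instances are the real part of the inner
  product, its sum over a tuple, and the form of a positive operator matrix.\<close>

locale psd_form =
  fixes g :: "'v :: real_vector \<Rightarrow> 'v \<Rightarrow> real"
  assumes add_left: "g (x + y) z = g x z + g y z"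
    and scaleR_left: "g (r *\<^sub>R x) y = r * g x y"
    and sym: "g x y = g y x"
    and nonneg: "0 \<le> g x x"
begin

lemma add_right: "g z (x + y) = g z x + g z y"
  by (metis add_left sym)

lemma scaleR_right: "g y (r *\<^sub>R x) = r * g y x"
  by (metis scaleR_left sym)

lemma minus_left: "g (- x) y = - g x y"
  using scaleR_left[of "-1" x y] by simp

lemma diff_left: "g (x - y) z = g x z - g y z"
  using add_left[of x "- y" z] by (simp add: minus_left)

lemma diff_right: "g z (x - y) = g z x - g z y"
  by (metis diff_left sym)

lemma Cauchy_Schwarz: "(g x y)\<^sup>2 \<le> g x x * g y y"
proof -
  have q: "0 \<le> g x x + 2 * t * g x y + t\<^sup>2 * g y y" for t
    using nonneg[of "x + t *\<^sub>R y"]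
    by (simp add: add_left add_right scaleR_left scaleR_right sym[of y x] power2_eq_square
        algebra_simps)
  show ?thesis
  proof (cases "g y y = 0")
    case True
    have "g x y = 0"
    proof (rule ccontr)
      assume ne: "g x y \<noteq> 0"
      \<comment> \<open>With \<open>g y y = 0\<close> the bound \<open>q\<close> is affine in
        \<open>t\<close>, and this \<open>t\<close> makes its right-hand side -1.\<close>
      from q[of "- (g x x + 1) / (2 * g x y)"] True ne show False
        by (simp add: field_simps)
    qed
    then show ?thesis using True by simp
  next
    case False
    then have pos: "g y y > 0" using nonneg[of y] by simp
    have "0 \<le> (g x x - (g x y)\<^sup>2 / g y y)"
      using q[of "- g x y / g y y"] pos by (simp add: power2_eq_square)
    then show ?thesis using pos by (simp add: field_simps)
  qed
qed

definition nrm :: "'v \<Rightarrow> real" where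
  "nrm x = sqrt (g x x)"

lemma nrm_nonneg: "0 \<le> nrm x"
  by (simp add: nrm_def nonneg)

lemma nrm_square: "(nrm x)\<^sup>2 = g x x"
  by (simp add: nrm_def nonneg)

lemma abs_le_nrm: "\<bar>g x y\<bar> \<le> nrm x * nrm y"
proof -
  have "\<bar>g x y\<bar>\<^sup>2 \<le> (nrm x * nrm y)\<^sup>2"
    using Cauchy_Schwarz[of x y] by (simp add: power_mult_distrib nrm_square)
  then show ?thesis
    by (rule power2_le_imp_le) (simp add: nrm_nonneg)
qed

lemma nrm_scaleR: "nrm (r *\<^sub>R x) = \<bar>r\<bar> * nrm x"
  by (simp add: nrm_def scaleR_left scaleR_right real_sqrt_mult flip: mult.assoc power2_eq_square)

lemma nrm_triangle: "nrm (x + y) \<le> nrm x + nrm y"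
proof -
  have "(nrm (x + y))\<^sup>2 \<le> (nrm x + nrm y)\<^sup>2"
    using abs_le_nrm[of x y]
    by (simp add: nrm_square power2_sum add_left add_right sym[of y x])
  then show ?thesis
    by (rule power2_le_imp_le) (simp add: nrm_nonneg)
qed

lemma nrm_minus: "nrm (- x) = nrm x"
  using nrm_scaleR[of "-1" x] by simp

lemma nrm_triangle_diff: "nrm (x - y) \<le> nrm x + nrm y"
  using nrm_triangle[of x "- y"] by (simp add: nrm_minus)

lemma nrm_diff_ge: "nrm x - nrm y \<le> nrm (x - y)"
  using nrm_triangle[of "x - y" y] by simp

end

interpretation cinner_form: psd_form "\<lambda>x y :: 'a :: chilbert_space. Re (cinner x y)"
  by unfold_locales
    (simp_all add: cinner_simps Re_cinner_commute cinner_self)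

lemma cinner_form_nrm [simp]: "cinner_form.nrm x = norm (x :: 'a :: chilbert_space)"
  by (simp add: cinner_form.nrm_def cinner_self)

text \<open>Multiplying \<open>x\<close> by a phase makes the inner product real and nonnegative,
  which reduces the claim to the real Cauchy-Schwarz inequality.\<close>

lemma norm_cinner_le: "cmod (cinner x y) \<le> norm x * norm (y :: 'a :: chilbert_space)"
proof (cases "cinner x y = 0")
  case False
  define a where "a = cnj (cinner x y) / cmod (cinner x y)"
  have "a * cinner x y = cmod (cinner x y)"
    using False by (simp add: a_def mult.commute[of "cnj _"] complex_norm_square[symmetric]
        power2_eq_square)
  then have "cmod (cinner x y) = Re (cinner (a *\<^sub>C x) y)"
    by (simp add: cinner_scaleC_left)
  also have "\<dots> \<le> norm (a *\<^sub>C x) * norm y"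
    using cinner_form.abs_le_nrm[of "a *\<^sub>C x" y] by simp
  also have "norm (a *\<^sub>C x) = norm x"
    using False by (simp add: norm_scaleC a_def norm_divide)
  finally show ?thesis .
qed simp

section \<open>Riesz representation of bounded real functionals\<close>

lemma parallelogram_law:
  fixes x y :: "'a :: chilbert_space"
  shows "(norm (x + y))\<^sup>2 + (norm (x - y))\<^sup>2 = 2 * (norm x)\<^sup>2 + 2 * (norm y)\<^sup>2"
  by (simp add: norm_square_eq_cinner cinner_simps)

text \<open>The representing vector minimises \<open>\<lambda>x. (norm x)\<^sup>2 - 2 * f x\<close>.\<close>

lemma Riesz_representation:
  fixes f :: "'a :: chilbert_space \<Rightarrow> real"
  assumes f: "bounded_linear f"
  obtains z where "\<And>x. f x = Re (cinner x z)"
proof -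
  interpret f: bounded_linear f by fact
  define J where "J x = (norm x)\<^sup>2 - 2 * f x" for x
  obtain K where K: "\<And>x. \<bar>f x\<bar> \<le> norm x * K" "K > 0"
    using f.pos_bounded by auto
  have J_ge: "- K\<^sup>2 \<le> J x" for x
  proof -
    have "2 * f x \<le> 2 * (norm x * K)"
      using K(1)[of x] by linarith
    moreover have "2 * (norm x * K) \<le> (norm x)\<^sup>2 + K\<^sup>2"
      using sum_squares_bound[of "norm x" K] by (simp add: mult.assoc)
    ultimately show ?thesis by (simp add: J_def)
  qed
  define m where "m = Inf (range J)"
  have bdd: "bdd_below (range J)"
    by (rule bdd_belowI[of _ "- K\<^sup>2"]) (use J_ge in auto)
  have m_le: "m \<le> J x" for x
    unfolding m_def by (rule cInf_lower) (use bdd in auto)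
  have "\<exists>x. J x < m + 1 / real (Suc n)" for n
    using cInf_lessD[of "range J" "m + 1 / real (Suc n)"] by (auto simp: m_def)
  then obtain u where u: "\<And>n. J (u n) < m + 1 / real (Suc n)" by metis
  \<comment> \<open>The midpoint of \<open>x\<close> and \<open>y\<close> cannot fall below
    \<open>m\<close> either, so the parallelogram law forces near minimisers together.\<close>
  have dist: "(norm (x - y))\<^sup>2 \<le> 2 * (J x - m) + 2 * (J y - m)" for x y
  proof -
    have "norm ((1/2) *\<^sub>R (x + y)) = norm (x + y) / 2"
      by simp
    then have "J ((1/2) *\<^sub>R (x + y)) = (1/4) * (norm (x + y))\<^sup>2 - (f x + f y)"
      by (simp only: J_def f.scaleR f.add) (simp add: power_divide add_divide_distrib)
    with m_le[of "(1/2) *\<^sub>R (x + y)"] parallelogram_law[of x y] show ?thesis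
      by (simp add: J_def)
  qed
  have "Cauchy u"
  proof (rule metric_CauchyI)
    fix e :: real assume e: "e > 0"
    then obtain N where N: "1 / real (Suc N) < e\<^sup>2 / 4"
      using nat_approx_posE[of "e\<^sup>2 / 4"] by auto
    have "dist (u i) (u j) < e" if "i \<ge> N" "j \<ge> N" for i j
    proof -
      have *: "J (u i) - m < e\<^sup>2 / 4" if "i \<ge> N" for i
      proof -
        have "1 / real (Suc i) \<le> 1 / real (Suc N)"
          using that by (simp add: field_simps)
        with u[of i] N show ?thesis by linarith
      qed
      have "(norm (u i - u j))\<^sup>2 < e\<^sup>2"
        by (rule le_less_trans[OF dist[of "u i" "u j"]]) (use *[OF that(1)] *[OF that(2)] in simp)
      then show ?thesis
        using e by (simp add: dist_norm power2_less_imp_less)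
    qed
    then show "\<exists>N. \<forall>i\<ge>N. \<forall>j\<ge>N. dist (u i) (u j) < e" by blast
  qed
  then obtain z where z: "u \<longlonglongrightarrow> z"
    using Cauchy_convergent convergent_def by blast
  have "(\<lambda>n. J (u n)) \<longlonglongrightarrow> J z"
    unfolding J_def by (intro tendsto_intros z f.tendsto)
  moreover have "(\<lambda>n. m + 1 / real (Suc n)) \<longlonglongrightarrow> m + 0"
    by (intro tendsto_intros LIMSEQ_inverse_real_of_nat[unfolded inverse_eq_divide])
  ultimately have "J z \<le> m + 0"
    by (rule LIMSEQ_le) (use u less_imp_le in blast)
  then have Jz: "J z \<le> m" by simp
  have "f y = Re (cinner y z)" for y
  proof -
    \<comment> \<open>\<open>2 * b\<close> is the derivative of \<open>J\<close> at the minimiser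
      \<open>z\<close> in the direction \<open>y\<close>, so it has to vanish.\<close>
    define b where "b = Re (cinner y z) - f y"
    have q: "0 \<le> 2 * t * b + t\<^sup>2 * (norm y)\<^sup>2" for t
    proof -
      have "J (z + t *\<^sub>R y) = J z + 2 * t * b + t\<^sup>2 * (norm y)\<^sup>2"
      proof -
        have "(norm (z + t *\<^sub>R y))\<^sup>2
            = (norm z)\<^sup>2 + 2 * t * Re (cinner y z) + t\<^sup>2 * (norm y)\<^sup>2"
          unfolding norm_square_eq_cinner
          by (simp add: cinner_simps Re_cinner_commute[of z y] power2_eq_square algebra_simps)
        then show ?thesis
          by (simp add: J_def f.add f.scaleR b_def algebra_simps)
      qed
      then show ?thesis using m_le[of "z + t *\<^sub>R y"] Jz by linarith
    qed
    have "b = 0"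
    proof (rule ccontr)
      assume "b \<noteq> 0"
      \<comment> \<open>The added 1 keeps \<open>N\<close> positive even for
        \<open>y = 0\<close>.\<close>
      define N where "N = (norm y)\<^sup>2 + 1"
      have N: "N > 0" by (simp add: N_def add_nonneg_pos)
      have "0 \<le> 2 * (- b / N) * b + (- b / N)\<^sup>2 * (norm y)\<^sup>2" by (rule q)
      also have "\<dots> \<le> 2 * (- b / N) * b + (- b / N)\<^sup>2 * N"
        by (intro add_left_mono mult_left_mono) (simp_all add: N_def)
      also have "\<dots> = - b\<^sup>2 / N"
        using N by (simp add: power2_eq_square field_simps)
      also have "\<dots> < 0" using N \<open>b \<noteq> 0\<close> by simp
      finally show False by simp
    qed
    then show ?thesis by (simp add: b_def)
  qed
  then show ?thesis using that by blast
qed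

section \<open>Adjoints of bounded complex-linear operators\<close>

lemma bounded_opsD: "T \<in> bounded_ops \<Longrightarrow> blinfun_apply T (c *\<^sub>C x) = c *\<^sub>C blinfun_apply T x"
  by (simp add: bounded_ops_def)

lemma cadjoint_eqI:
  assumes "\<And>x y. cinner (blinfun_apply T x) y = cinner x (blinfun_apply S y)"
  shows "cadjoint T = S"
  unfolding cadjoint_def
proof (rule the_equality)
  fix S' assume S': "\<forall>x y. cinner (blinfun_apply T x) y = cinner x (blinfun_apply S' y)"
  show "S' = S"
  proof (rule blinfun_eqI, rule cinner_eqI)
    fix x y
    show "cinner (blinfun_apply S' x) y = cinner (blinfun_apply S x) y"
      using S' assms by (metis cinner_commute)
  qed
qed (use assms in auto)

text \<open>Riesz represents only the real part of the functional; complex linearity of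
  \<open>T\<close> recovers the imaginary part by testing on
  \<open>\<i> *\<^sub>C x\<close>.\<close>

lemma cadjoint_exists:
  assumes T: "T \<in> bounded_ops"
  shows "\<exists>S. \<forall>x y. cinner (blinfun_apply T x) y = cinner x (blinfun_apply S y)"
proof -
  have "\<exists>z. \<forall>x. Re (cinner (blinfun_apply T x) y) = Re (cinner x z)" for y
  proof -
    have "bounded_linear (\<lambda>x. Re (cinner (blinfun_apply T x) y))"
    proof (rule bounded_linear_intro[where K = "norm T * norm y"])
      show "norm (Re (cinner (blinfun_apply T x) y)) \<le> norm x * (norm T * norm y)" for x
      proof -
        have "norm (Re (cinner (blinfun_apply T x) y)) \<le> norm (blinfun_apply T x) * norm y"
          using norm_cinner_le[of "blinfun_apply T x" y] abs_Re_le_cmod order_trans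
          by (metis real_norm_def)
        also have "\<dots> \<le> (norm T * norm x) * norm y"
          by (intro mult_right_mono norm_blinfun) simp
        finally show ?thesis by (simp add: mult_ac)
      qed
    qed (simp_all add: blinfun.add_right blinfun.scaleR_right cinner_simps)
    then show ?thesis by (metis Riesz_representation)
  qed
  then obtain s where s: "\<And>x y. Re (cinner (blinfun_apply T x) y) = Re (cinner x (s y))" by metis
  have s': "cinner (blinfun_apply T x) y = cinner x (s y)" for x y
  proof (rule complex_eqI)
    show "Im (cinner (blinfun_apply T x) y) = Im (cinner x (s y))"
      using s[of "\<i> *\<^sub>C x" y] by (simp add: bounded_opsD[OF T] cinner_simps)
  qed (rule s)
  have "bounded_linear s"
  proof (rule bounded_linear_intro[where K = "norm T"])
    show "s (x + y) = s x + s y" for x y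
      by (rule cinner_eqI) (metis (no_types, lifting) s' cinner_add_right cinner_commute)
    show "s (r *\<^sub>R x) = r *\<^sub>R s x" for r x
      by (rule cinner_eqI) (metis (no_types, lifting) s' cinner_scaleR_right cinner_commute)
    show "norm (s x) \<le> norm x * norm T" for x
    proof (cases "norm (s x) = 0")
      case False
      have "(norm (s x))\<^sup>2 = Re (cinner (blinfun_apply T (s x)) x)"
        by (simp add: norm_square_eq_cinner s')
      also have "\<dots> \<le> norm (blinfun_apply T (s x)) * norm x"
        using norm_cinner_le complex_Re_le_cmod order_trans by blast
      also have "\<dots> \<le> (norm T * norm (s x)) * norm x"
        by (intro mult_right_mono norm_blinfun) simp
      finally have "norm (s x) * norm (s x) \<le> norm (s x) * (norm x * norm T)"
        by (simp add: power2_eq_square mult_ac)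
      then show ?thesis
        using False by (simp add: mult_le_cancel_left)
    qed simp
  qed
  then show ?thesis
    using s' by (intro exI[of _ "Blinfun s"]) (simp add: bounded_linear_Blinfun_apply)
qed

lemma cinner_cadjoint_right:
  assumes "T \<in> bounded_ops"
  shows "cinner x (blinfun_apply (cadjoint T) y) = cinner (blinfun_apply T x) y"
  using cadjoint_exists[OF assms] cadjoint_eqI by metis

lemma cinner_cadjoint_left:
  assumes "T \<in> bounded_ops"
  shows "cinner (blinfun_apply (cadjoint T) x) y = cinner x (blinfun_apply T y)"
  by (metis cinner_cadjoint_right[OF assms] cinner_commute)

lemma cadjoint_bounded_ops [simp]:
  assumes "T \<in> bounded_ops"
  shows "cadjoint T \<in> bounded_ops"
  unfolding bounded_ops_def
proof (intro CollectI allI)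
  fix c x
  show "blinfun_apply (cadjoint T) (c *\<^sub>C x) = c *\<^sub>C blinfun_apply (cadjoint T) x"
    by (rule cinner_eqI) (simp add: cinner_cadjoint_left[OF assms] cinner_simps)
qed

lemma cadjoint_cadjoint [simp]:
  assumes "T \<in> bounded_ops"
  shows "cadjoint (cadjoint T) = T"
  by (rule cadjoint_eqI) (simp add: cinner_cadjoint_left[OF assms])

lemma scaleC_blinfun_apply [simp]: "blinfun_apply (c *\<^sub>C T) x = c *\<^sub>C blinfun_apply T x"
  by transfer simp

lemma id_bounded_ops [simp]: "id_blinfun \<in> bounded_ops"
  by (simp add: bounded_ops_def)

lemma zero_bounded_ops [simp]: "0 \<in> bounded_ops"
  by (simp add: bounded_ops_def)

lemma add_bounded_ops: "S \<in> bounded_ops \<Longrightarrow> T \<in> bounded_ops \<Longrightarrow> S + T \<in> bounded_ops"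
  by (simp add: bounded_ops_def blinfun.add_left scaleC_add_right)

lemma scaleC_bounded_ops: "T \<in> bounded_ops \<Longrightarrow> c *\<^sub>C T \<in> bounded_ops"
  by (simp add: bounded_ops_def scaleC_scaleC mult.commute)

lemma subspace_bounded_ops: "complex_vector.subspace bounded_ops"
  by (simp add: complex_vector.subspace_def add_bounded_ops scaleC_bounded_ops)

lemma compose_bounded_ops: "S \<in> bounded_ops \<Longrightarrow> T \<in> bounded_ops \<Longrightarrow> S o\<^sub>L T \<in> bounded_ops"
  by (simp add: bounded_ops_def)

lemma cadjoint_id [simp]: "cadjoint id_blinfun = id_blinfun"
  by (rule cadjoint_eqI) simp

lemma cadjoint_add:
  assumes "S \<in> bounded_ops" "T \<in> bounded_ops"
  shows "cadjoint (S + T) = cadjoint S + cadjoint T"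
  by (rule cadjoint_eqI) (simp add: blinfun.add_left cinner_simps cinner_cadjoint_right assms)

lemma cadjoint_scaleC:
  assumes "T \<in> bounded_ops"
  shows "cadjoint (c *\<^sub>C T) = cnj c *\<^sub>C cadjoint T"
  by (rule cadjoint_eqI) (simp add: cinner_simps cinner_cadjoint_right assms)

lemma cadjoint_zero [simp]: "cadjoint 0 = (0 :: 'a :: chilbert_space \<Rightarrow>\<^sub>L 'a)"
  by (rule cadjoint_eqI) simp

lemma cadjoint_diff:
  assumes "S \<in> bounded_ops" "T \<in> bounded_ops"
  shows "cadjoint (S - T) = cadjoint S - cadjoint T"
  by (rule cadjoint_eqI) (simp add: blinfun.diff_left cinner_simps cinner_cadjoint_right assms)

lemma cadjoint_compose:
  assumes "S \<in> bounded_ops" "T \<in> bounded_ops"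
  shows "cadjoint (S o\<^sub>L T) = cadjoint T o\<^sub>L cadjoint S"
  by (rule cadjoint_eqI) (simp add: cinner_cadjoint_right assms)

lemma cadjoint_sum:
  assumes "\<And>i. i \<in> I \<Longrightarrow> f i \<in> bounded_ops"
  shows "cadjoint (\<Sum>i\<in>I. f i) = (\<Sum>i\<in>I. cadjoint (f i))"
  using assms
proof (induction I rule: infinite_finite_induct)
  case (insert i I)
  then show ?case
    by (simp add: cadjoint_add complex_vector.subspace_sum[OF subspace_bounded_ops])
qed (auto intro: cadjoint_eqI)

lemma norm_cadjoint_le:
  assumes T: "T \<in> bounded_ops"
  shows "norm (cadjoint T) \<le> norm T"
proof (rule norm_blinfun_bound)
  fix x
  let ?y = "blinfun_apply (cadjoint T) x"
  show "norm ?y \<le> norm T * norm x"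
  proof (cases "norm ?y = 0")
    case False
    have "(norm ?y)\<^sup>2 = Re (cinner (blinfun_apply T ?y) x)"
      by (simp add: norm_square_eq_cinner cinner_cadjoint_right[OF T])
    also have "\<dots> \<le> norm (blinfun_apply T ?y) * norm x"
      using norm_cinner_le complex_Re_le_cmod order_trans by blast
    also have "\<dots> \<le> (norm T * norm ?y) * norm x"
      by (intro mult_right_mono norm_blinfun) simp
    finally have "norm ?y * norm ?y \<le> norm ?y * (norm T * norm x)"
      by (simp add: power2_eq_square mult_ac)
    then show ?thesis
      using False by (simp add: mult_le_cancel_left)
  qed simp
qed simp

lemma closed_bounded_ops: "closed (bounded_ops :: ('a :: chilbert_space \<Rightarrow>\<^sub>L 'a) set)"
proof -
  have eq: "bounded_ops = (\<Inter>c. \<Inter>x. {T :: 'a \<Rightarrow>\<^sub>L 'a. T (c *\<^sub>C x) = c *\<^sub>C T x})"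
    by (auto simp: bounded_ops_def)
  have cont: "continuous_on UNIV (\<lambda>T :: 'a \<Rightarrow>\<^sub>L 'a. c *\<^sub>C T x)" for c x
  proof -
    have "continuous_on UNIV (\<lambda>T :: 'a \<Rightarrow>\<^sub>L 'a. blinfun_apply (c *\<^sub>C id_blinfun) (T x))"
      by (intro continuous_intros)
    then show ?thesis by simp
  qed
  show ?thesis
    unfolding eq by (intro closed_INT ballI closed_Collect_eq cont continuous_intros)
qed

lemma clinear_on_zero:
  assumes f: "clinear_on S f" and S: "complex_vector.subspace S"
  shows "f 0 = 0"
proof -
  have "f (0 *\<^sub>C 0) = 0 *\<^sub>C f 0"
    using f complex_vector.subspace_0[OF S] unfolding clinear_on_def by blast
  then show ?thesis by simp
qed

lemma clinear_on_sum:
  assumes f: "clinear_on S f" and S: "complex_vector.subspace S" and x: "\<And>k. k \<in> K \<Longrightarrow> x k \<in> S"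
  shows "f (\<Sum>k\<in>K. x k) = (\<Sum>k\<in>K. f (x k))"
  using x
proof (induction K rule: infinite_finite_induct)
  case (insert k K)
  have "(\<Sum>k\<in>K. x k) \<in> S"
    using insert.prems by (intro complex_vector.subspace_sum S) auto
  then show ?case using insert f by (simp add: clinear_on_def)
qed (simp_all add: clinear_on_zero[OF f S])

lemma clinear_on_lincomb:
  assumes f: "clinear_on S f" and S: "complex_vector.subspace S" and x: "\<And>k. k \<in> K \<Longrightarrow> x k \<in> S"
  shows "f (\<Sum>k\<in>K. c k *\<^sub>C x k) = (\<Sum>k\<in>K. c k *\<^sub>C f (x k))"
proof -
  have "f (\<Sum>k\<in>K. c k *\<^sub>C x k) = (\<Sum>k\<in>K. f (c k *\<^sub>C x k))"
    by (intro clinear_on_sum[OF f S] complex_vector.subspace_scale S x)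
  also have "\<dots> = (\<Sum>k\<in>K. c k *\<^sub>C f (x k))"
    using f x by (intro sum.cong) (auto simp: clinear_on_def)
  finally show ?thesis .
qed

section \<open>C*-algebras generated by tuples\<close>

lemma unital_cstar_subalgebra_bounded_ops: "unital_cstar_subalgebra bounded_ops"
  by (simp add: unital_cstar_subalgebra_def subspace_bounded_ops compose_bounded_ops
      closed_bounded_ops)

lemma unital_cstar_subalgebra_Inter:
  assumes "\<And>\<A>. \<A> \<in> F \<Longrightarrow> unital_cstar_subalgebra \<A>" "F \<noteq> {}"
  shows "unital_cstar_subalgebra (\<Inter>F)"
proof -
  have *: "\<A> \<in> F \<Longrightarrow> \<A> \<subseteq> bounded_ops" "\<A> \<in> F \<Longrightarrow> complex_vector.subspace \<A>"
    "\<A> \<in> F \<Longrightarrow> closed \<A>" for \<A>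
    using assms(1) by (auto simp: unital_cstar_subalgebra_def)
  have "\<Inter>F \<subseteq> bounded_ops"
    using *(1) assms(2) by blast
  moreover have "complex_vector.subspace (\<Inter>F)"
    by (intro complex_vector.subspace_Inter ballI *(2))
  moreover have "closed (\<Inter>F)"
    using *(3) by (intro closed_Inter) auto
  ultimately show ?thesis
    using assms(1) by (auto simp: unital_cstar_subalgebra_def)
qed

lemma unital_cstar_subalgebra_cstar_algebra:
  assumes "\<forall>i. A i \<in> bounded_ops"
  shows "unital_cstar_subalgebra (cstar_algebra A)"
  unfolding cstar_algebra_def hull_def
  by (rule unital_cstar_subalgebra_Inter)
    (use assms unital_cstar_subalgebra_bounded_ops in auto)

lemma generator_in_cstar_algebra: "A i \<in> cstar_algebra A"
  using hull_subset[of "range A" unital_cstar_subalgebra] by (auto simp: cstar_algebra_def)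

lemma cstar_algebra_minimal:
  "unital_cstar_subalgebra \<A> \<Longrightarrow> range A \<subseteq> \<A> \<Longrightarrow> cstar_algebra A \<subseteq> \<A>"
  unfolding cstar_algebra_def by (rule hull_minimal)

section \<open>Extension of positive functionals\<close>

text \<open>Scaling asks for one inequality; applying it to the inverse factor gives the other
  (\<open>sublinear_scaleR\<close>).\<close>

definition sublinear :: "('v :: real_vector \<Rightarrow> real) \<Rightarrow> bool" where
  "sublinear p \<longleftrightarrow> (\<forall>x y. p (x + y) \<le> p x + p y) \<and> (\<forall>t>0. \<forall>x. p (t *\<^sub>R x) \<le> t * p x)"

lemma sublinear_add: "sublinear p \<Longrightarrow> p (x + y) \<le> p x + p y"
  by (simp add: sublinear_def)

lemma sublinear_scaleR_le: "sublinear p \<Longrightarrow> t > 0 \<Longrightarrow> p (t *\<^sub>R x) \<le> t * p x"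
  by (simp add: sublinear_def)

lemma sublinear_scaleR:
  assumes "sublinear p" "t > 0"
  shows "p (t *\<^sub>R x) = t * p x"
proof (rule antisym)
  show "p (t *\<^sub>R x) \<le> t * p x" by (rule sublinear_scaleR_le) fact+
  have "p ((1 / t) *\<^sub>R (t *\<^sub>R x)) \<le> (1 / t) * p (t *\<^sub>R x)"
    using assms by (intro sublinear_scaleR_le) simp_all
  then show "t * p x \<le> p (t *\<^sub>R x)"
    using assms(2) by (simp add: field_simps)
qed

lemma sublinear_zero: "sublinear p \<Longrightarrow> p 0 = 0"
  using sublinear_scaleR[of p 2 0] by simp

lemma sublinear_minus: "sublinear p \<Longrightarrow> - p (- x) \<le> p x"
  using sublinear_add[of p x "- x"] sublinear_zero[of p] by simp

text \<open>Infima do not preserve subadditivity in general. In a chain, the two functionals that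
  almost attain the infima at \<open>x\<close> and at \<open>y\<close> can both be replaced by the
  smaller one.\<close>

lemma sublinear_INF_chain:
  assumes sub: "\<And>q. q \<in> C \<Longrightarrow> sublinear q" and "C \<noteq> {}"
    and total: "\<And>q r. q \<in> C \<Longrightarrow> r \<in> C \<Longrightarrow> q \<le> r \<or> r \<le> q"
    and bdd: "\<And>x. bdd_below ((\<lambda>q. q x) ` C)"
  shows "sublinear (\<lambda>x. INF q\<in>C. q x)"
  unfolding sublinear_def
proof (intro conjI allI impI)
  fix x y
  show "(INF q\<in>C. q (x + y)) \<le> (INF q\<in>C. q x) + (INF q\<in>C. q y)"
  proof (rule field_le_epsilon)
    fix e :: real assume "e > 0"
    then obtain q r where qr: "q \<in> C" "q x < (INF q\<in>C. q x) + e / 2"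
      "r \<in> C" "r y < (INF q\<in>C. q y) + e / 2"
      using cINF_less_iff[OF \<open>C \<noteq> {}\<close> bdd[of x], of "(INF q\<in>C. q x) + e / 2"]
        cINF_less_iff[OF \<open>C \<noteq> {}\<close> bdd[of y], of "(INF q\<in>C. q y) + e / 2"] by auto
    obtain s where s: "s \<in> C" "s \<le> q" "s \<le> r"
      using total[OF qr(1,3)] qr(1,3) by auto
    have "(INF q\<in>C. q (x + y)) \<le> s (x + y)"
      by (rule cINF_lower[OF bdd s(1)])
    also have "\<dots> \<le> s x + s y"
      by (rule sublinear_add[OF sub[OF s(1)]])
    also have "\<dots> \<le> q x + r y"
      using s(2,3) by (intro add_mono) (auto simp: le_fun_def)
    finally show "(INF q\<in>C. q (x + y)) \<le> (INF q\<in>C. q x) + (INF q\<in>C. q y) + e"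
      using qr by linarith
  qed
next
  fix t :: real and x assume t: "t > 0"
  have "(INF q\<in>C. q (t *\<^sub>R x)) / t \<le> (INF q\<in>C. q x)"
  proof (rule cINF_greatest[OF \<open>C \<noteq> {}\<close>])
    fix q assume q: "q \<in> C"
    have "(INF q\<in>C. q (t *\<^sub>R x)) \<le> q (t *\<^sub>R x)"
      by (rule cINF_lower[OF bdd q])
    also have "\<dots> \<le> t * q x"
      by (rule sublinear_scaleR_le[OF sub[OF q] t])
    finally show "(INF q\<in>C. q (t *\<^sub>R x)) / t \<le> q x"
      using t by (simp add: field_simps)
  qed
  then show "(INF q\<in>C. q (t *\<^sub>R x)) \<le> t * (INF q\<in>C. q x)"
    using t by (simp add: field_simps)
qed

text \<open>The competitor \<open>r\<close> is sublinear and below \<open>q\<close>, so minimality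
  gives \<open>r = q\<close>; its bound for \<open>t = 1\<close> is the claim.\<close>

lemma minimal_sublinear_additive:
  assumes q: "sublinear q" and min: "\<And>r. sublinear r \<Longrightarrow> r \<le> q \<Longrightarrow> r = q"
  shows "q x + q y \<le> q (x + y)"
proof -
  define r where "r x = (INF t\<in>{0..}. q (x + t *\<^sub>R y) - t * q y)" for x
  have ty: "q (t *\<^sub>R y) = t * q y" if "t \<ge> 0" for t
    using that sublinear_scaleR[OF q, of t y] sublinear_zero[OF q] by (cases "t = 0") auto
  have bdd: "bdd_below ((\<lambda>t. q (x + t *\<^sub>R y) - t * q y) ` {0..})" for x
  proof (rule bdd_belowI2)
    fix t :: real assume "t \<in> {0..}"
    then show "- q (- x) \<le> q (x + t *\<^sub>R y) - t * q y"
      using sublinear_add[OF q, of "x + t *\<^sub>R y" "- x"] ty[of t] by simp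
  qed
  have r_le: "r x \<le> q (x + t *\<^sub>R y) - t * q y" if "t \<ge> 0" for x t
    unfolding r_def using that by (intro cINF_lower[OF bdd]) simp
  have "sublinear r"
    unfolding sublinear_def
  proof (intro conjI allI impI)
    fix x x'
    have "r (x + x') - (q (x' + t' *\<^sub>R y) - t' * q y) \<le> q (x + t *\<^sub>R y) - t * q y"
      if "t \<ge> 0" "t' \<ge> 0" for t t'
      using r_le[of "t + t'" "x + x'"] that
        sublinear_add[OF q, of "x + t *\<^sub>R y" "x' + t' *\<^sub>R y"]
      by (simp add: algebra_simps)
    then have "r (x + x') - (q (x' + t' *\<^sub>R y) - t' * q y) \<le> r x" if "t' \<ge> 0" for t'
      unfolding r_def[of x] using that by (intro cINF_greatest) auto
    then have "r (x + x') - r x \<le> q (x' + t' *\<^sub>R y) - t' * q y" if "t' \<ge> 0" for t'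
      using that by (simp add: algebra_simps)
    then have "r (x + x') - r x \<le> r x'"
      unfolding r_def[of x'] by (intro cINF_greatest) auto
    then show "r (x + x') \<le> r x + r x'" by simp
  next
    fix s :: real and x assume s: "s > 0"
    have "r (s *\<^sub>R x) / s \<le> q (x + t *\<^sub>R y) - t * q y" if "t \<ge> 0" for t
    proof -
      have "r (s *\<^sub>R x) \<le> q (s *\<^sub>R (x + t *\<^sub>R y)) - s * t * q y"
        using r_le[of "s * t" "s *\<^sub>R x"] that s by (simp add: algebra_simps)
      also have "q (s *\<^sub>R (x + t *\<^sub>R y)) = s * q (x + t *\<^sub>R y)"
        by (rule sublinear_scaleR[OF q s])
      finally show ?thesis using s by (simp add: field_simps)
    qed
    then have "r (s *\<^sub>R x) / s \<le> r x"
      unfolding r_def[of x] by (intro cINF_greatest) auto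
    then show "r (s *\<^sub>R x) \<le> s * r x"
      using s by (simp add: field_simps)
  qed
  moreover have "r \<le> q"
    using r_le[of 0] by (simp add: le_fun_def)
  ultimately have "r = q" by (rule min)
  then show ?thesis
    using r_le[of 1 x] by simp
qed

text \<open>Hahn-Banach in the form: Zorn's lemma gives a minimal sublinear functional below
  \<open>p\<close>, and minimal ones are linear.\<close>

lemma sublinear_dominates_linear:
  fixes p :: "'v :: real_vector \<Rightarrow> real"
  assumes p: "sublinear p"
  obtains g where "linear g" "\<And>x. g x \<le> p x"
proof -
  define Q where "Q = {q. sublinear q \<and> q \<le> p}"
  \<comment> \<open>The order is reversed because \<open>predicate_Zorn\<close> yields maximal
    elements.\<close>
  define ord where "ord = (\<lambda>q r :: 'v \<Rightarrow> real. r \<le> q)"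
  have "\<exists>m\<in>Q. \<forall>q\<in>Q. ord m q \<longrightarrow> q = m"
  proof (rule predicate_Zorn)
    show "partial_order_on Q (relation_of ord Q)"
      by (auto simp: partial_order_on_def preorder_on_def refl_on_def trans_def antisym_def
          relation_of_def ord_def)
    fix C assume C: "C \<in> Chains (relation_of ord Q)"
    have CQ: "C \<subseteq> Q" and tot: "\<And>q r. q \<in> C \<Longrightarrow> r \<in> C \<Longrightarrow> q \<le> r \<or> r \<le> q"
      using C by (auto simp: Chains_def relation_of_def ord_def)
    show "\<exists>u\<in>Q. \<forall>q\<in>C. ord q u"
    proof (cases "C = {}")
      case True
      then show ?thesis using p by (auto simp: Q_def)
    next
      case False
      have bdd: "bdd_below ((\<lambda>q. q x) ` C)" for x
      proof (rule bdd_belowI2)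
        fix q assume "q \<in> C"
        then have "sublinear q" "q (- x) \<le> p (- x)"
          using CQ by (auto simp: Q_def le_fun_def)
        then show "- p (- x) \<le> q x"
          using sublinear_minus[of q x] by linarith
      qed
      let ?u = "\<lambda>x. INF q\<in>C. q x"
      have le: "?u \<le> q" if "q \<in> C" for q
        using cINF_lower[OF bdd that] by (simp add: le_fun_def)
      have "sublinear ?u"
        by (rule sublinear_INF_chain) (use CQ False tot bdd in \<open>auto simp: Q_def\<close>)
      moreover have "?u \<le> p"
        using False le CQ by (force simp: Q_def intro: order_trans)
      ultimately show ?thesis
        using le by (auto simp: Q_def ord_def)
    qed
  qed
  then obtain g where g: "sublinear g" "g \<le> p" and "\<And>r. sublinear r \<Longrightarrow> r \<le> g \<Longrightarrow> r = g"
    unfolding Q_def ord_def by (auto intro: order_trans)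
  then have add: "g (x + y) = g x + g y" for x y
    using minimal_sublinear_additive[of g x y] sublinear_add[of g x y] by (simp add: order.antisym)
  have minus: "g (- x) = - g x" for x
    using add[of x "- x"] sublinear_zero[OF g(1)] by simp
  have "g (t *\<^sub>R x) = t * g x" for t x
  proof (cases t "0 :: real" rule: linorder_cases)
    case less
    then have "g ((- t) *\<^sub>R x) = (- t) * g x"
      by (intro sublinear_scaleR g) simp
    then show ?thesis by (simp add: minus)
  qed (auto simp: sublinear_zero[OF g(1)] sublinear_scaleR[OF g(1)])
  then have "linear g"
    by (intro linearI) (simp_all add: add)
  then show ?thesis
    using that g(2) by (auto simp: le_fun_def)
qed

text \<open>The order-unit hypothesis makes \<open>\<lambda>v. INF e. f e\<close>, over the \<open>e \<in> E\<close> dominating \<open>v\<close>, a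
  finite sublinear functional; any linear functional below it extends \<open>f\<close> positively.\<close>

lemma Krein_extension:
  fixes f :: "'v :: real_vector \<Rightarrow> real"
  assumes E: "subspace E"
    and f_add: "\<And>x y. x \<in> E \<Longrightarrow> y \<in> E \<Longrightarrow> f (x + y) = f x + f y"
    and f_scale: "\<And>t x. x \<in> E \<Longrightarrow> f (t *\<^sub>R x) = t * f x"
    and P_add: "\<And>x y. x \<in> P \<Longrightarrow> y \<in> P \<Longrightarrow> x + y \<in> P"
    and P_scale: "\<And>t x. t \<ge> 0 \<Longrightarrow> x \<in> P \<Longrightarrow> t *\<^sub>R x \<in> P"
    and f_pos: "\<And>x. x \<in> E \<Longrightarrow> x \<in> P \<Longrightarrow> 0 \<le> f x"
    and unit: "\<And>v. \<exists>e\<in>E. e - v \<in> P"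
  obtains g where "linear g" "\<And>x. x \<in> E \<Longrightarrow> g x = f x" "\<And>x. x \<in> P \<Longrightarrow> 0 \<le> g x"
proof -
  define D where "D v = {e \<in> E. e - v \<in> P}" for v
  define p where "p v = Inf (f ` D v)" for v
  have zP: "0 \<in> P" using unit[of 0] P_scale[of 0] by auto
  have ne: "D v \<noteq> {}" for v
    using unit[of v] by (auto simp: D_def)
  have f_minus: "f (- x) = - f x" if "x \<in> E" for x
    using f_scale[OF that, of "-1"] by simp
  have bdd: "bdd_below (f ` D v)" for v
  proof -
    obtain e' where e': "e' \<in> E" "e' - (- v) \<in> P" using unit by blast
    show ?thesis
    proof (rule bdd_belowI2)
      fix e assume "e \<in> D v"
      then have e: "e \<in> E" "e - v \<in> P" by (auto simp: D_def)
      have "e + e' \<in> P" using P_add[OF e(2) e'(2)] by simp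
      then have "0 \<le> f (e + e')" using E e e' by (intro f_pos) (auto simp: subspace_add)
      then show "- f e' \<le> f e" using f_add e e' by simp
    qed
  qed
  have p_le: "p v \<le> f e" if "e \<in> D v" for v e
    unfolding p_def using that by (intro cInf_lower bdd) auto
  have p_ge: "c \<le> p v" if "\<And>e. e \<in> D v \<Longrightarrow> c \<le> f e" for v c
    unfolding p_def using ne that by (intro cInf_greatest) auto
  have "sublinear p"
    unfolding sublinear_def
  proof (intro conjI allI impI)
    fix x y
    have "p (x + y) - f e' \<le> f e" if "e \<in> D x" "e' \<in> D y" for e e'
    proof -
      have "e + e' \<in> D (x + y)"
        using that E P_add[of "e - x" "e' - y"] by (auto simp: D_def subspace_add algebra_simps)
      then show ?thesis
        using p_le[of "e + e'" "x + y"] f_add that by (auto simp: D_def)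
    qed
    then have "p (x + y) - f e' \<le> p x" if "e' \<in> D y" for e'
      using that by (intro p_ge) auto
    then have "p (x + y) - p x \<le> f e'" if "e' \<in> D y" for e'
      using that by (simp add: algebra_simps)
    then have "p (x + y) - p x \<le> p y" by (intro p_ge)
    then show "p (x + y) \<le> p x + p y" by simp
  next
    fix t :: real and x assume t: "t > 0"
    have "p (t *\<^sub>R x) / t \<le> f e" if "e \<in> D x" for e
    proof -
      have "t *\<^sub>R e \<in> D (t *\<^sub>R x)"
        using that E P_scale[of t "e - x"] t by (auto simp: D_def subspace_scale algebra_simps)
      then show ?thesis
        using p_le[of "t *\<^sub>R e" "t *\<^sub>R x"] f_scale[of e t] that t by (auto simp: D_def field_simps)
    qed
    then have "p (t *\<^sub>R x) / t \<le> p x" by (intro p_ge)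
    then show "p (t *\<^sub>R x) \<le> t * p x" using t by (simp add: field_simps)
  qed
  then obtain g where g: "linear g" "\<And>x. g x \<le> p x"
    by (rule sublinear_dominates_linear) blast
  have le: "g x \<le> f x" if "x \<in> E" for x
    using g(2)[of x] p_le[of x x] that zP by (simp add: D_def)
  show ?thesis
  proof (rule that)
    show "g x = f x" if "x \<in> E" for x
      using le[OF that] le[of "- x"] f_minus[OF that] that E
      by (simp add: subspace_neg linear_neg[OF g(1)])
    show "0 \<le> g x" if "x \<in> P" for x
    proof -
      have "f 0 = 0" using f_scale[of 0 0] E by (simp add: subspace_0)
      \<comment> \<open>For \<open>x\<close> in the cone, \<open>0\<close> is an element of
        \<open>E\<close> dominating \<open>- x\<close>.\<close>
      then have "g (- x) \<le> 0"
        using g(2)[of "- x"] p_le[of 0 "- x"] that E by (simp add: D_def subspace_0)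
      then show ?thesis by (simp add: linear_neg[OF g(1)])
    qed
  qed fact
qed

section \<open>Matrices of operators\<close>

instantiation "fun" :: (type, complex_vector) complex_vector
begin

definition scaleC_fun :: "complex \<Rightarrow> ('a \<Rightarrow> 'b) \<Rightarrow> 'a \<Rightarrow> 'b" where
  "scaleC_fun c f = (\<lambda>x. c *\<^sub>C f x)"

instance
  by standard (auto simp: scaleC_fun_def fun_eq_iff scaleC_add_right scaleC_add_left
      scaleC_scaleC scaleC_of_real)

end

lemma scaleC_fun_apply [simp]: "(c *\<^sub>C f) x = c *\<^sub>C f x"
  by (simp add: scaleC_fun_def)

section \<open>Tuples of vectors and the action of operator matrices\<close>

definition tinner :: "nat \<Rightarrow> (nat \<Rightarrow> 'a :: chilbert_space) \<Rightarrow> (nat \<Rightarrow> 'a) \<Rightarrow> complex" where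
  "tinner n \<xi> \<eta> = (\<Sum>i<n. cinner (\<xi> i) (\<eta> i))"

definition tnorm :: "nat \<Rightarrow> (nat \<Rightarrow> 'a :: chilbert_space) \<Rightarrow> real" where
  "tnorm n \<xi> = L2_set (\<lambda>i. norm (\<xi> i)) {..<n}"

text \<open>The row index \<open>i\<close> is not cut off at \<open>n\<close>, so that algebraic
  laws hold as equations between functions; the cut-off is left to \<open>tinner\<close> and
  \<open>tnorm\<close>.\<close>

definition mat_app ::
    "nat \<Rightarrow> (nat \<Rightarrow> nat \<Rightarrow> 'a :: chilbert_space \<Rightarrow>\<^sub>L 'a) \<Rightarrow> (nat \<Rightarrow> 'a) \<Rightarrow> nat \<Rightarrow> 'a" where
  "mat_app n X \<xi> i = (\<Sum>j<n. blinfun_apply (X i j) (\<xi> j))"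

lemma tinner_simps:
  "tinner n (\<xi> + \<xi>') \<eta> = tinner n \<xi> \<eta> + tinner n \<xi>' \<eta>"
  "tinner n \<eta> (\<xi> + \<xi>') = tinner n \<eta> \<xi> + tinner n \<eta> \<xi>'"
  "tinner n (\<xi> - \<xi>') \<eta> = tinner n \<xi> \<eta> - tinner n \<xi>' \<eta>"
  "tinner n \<eta> (\<xi> - \<xi>') = tinner n \<eta> \<xi> - tinner n \<eta> \<xi>'"
  "tinner n (- \<xi>) \<eta> = - tinner n \<xi> \<eta>"
  "tinner n (c *\<^sub>C \<xi>) \<eta> = c * tinner n \<xi> \<eta>"
  "tinner n \<eta> (c *\<^sub>C \<xi>) = cnj c * tinner n \<eta> \<xi>"
  "tinner n (r *\<^sub>R \<xi>) \<eta> = r * tinner n \<xi> \<eta>"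
  "tinner n \<eta> (r *\<^sub>R \<xi>) = r * tinner n \<eta> \<xi>"
  by (simp_all add: tinner_def cinner_simps sum.distrib sum_subtractf sum_negf sum_distrib_left)

lemma tinner_commute: "tinner n \<xi> \<eta> = cnj (tinner n \<eta> \<xi>)"
  unfolding tinner_def cnj_sum by (subst cinner_commute) simp

lemma tnorm_nonneg [simp]: "0 \<le> tnorm n \<xi>"
  by (simp add: tnorm_def)

lemma tinner_self: "tinner n \<xi> \<xi> = complex_of_real ((tnorm n \<xi>)\<^sup>2)"
  by (simp add: tinner_def tnorm_def cinner_self L2_set_def sum_nonneg)

interpretation tuple_form: psd_form "\<lambda>\<xi> \<eta> :: nat \<Rightarrow> 'a :: chilbert_space. Re (tinner n \<xi> \<eta>)" for n
proof
  show "Re (tinner n \<xi> \<eta>) = Re (tinner n \<eta> \<xi>)" for \<xi> \<eta> :: "nat \<Rightarrow> 'a"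
    by (subst tinner_commute) simp
qed (simp_all add: tinner_simps tinner_self)

lemma tuple_form_nrm [simp]: "tuple_form.nrm n \<xi> = tnorm n \<xi>"
  by (simp add: tuple_form.nrm_def tinner_self)

lemma tnorm_square: "(tnorm n \<xi>)\<^sup>2 = Re (tinner n \<xi> \<xi>)"
  by (simp add: tinner_self)

lemma tnorm_cong: "(\<And>i. i < n \<Longrightarrow> \<xi> i = \<eta> i) \<Longrightarrow> tnorm n \<xi> = tnorm n \<eta>"
  by (auto simp: tnorm_def intro!: L2_set_cong)

lemma norm_le_tnorm: "i < n \<Longrightarrow> norm (\<xi> i) \<le> tnorm n \<xi>"
  unfolding tnorm_def by (intro member_le_L2_set) auto

lemma tnorm_scaleC: "tnorm n (c *\<^sub>C \<xi>) = cmod c * tnorm n \<xi>"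
  by (simp add: tnorm_def norm_scaleC L2_set_right_distrib)

lemma mat_app_simps:
  "mat_app n (X + Y) \<xi> = mat_app n X \<xi> + mat_app n Y \<xi>"
  "mat_app n (X - Y) \<xi> = mat_app n X \<xi> - mat_app n Y \<xi>"
  "mat_app n (- X) \<xi> = - mat_app n X \<xi>"
  "mat_app n (c *\<^sub>C X) \<xi> = c *\<^sub>C mat_app n X \<xi>"
  "mat_app n (r *\<^sub>R X) \<xi> = r *\<^sub>R mat_app n X \<xi>"
  by (simp_all add: mat_app_def fun_eq_iff blinfun.add_left blinfun.diff_left blinfun.minus_left
      blinfun.scaleR_left sum.distrib sum_subtractf sum_negf complex_vector.scale_sum_right
      scaleR_sum_right)

lemma mat_app_add_right: "mat_app n X (\<xi> + \<eta>) = mat_app n X \<xi> + mat_app n X \<eta>"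
  by (simp add: mat_app_def fun_eq_iff blinfun.add_right sum.distrib)

lemma mat_app_scaleR_right: "mat_app n X (r *\<^sub>R \<xi>) = r *\<^sub>R mat_app n X \<xi>"
  by (simp add: mat_app_def fun_eq_iff blinfun.scaleR_right scaleR_sum_right)

lemma mat_app_bounded: "\<exists>R>0. \<forall>\<xi>. tnorm n (mat_app n X \<xi>) \<le> R * tnorm n \<xi>"
proof (intro exI conjI allI)
  let ?R = "(\<Sum>i<n. \<Sum>j<n. norm (X i j))"
  show "?R + 1 > 0" by (intro add_nonneg_pos sum_nonneg) auto
  fix \<xi>
  have "tnorm n (mat_app n X \<xi>) \<le> (\<Sum>i<n. norm (mat_app n X \<xi> i))"
    unfolding tnorm_def by (rule L2_set_le_sum) simp
  also have "\<dots> \<le> (\<Sum>i<n. \<Sum>j<n. norm (X i j) * tnorm n \<xi>)"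
    unfolding mat_app_def
    by (intro sum_mono order_trans[OF norm_sum] order_trans[OF norm_blinfun] mult_left_mono
        norm_le_tnorm) auto
  also have "\<dots> = ?R * tnorm n \<xi>"
    by (simp add: sum_distrib_right)
  also have "\<dots> \<le> (?R + 1) * tnorm n \<xi>"
    by (intro mult_right_mono) auto
  finally show "tnorm n (mat_app n X \<xi>) \<le> (?R + 1) * tnorm n \<xi>" .
qed

lemma op_matrix_pos_iff: "op_matrix_pos n X \<longleftrightarrow> (\<forall>\<xi>. 0 \<le> tinner n (mat_app n X \<xi>) \<xi>)"
  by (simp add: op_matrix_pos_def tinner_def mat_app_def)

text \<open>This cone has the order unit that Krein's extension requires
  (\<open>accretive_order_unit\<close>): a multiple of the identity minus any matrix, hermitian or
  not, becomes accretive.\<close>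

definition accretive :: "nat \<Rightarrow> (nat \<Rightarrow> nat \<Rightarrow> 'a :: chilbert_space \<Rightarrow>\<^sub>L 'a) \<Rightarrow> bool" where
  "accretive n X \<longleftrightarrow> (\<forall>\<xi>. 0 \<le> Re (tinner n (mat_app n X \<xi>) \<xi>))"

text \<open>Accretivity of both \<open>\<i> *\<^sub>C X\<close> and its negative forces the form of
  \<open>X\<close> to be real.\<close>

lemma op_matrix_pos_iff_accretive:
  "op_matrix_pos n X \<longleftrightarrow> accretive n X \<and> accretive n (\<i> *\<^sub>C X) \<and> accretive n (- \<i> *\<^sub>C X)"
  unfolding op_matrix_pos_iff accretive_def mat_app_simps(4) tinner_simps(6)
  by (auto simp: less_eq_complex_def intro: antisym)

definition id_mat :: "nat \<Rightarrow> nat \<Rightarrow> 'a :: chilbert_space \<Rightarrow>\<^sub>L 'a" where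
  "id_mat i j = (if i = j then id_blinfun else 0)"

definition mat_adj ::
    "(nat \<Rightarrow> nat \<Rightarrow> 'a :: chilbert_space \<Rightarrow>\<^sub>L 'a) \<Rightarrow> nat \<Rightarrow> nat \<Rightarrow> 'a \<Rightarrow>\<^sub>L 'a" where
  "mat_adj X i j = cadjoint (X j i)"

definition mats :: "nat \<Rightarrow> ('a :: chilbert_space \<Rightarrow>\<^sub>L 'a) set \<Rightarrow> (nat \<Rightarrow> nat \<Rightarrow> 'a \<Rightarrow>\<^sub>L 'a) set" where
  "mats n S = {X. \<forall>i<n. \<forall>j<n. X i j \<in> S}"

lemma mat_app_id: "i < n \<Longrightarrow> mat_app n id_mat \<xi> i = \<xi> i"
proof -
  assume "i < n"
  moreover have "blinfun_apply (id_mat i j) (\<xi> j) = (if j = i then \<xi> j else 0)" for j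
    by (simp add: id_mat_def)
  ultimately show ?thesis by (simp add: mat_app_def)
qed

lemma tinner_mat_app_id [simp]: "tinner n (mat_app n id_mat \<xi>) \<eta> = tinner n \<xi> \<eta>"
  by (simp add: tinner_def mat_app_id)

lemma tinner_mat_adj:
  assumes "X \<in> mats n bounded_ops"
  shows "tinner n (mat_app n (mat_adj X) \<xi>) \<eta> = tinner n \<xi> (mat_app n X \<eta>)"
proof -
  have "tinner n (mat_app n (mat_adj X) \<xi>) \<eta> = (\<Sum>i<n. \<Sum>j<n. cinner (\<xi> j) (X j i (\<eta> i)))"
    using assms by (simp add: tinner_def mat_app_def mat_adj_def cinner_sum_left mats_def
        cinner_cadjoint_left)
  also have "\<dots> = (\<Sum>j<n. \<Sum>i<n. cinner (\<xi> j) (X j i (\<eta> i)))"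
    by (rule sum.swap)
  finally show ?thesis
    by (simp add: tinner_def mat_app_def cinner_sum_right)
qed

definition operator_system :: "('a :: chilbert_space \<Rightarrow>\<^sub>L 'a) set \<Rightarrow> bool" where
  "operator_system S \<longleftrightarrow> S \<subseteq> bounded_ops \<and> complex_vector.subspace S \<and> id_blinfun \<in> S \<and>
     (\<forall>T\<in>S. cadjoint T \<in> S)"

lemma operator_system_cstar_subalgebra: "unital_cstar_subalgebra \<A> \<Longrightarrow> operator_system \<A>"
  by (simp add: operator_system_def unital_cstar_subalgebra_def)

lemma mats_mono: "S \<subseteq> S' \<Longrightarrow> mats n S \<subseteq> mats n S'"
  by (auto simp: mats_def)

lemma mats_closed:
  assumes "operator_system S" "X \<in> mats n S" "Y \<in> mats n S"
  shows "X + Y \<in> mats n S" "X - Y \<in> mats n S" "c *\<^sub>C X \<in> mats n S" "mat_adj X \<in> mats n S"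
    "id_mat \<in> mats n S" "- X \<in> mats n S" "r *\<^sub>R X \<in> mats n S"
  using assms by (auto simp: mats_def operator_system_def mat_adj_def id_mat_def
      complex_vector.subspace_add complex_vector.subspace_diff complex_vector.subspace_scale
      complex_vector.subspace_0 complex_vector.subspace_neg simp flip: scaleC_of_real)

lemma tinner_mat_app_le:
  assumes "\<And>\<xi>. tnorm n (mat_app n X \<xi>) \<le> R * tnorm n \<xi>"
  shows "\<bar>Re (tinner n (mat_app n X \<xi>) \<xi>)\<bar> \<le> R * (tnorm n \<xi>)\<^sup>2"
proof -
  have "\<bar>Re (tinner n (mat_app n X \<xi>) \<xi>)\<bar> \<le> tnorm n (mat_app n X \<xi>) * tnorm n \<xi>"
    using tuple_form.abs_le_nrm[of n "mat_app n X \<xi>" \<xi>] by simp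
  also have "\<dots> \<le> R * tnorm n \<xi> * tnorm n \<xi>"
    by (intro mult_right_mono assms) simp
  finally show ?thesis by (simp add: power2_eq_square mult.assoc)
qed

lemma accretive_order_unit: "\<exists>r>0. accretive n (r *\<^sub>R id_mat - X)"
proof -
  obtain R where "R > 0" and R: "\<And>\<xi>. tnorm n (mat_app n X \<xi>) \<le> R * tnorm n \<xi>"
    using mat_app_bounded by blast
  show ?thesis
  proof (intro exI conjI)
    show "accretive n (R *\<^sub>R id_mat - X)"
      unfolding accretive_def
    proof
      fix \<xi>
      show "0 \<le> Re (tinner n (mat_app n (R *\<^sub>R id_mat - X) \<xi>) \<xi>)"
        using tinner_mat_app_le[of n X R \<xi>, OF R]
        by (simp add: mat_app_simps tinner_simps tinner_self flip: of_real_power)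
    qed
  qed fact
qed

text \<open>Used for the functional that encodes a map into a matrix algebra and, with
  \<open>n = 1\<close>, for a positive map followed by a vector functional.\<close>

locale positive_functional =
  fixes n :: nat and S :: "('h :: chilbert_space \<Rightarrow>\<^sub>L 'h) set"
    and s :: "(nat \<Rightarrow> nat \<Rightarrow> 'h \<Rightarrow>\<^sub>L 'h) \<Rightarrow> complex"
  assumes S: "operator_system S"
    and s_add: "\<And>X Y. X \<in> mats n S \<Longrightarrow> Y \<in> mats n S \<Longrightarrow> s (X + Y) = s X + s Y"
    and s_scaleC: "\<And>c X. X \<in> mats n S \<Longrightarrow> s (c *\<^sub>C X) = c * s X"
    and s_pos: "\<And>X. X \<in> mats n S \<Longrightarrow> op_matrix_pos n X \<Longrightarrow> 0 \<le> s X"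
begin

lemma mats_bounded: "X \<in> mats n S \<Longrightarrow> X \<in> mats n bounded_ops"
  using S by (auto simp: mats_def operator_system_def)

lemma s_minus: "X \<in> mats n S \<Longrightarrow> s (- X) = - s X"
  using s_scaleC[of X "-1"] by (simp add: scaleC_minus_one)

lemma s_scaleR: "X \<in> mats n S \<Longrightarrow> s (r *\<^sub>R X) = r * s X"
  using s_scaleC[of X "complex_of_real r"] by (simp only: scaleC_of_real)

lemma id_in: "id_mat \<in> mats n S"
  using S by (auto simp: mats_def operator_system_def id_mat_def complex_vector.subspace_0)

text \<open>Adding a multiple of the identity makes a hermitian matrix positive, and
  \<open>s\<close> is real both there and at the identity.\<close>

lemma s_hermitian_real:
  assumes X: "X \<in> mats n S" and herm: "\<And>\<xi>. Im (tinner n (mat_app n X \<xi>) \<xi>) = 0"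
  shows "Im (s X) = 0"
proof -
  obtain r where "r > 0" and r: "accretive n (r *\<^sub>R id_mat - (- X))"
    using accretive_order_unit by blast
  have "op_matrix_pos n (r *\<^sub>R id_mat + X)"
    using r herm
    by (auto simp: op_matrix_pos_iff accretive_def less_eq_complex_def mat_app_simps tinner_simps
        tinner_self simp flip: of_real_power)
  then have "0 \<le> s (r *\<^sub>R id_mat + X)"
    using mats_closed[OF S] X id_in by (intro s_pos) auto
  moreover have "0 \<le> s id_mat"
    by (intro s_pos id_in) (simp add: op_matrix_pos_iff tinner_self less_eq_complex_def)
  moreover have "s (r *\<^sub>R id_mat + X) = r * s id_mat + s X"
    using mats_closed[OF S] X id_in by (simp add: s_add s_scaleR)
  ultimately show ?thesis by (simp add: less_eq_complex_def)
qed

lemma tinner_mat_adj_self: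
  assumes X: "X \<in> mats n S"
  shows "tinner n (mat_app n (mat_adj X) \<xi>) \<xi> = cnj (tinner n (mat_app n X \<xi>) \<xi>)"
  unfolding tinner_mat_adj[OF mats_bounded[OF X]] by (rule tinner_commute)

text \<open>The sum of \<open>X\<close> and its adjoint, and \<open>\<i>\<close> times their
  difference, are hermitian; reality of \<open>s\<close> at these two matrices gives the two
  components of the claim.\<close>

lemma s_mat_adj:
  assumes X: "X \<in> mats n S"
  shows "s (mat_adj X) = cnj (s X)"
proof (rule complex_eqI)
  note cl = mats_closed[OF S] X
  have "Im (s (X + mat_adj X)) = 0"
    by (rule s_hermitian_real)
      (use cl tinner_mat_adj_self[OF X] in \<open>auto simp: mat_app_simps tinner_simps\<close>)
  moreover have "s (X + mat_adj X) = s X + s (mat_adj X)"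
    using cl by (simp add: s_add)
  ultimately show "Im (s (mat_adj X)) = Im (cnj (s X))" by simp
  have "Im (s (\<i> *\<^sub>C (X + - mat_adj X))) = 0"
    by (rule s_hermitian_real)
      (use cl tinner_mat_adj_self[OF X] in \<open>auto simp: mat_app_simps tinner_simps\<close>)
  moreover have "s (\<i> *\<^sub>C (X + - mat_adj X)) = \<i> * (s X + - s (mat_adj X))"
    using cl by (simp add: s_add s_scaleC s_minus del: add_uminus_conv_diff)
  ultimately show "Re (s (mat_adj X)) = Re (cnj (s X))" by simp
qed

lemma s_accretive:
  assumes X: "X \<in> mats n S" and "accretive n X"
  shows "0 \<le> Re (s X)"
proof -
  have "op_matrix_pos n (X + mat_adj X)"
    using assms tinner_mat_adj_self[OF X]
    by (auto simp: op_matrix_pos_iff accretive_def less_eq_complex_def mat_app_simps tinner_simps)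
  then have "0 \<le> s (X + mat_adj X)"
    using mats_closed[OF S] X by (intro s_pos) auto
  also have "s (X + mat_adj X) = s X + cnj (s X)"
    using mats_closed[OF S] X by (simp add: s_add s_mat_adj)
  finally show ?thesis by (simp add: less_eq_complex_def)
qed

text \<open>The real part of \<open>s\<close> is nonnegative on accretive matrices, so Krein extends
  it to a real functional \<open>g\<close>. As in the complex Hahn-Banach theorem, \<open>g\<close>
  is the real part of a complex-linear \<open>t\<close>. At a positive \<open>X\<close>, accretivity
  of both imaginary multiples makes the imaginary part of \<open>t X\<close> zero.\<close>

lemma extension:
  obtains t where "\<And>X Y. t (X + Y) = t X + t Y" "\<And>c X. t (c *\<^sub>C X) = c * t X"
    "\<And>X. X \<in> mats n S \<Longrightarrow> t X = s X" "\<And>X. op_matrix_pos n X \<Longrightarrow> 0 \<le> t X"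
proof -
  have "\<exists>g. linear g \<and> (\<forall>X\<in>mats n S. g X = Re (s X)) \<and> (\<forall>X. accretive n X \<longrightarrow> 0 \<le> g X)"
  proof (rule Krein_extension[of "mats n S" "\<lambda>X. Re (s X)" "{X. accretive n X}"])
    show "subspace (mats n S)"
      using S by (auto simp: subspace_def mats_def operator_system_def complex_vector.subspace_0
          complex_vector.subspace_add complex_vector.subspace_scale simp flip: scaleC_of_real)
    fix X :: "nat \<Rightarrow> nat \<Rightarrow> 'h \<Rightarrow>\<^sub>L 'h"
    obtain r where "accretive n (r *\<^sub>R id_mat - X)"
      using accretive_order_unit by blast
    then show "\<exists>e\<in>mats n S. e - X \<in> {X. accretive n X}"
      using mats_closed(7)[OF S id_in id_in] by auto
  qed (auto simp: s_add s_scaleR s_accretive accretive_def mat_app_simps tinner_simps)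
  then obtain g where g: "linear g" "\<And>X. X \<in> mats n S \<Longrightarrow> g X = Re (s X)"
    "\<And>X. accretive n X \<Longrightarrow> 0 \<le> g X" by blast
  define t where "t X = Complex (g X) (- g (\<i> *\<^sub>C X))" for X
  note lin = linear_add[OF g(1)] linear_scale[OF g(1)] linear_neg[OF g(1)]
  show ?thesis
  proof
    show "t (X + Y) = t X + t Y" for X Y
      by (simp add: t_def lin scaleC_add_right complex_eq_iff)
    show "t (c *\<^sub>C X) = c * t X" for c X
    proof -
      have c: "c *\<^sub>C Y = Re c *\<^sub>R Y + Im c *\<^sub>R (\<i> *\<^sub>C Y)" for Y :: "nat \<Rightarrow> nat \<Rightarrow> 'h \<Rightarrow>\<^sub>L 'h"
        by (simp add: scaleC_scaleC complex_eq mult.commute flip: scaleC_of_real scaleC_add_left)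
      have "\<i> *\<^sub>C \<i> *\<^sub>C X = - X"
        by (simp add: scaleC_scaleC scaleC_minus_one)
      then have "\<i> *\<^sub>C c *\<^sub>C X = Re c *\<^sub>R (\<i> *\<^sub>C X) + Im c *\<^sub>R (- X)"
        using c[of "\<i> *\<^sub>C X"] by (simp add: scaleC_scaleC mult.commute)
      then have "g (\<i> *\<^sub>C c *\<^sub>C X) = Re c * g (\<i> *\<^sub>C X) - Im c * g X"
        by (simp only: lin) simp
      moreover have "g (c *\<^sub>C X) = Re c * g X + Im c * g (\<i> *\<^sub>C X)"
        by (subst c) (simp add: lin)
      ultimately show ?thesis
        by (simp add: t_def complex_eq_iff algebra_simps)
    qed
    show "t X = s X" if "X \<in> mats n S" for X
      using that mats_closed(3)[OF S that that]
      by (simp add: t_def g(2) s_scaleC complex_eq_iff)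
    show "0 \<le> t X" if "op_matrix_pos n X" for X
    proof -
      have "accretive n X" "accretive n (\<i> *\<^sub>C X)" "accretive n (- (\<i> *\<^sub>C X))"
        using that by (auto simp: op_matrix_pos_iff_accretive complex_vector.scale_minus_left)
      then have "0 \<le> g X" "0 \<le> g (\<i> *\<^sub>C X)" "0 \<le> g (- (\<i> *\<^sub>C X))"
        by (auto intro: g(3))
      then show ?thesis by (simp add: t_def less_eq_complex_def lin)
    qed
  qed
qed

end

section \<open>Completely positive maps into matrix algebras\<close>

text \<open>If \<open>G a b\<close> are the entries of a map into the \<open>k\<close> by
  \<open>k\<close> matrices, this is the quadratic form of its amplification at \<open>X\<close>,
  evaluated at the vector whose \<open>i\<close>-th block is \<open>z i\<close>.\<close>

definition quad ::
    "nat \<Rightarrow> nat \<Rightarrow> (nat \<Rightarrow> nat \<Rightarrow> 'a \<Rightarrow> complex) \<Rightarrow> (nat \<Rightarrow> nat \<Rightarrow> 'a) \<Rightarrow> (nat \<Rightarrow> nat \<Rightarrow> complex) \<Rightarrow> complex"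
  where "quad k n G X z =
    (\<Sum>i<n. \<Sum>j<n. \<Sum>a<k. \<Sum>b<k. G a b (X i j) * z j b * cnj (z i a))"

lemma quad_cong:
  assumes "\<And>i j a b. i < n \<Longrightarrow> j < n \<Longrightarrow> a < k \<Longrightarrow> b < k \<Longrightarrow> G a b (X i j) = G' a b (X' i j)"
  shows "quad k n G X z = quad k n G' X' z"
  unfolding quad_def using assms by (intro sum.cong) auto

text \<open>The blocks of this vector are the standard basis vectors; there the quadratic form
  becomes the functional that encodes the map.\<close>

lemma quad_delta: "quad k k G X (\<lambda>j b. if b = j then 1 else 0) = (\<Sum>a<k. \<Sum>b<k. G a b (X a b))"
proof -
  have "(\<Sum>a<k. \<Sum>b<k. G a b (X i j) * (if b = j then 1 else 0) * cnj (if a = i then 1 else 0))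
      = G i j (X i j)" if "i < k" "j < k" for i j
  proof -
    have "(\<Sum>b<k. G a b (X i j) * (if b = j then 1 else 0) * cnj (if a = i then 1 else 0))
        = (if a = i then G a j (X i j) else 0)" for a
    proof -
      have "(\<Sum>b<k. G a b (X i j) * (if b = j then 1 else 0) * cnj (if a = i then 1 else 0))
          = (\<Sum>b<k. if b = j then (if a = i then G a j (X i j) else 0) else 0)"
        by (intro sum.cong) auto
      also have "\<dots> = (if a = i then G a j (X i j) else 0)"
        using that(2) by simp
      finally show ?thesis .
    qed
    then show ?thesis using that(1) by simp
  qed
  then show ?thesis unfolding quad_def by (intro sum.cong) auto
qed

lemma mat_matrix_pos_iff:
  assumes Y: "\<And>i j. i < n \<Longrightarrow> j < n \<Longrightarrow> Y i j \<in> carrier_mat k k"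
  shows "mat_matrix_pos k n Y \<longleftrightarrow> (\<forall>z. 0 \<le> quad k n (\<lambda>a b M. M $$ (a, b)) Y z)"
proof -
  have eq: "(Y i j *\<^sub>v v) \<bullet>c w = (\<Sum>a<k. \<Sum>b<k. Y i j $$ (a, b) * v $ b * cnj (w $ a))"
    if "i < n" "j < n" "v \<in> carrier_vec k" "w \<in> carrier_vec k" for i j v w
    using Y[OF that(1,2)] that(3,4)
    by (auto simp: scalar_prod_def atLeast0LessThan sum_distrib_right intro!: sum.cong)
  have quad_eq: "(\<Sum>i<n. \<Sum>j<n. (Y i j *\<^sub>v \<xi> j) \<bullet>c \<xi> i)
      = quad k n (\<lambda>a b M. M $$ (a, b)) Y (\<lambda>j b. \<xi> j $ b)"
    if "\<And>i. i < n \<Longrightarrow> \<xi> i \<in> carrier_vec k" for \<xi>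
    unfolding quad_def using that by (intro sum.cong refl eq) auto
  show ?thesis
  proof
    assume pos: "mat_matrix_pos k n Y"
    show "\<forall>z. 0 \<le> quad k n (\<lambda>a b M. M $$ (a, b)) Y z"
    proof
      fix z :: "nat \<Rightarrow> nat \<Rightarrow> complex"
      let ?\<xi> = "\<lambda>j. Matrix.vec k (z j)"
      have "0 \<le> (\<Sum>i<n. \<Sum>j<n. (Y i j *\<^sub>v ?\<xi> j) \<bullet>c ?\<xi> i)"
        using pos by (simp add: mat_matrix_pos_def)
      also have "\<dots> = quad k n (\<lambda>a b M. M $$ (a, b)) Y (\<lambda>j b. ?\<xi> j $ b)"
        by (rule quad_eq) simp
      also have "\<dots> = quad k n (\<lambda>a b M. M $$ (a, b)) Y z"
        unfolding quad_def by (intro sum.cong) auto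
      finally show "0 \<le> quad k n (\<lambda>a b M. M $$ (a, b)) Y z" .
    qed
  qed (simp add: mat_matrix_pos_def quad_eq)
qed

text \<open>UCP maps into a matrix algebra as families of scalar functionals, which keeps dimensions
  and carrier conditions out of the arguments; \<open>ucp_mat_map_entries\<close> and
  \<open>ucp_entries_mat_map\<close> translate.\<close>

definition ucp_entries ::
    "nat \<Rightarrow> ('h :: chilbert_space \<Rightarrow>\<^sub>L 'h) set \<Rightarrow> (nat \<Rightarrow> nat \<Rightarrow> ('h \<Rightarrow>\<^sub>L 'h) \<Rightarrow> complex) \<Rightarrow> bool" where
  "ucp_entries k S G \<longleftrightarrow>
     (\<forall>a<k. \<forall>b<k. clinear_on S (G a b) \<and> G a b id_blinfun = (if a = b then 1 else 0)) \<and>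
     (\<forall>n\<ge>1. \<forall>X\<in>mats n S. op_matrix_pos n X \<longrightarrow> (\<forall>z. 0 \<le> quad k n G X z))"

lemma ucp_mat_map_entries:
  assumes "ucp_mat_map k S \<phi>" "operator_system S"
  shows "ucp_entries k S (\<lambda>a b T. \<phi> T $$ (a, b))"
proof -
  have carr: "T \<in> S \<Longrightarrow> \<phi> T \<in> carrier_mat k k" for T
    using assms(1) by (auto simp: ucp_mat_map_def)
  have "clinear_on S (\<lambda>T. \<phi> T $$ (a, b))" if "a < k" "b < k" for a b
    using assms(1) that carr[THEN carrier_matD(1)] carr[THEN carrier_matD(2)]
    by (simp add: clinear_on_def ucp_mat_map_def scaleC_complex_def)
  moreover have "0 \<le> quad k n (\<lambda>a b T. \<phi> T $$ (a, b)) X z"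
    if "n \<ge> 1" "X \<in> mats n S" "op_matrix_pos n X" for n X z
  proof -
    have "mat_matrix_pos k n (\<lambda>i j. \<phi> (X i j))"
      using assms(1) that by (simp add: ucp_mat_map_def n_positive_on_def mats_def)
    then have "0 \<le> quad k n (\<lambda>a b M. M $$ (a, b)) (\<lambda>i j. \<phi> (X i j)) z"
      using that carr by (subst (asm) mat_matrix_pos_iff) (auto simp: mats_def)
    then show ?thesis by (simp add: quad_def)
  qed
  moreover have "\<phi> id_blinfun = 1\<^sub>m k"
    using assms(1) by (simp add: ucp_mat_map_def)
  ultimately show ?thesis by (simp add: ucp_entries_def)
qed

lemma ucp_entries_mat_map:
  assumes "ucp_entries k S G"
  shows "ucp_mat_map k S (\<lambda>T. mat k k (\<lambda>(a, b). G a b T))"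
proof -
  have lin: "clinear_on S (G a b)" if "a < k" "b < k" for a b
    using assms that by (simp add: ucp_entries_def)
  have "n_positive_on op_matrix_pos (mat_matrix_pos k) n S (\<lambda>T. mat k k (\<lambda>(a, b). G a b T))"
    if n: "n \<ge> 1" for n
    unfolding n_positive_on_def
  proof (intro allI impI)
    fix X assume X: "\<forall>i<n. \<forall>j<n. X i j \<in> S" "op_matrix_pos n X"
    have "0 \<le> quad k n (\<lambda>a b M. M $$ (a, b)) (\<lambda>i j. mat k k (\<lambda>(a, b). G a b (X i j))) z" for z
    proof -
      have "0 \<le> quad k n G X z"
        using assms n X by (simp add: ucp_entries_def mats_def)
      also have "\<dots> = quad k n (\<lambda>a b M. M $$ (a, b)) (\<lambda>i j. mat k k (\<lambda>(a, b). G a b (X i j))) z"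
        by (rule quad_cong) simp
      finally show ?thesis .
    qed
    then show "mat_matrix_pos k n (\<lambda>i j. mat k k (\<lambda>(a, b). G a b (X i j)))"
      by (subst mat_matrix_pos_iff) auto
  qed
  then show ?thesis
    using lin assms
    by (auto simp: ucp_mat_map_def clinear_on_def scaleC_complex_def ucp_entries_def
        intro!: eq_matI)
qed

lemma matrix_range_level_eq:
  assumes "\<forall>i. A i \<in> bounded_ops"
  shows "matrix_range_level n A =
    {\<lambda>i. mat n n (\<lambda>(a, b). G a b (A i)) | G. ucp_entries n (cstar_algebra A) G}"
proof (intro equalityI subsetI)
  fix W assume "W \<in> matrix_range_level n A"
  then obtain \<phi> where \<phi>: "ucp_mat_map n (cstar_algebra A) \<phi>" and W: "W = (\<lambda>i. \<phi> (A i))"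
    by (auto simp: matrix_range_level_def)
  have *: "ucp_entries n (cstar_algebra A) (\<lambda>a b T. \<phi> T $$ (a, b))"
    using \<phi> assms operator_system_cstar_subalgebra unital_cstar_subalgebra_cstar_algebra
    by (blast intro: ucp_mat_map_entries)
  have carr: "\<phi> (A i) \<in> carrier_mat n n" for i
    using \<phi> generator_in_cstar_algebra[of A i] by (auto simp: ucp_mat_map_def)
  have "W = (\<lambda>i. mat n n (\<lambda>(a, b). \<phi> (A i) $$ (a, b)))"
    unfolding W using carrier_matD[OF carr] by (intro ext eq_matI) simp_all
  then show "W \<in> {\<lambda>i. mat n n (\<lambda>(a, b). G a b (A i)) | G. ucp_entries n (cstar_algebra A) G}"
    using * by (intro CollectI exI[of _ "\<lambda>a b T. \<phi> T $$ (a, b)"] conjI)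
qed (auto simp: matrix_range_level_def dest!: ucp_entries_mat_map)

text \<open>Here \<open>n\<close>-positivity is enough: the encoding functional is the amplified
  form at the single vector of \<open>quad_delta\<close>, which involves only matrices of size
  \<open>n\<close>.\<close>

lemma positive_functional_entries:
  assumes S: "operator_system S"
    and lin: "\<And>a b. a < n \<Longrightarrow> b < n \<Longrightarrow> clinear_on S (F a b)"
    and pos: "\<And>X z. X \<in> mats n S \<Longrightarrow> op_matrix_pos n X \<Longrightarrow> 0 \<le> quad n n F X z"
  shows "positive_functional n S (\<lambda>X. \<Sum>a<n. \<Sum>b<n. F a b (X a b))"
proof
  fix X assume X: "X \<in> mats n S"
  show "(\<Sum>a<n. \<Sum>b<n. F a b ((X + Y) a b))
      = (\<Sum>a<n. \<Sum>b<n. F a b (X a b)) + (\<Sum>a<n. \<Sum>b<n. F a b (Y a b))"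
    if "Y \<in> mats n S" for Y
    using X that lin by (simp add: clinear_on_def mats_def flip: sum.distrib)
  show "(\<Sum>a<n. \<Sum>b<n. F a b ((c *\<^sub>C X) a b)) = c * (\<Sum>a<n. \<Sum>b<n. F a b (X a b))" for c
    using X lin by (simp add: clinear_on_def mats_def sum_distrib_left scaleC_complex_def)
  show "0 \<le> (\<Sum>a<n. \<Sum>b<n. F a b (X a b))" if "op_matrix_pos n X"
    using pos[OF X that, of "\<lambda>j b. if b = j then 1 else 0"] by (simp add: quad_delta)
qed fact

definition elem_mat ::
    "nat \<Rightarrow> nat \<Rightarrow> ('h :: chilbert_space \<Rightarrow>\<^sub>L 'h) \<Rightarrow> nat \<Rightarrow> nat \<Rightarrow> 'h \<Rightarrow>\<^sub>L 'h" where
  "elem_mat a b T i j = (if i = a \<and> j = b then T else 0)"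

lemma sum_elem_mat:
  assumes ab: "a < n" "b < n" and F0: "\<And>i j. i < n \<Longrightarrow> j < n \<Longrightarrow> F i j 0 = 0"
  shows "(\<Sum>i<n. \<Sum>j<n. F i j (elem_mat a b T i j)) = (F a b T :: 'c :: comm_monoid_add)"
proof -
  have "(\<Sum>j<n. F i j (elem_mat a b T i j)) = (if i = a then F a b T else 0)" if "i < n" for i
  proof -
    have "(\<Sum>j<n. F i j (elem_mat a b T i j)) = (\<Sum>j<n. if j = b then (if i = a then F a b T else 0) else 0)"
      using that F0 by (intro sum.cong) (auto simp: elem_mat_def)
    also have "\<dots> = (if i = a then F a b T else 0)"
      using ab(2) by simp
    finally show ?thesis .
  qed
  then have "(\<Sum>i<n. \<Sum>j<n. F i j (elem_mat a b T i j)) = (\<Sum>i<n. if i = a then F a b T else 0)"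
    by (intro sum.cong) auto
  then show ?thesis using ab(1) by simp
qed

lemma elem_mat_in_mats: "operator_system S \<Longrightarrow> T \<in> S \<Longrightarrow> elem_mat a b T \<in> mats n S"
  by (auto simp: mats_def elem_mat_def operator_system_def complex_vector.subspace_0)

lemma tinner_elem_mat:
  assumes "a < n" "b < n"
  shows "tinner n (mat_app n (elem_mat a b T) \<xi>) \<eta> = cinner (blinfun_apply T (\<xi> b)) (\<eta> a)"
proof -
  have "tinner n (mat_app n (elem_mat a b T) \<xi>) \<eta>
      = (\<Sum>i<n. \<Sum>j<n. cinner (blinfun_apply (elem_mat a b T i j) (\<xi> j)) (\<eta> i))"
    by (simp add: tinner_def mat_app_def cinner_sum_left)
  also have "\<dots> = cinner (blinfun_apply T (\<xi> b)) (\<eta> a)"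
    by (rule sum_elem_mat[where F = "\<lambda>i j T. cinner (blinfun_apply T (\<xi> j)) (\<eta> i)"])
      (use assms in auto)
  finally show ?thesis .
qed

lemma bounded_ops_sum_right:
  assumes "T \<in> bounded_ops"
  shows "blinfun_apply T (\<Sum>b\<in>I. z b *\<^sub>C \<xi> b) = (\<Sum>b\<in>I. z b *\<^sub>C blinfun_apply T (\<xi> b))"
  by (simp add: blinfun.sum_right bounded_opsD[OF assms])

text \<open>Compressing the entries of \<open>X\<close> to the vectors \<open>\<xi> b\<close>
  amounts to evaluating the form of \<open>X\<close> at linear combinations of them, so compressions
  are completely positive.\<close>

lemma quad_vector:
  assumes "X \<in> mats n bounded_ops"
  shows "quad k n (\<lambda>a b T. cinner (blinfun_apply T (\<xi> b)) (\<xi> a)) X z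
    = tinner n (mat_app n X (\<lambda>i. \<Sum>b<k. z i b *\<^sub>C \<xi> b)) (\<lambda>i. \<Sum>b<k. z i b *\<^sub>C \<xi> b)"
proof -
  have "cinner (blinfun_apply (X i j) (\<Sum>b<k. z j b *\<^sub>C \<xi> b)) (\<Sum>a<k. z i a *\<^sub>C \<xi> a)
      = (\<Sum>a<k. \<Sum>b<k. cinner (blinfun_apply (X i j) (\<xi> b)) (\<xi> a) * z j b * cnj (z i a))"
    if "i < n" "j < n" for i j
    using assms that
    by (auto simp: mats_def bounded_ops_sum_right cinner_sum_left cinner_sum_right cinner_simps
        sum_distrib_left mult_ac intro!: sum.cong)
  then show ?thesis
    unfolding quad_def tinner_def mat_app_def
    by (simp add: cinner_sum_left)
qed

text \<open>A map into \<open>M\<^sub>n\<close> is encoded by the functional \<open>X \<mapsto> (\<Sum>i j. F i j (X i j))\<close> on matrices of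
  size \<open>n\<close>. That functional is positive as soon as the map is \<open>n\<close>-positive, and its positive
  extensions give back completely positive maps.\<close>

lemma ucp_extension:
  fixes F :: "nat \<Rightarrow> nat \<Rightarrow> ('h :: chilbert_space \<Rightarrow>\<^sub>L 'h) \<Rightarrow> complex"
  assumes S: "operator_system S" and \<A>: "\<A> \<subseteq> bounded_ops"
    and lin: "\<And>a b. a < n \<Longrightarrow> b < n \<Longrightarrow> clinear_on S (F a b)"
    and unit: "\<And>a b. a < n \<Longrightarrow> b < n \<Longrightarrow> F a b id_blinfun = (if a = b then 1 else 0)"
    and pos: "\<And>X z. X \<in> mats n S \<Longrightarrow> op_matrix_pos n X \<Longrightarrow> 0 \<le> quad n n F X z"
  obtains G where "ucp_entries n \<A> G" "\<And>a b T. a < n \<Longrightarrow> b < n \<Longrightarrow> T \<in> S \<Longrightarrow> G a b T = F a b T"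
proof -
  define s where "s X = (\<Sum>a<n. \<Sum>b<n. F a b (X a b))" for X
  have F0: "F a b 0 = 0" if "a < n" "b < n" for a b
    using S by (intro clinear_on_zero[OF lin[OF that]]) (simp add: operator_system_def)
  interpret positive_functional n S s
    unfolding s_def by (rule positive_functional_entries[OF S lin pos])
  obtain t where t_add: "\<And>X Y. t (X + Y) = t X + t Y" and t_scale: "\<And>c X. t (c *\<^sub>C X) = c * t X"
    and t_s: "\<And>X. X \<in> mats n S \<Longrightarrow> t X = s X" and t_pos: "\<And>X. op_matrix_pos n X \<Longrightarrow> 0 \<le> t X"
    by (rule extension) blast
  have t0: "t 0 = 0" using t_scale[of 0 0] by simp
  have t_sum: "t (\<Sum>i\<in>I. f i) = (\<Sum>i\<in>I. t (f i))" for f :: "nat \<Rightarrow> _" and I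
    by (induction I rule: infinite_finite_induct)
      (simp_all add: t0 t_add del: plus_fun_apply zero_fun_apply)
  define G where "G a b T = t (elem_mat a b T)" for a b T
  have G_F: "G a b T = F a b T" if "a < n" "b < n" "T \<in> S" for a b T
  proof -
    have "G a b T = s (elem_mat a b T)"
      unfolding G_def by (rule t_s[OF elem_mat_in_mats[OF S that(3)]])
    also have "\<dots> = F a b T"
      unfolding s_def by (rule sum_elem_mat[where F = F, OF that(1,2) F0])
    finally show ?thesis .
  qed
  have "ucp_entries n \<A> G"
    unfolding ucp_entries_def
  proof (intro conjI allI impI ballI)
    fix a b assume ab: "a < n" "b < n"
    have "elem_mat a b (S + T) = elem_mat a b S + elem_mat a b T" for S T :: "'h \<Rightarrow>\<^sub>L 'h"
      by (simp add: elem_mat_def fun_eq_iff)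
    moreover have "elem_mat a b (c *\<^sub>C T) = c *\<^sub>C elem_mat a b T" for c and T :: "'h \<Rightarrow>\<^sub>L 'h"
      by (simp add: elem_mat_def fun_eq_iff)
    ultimately show "clinear_on \<A> (G a b)"
      by (simp add: clinear_on_def G_def t_add t_scale scaleC_complex_def)
    show "G a b id_blinfun = (if a = b then 1 else 0)"
      using G_F[OF ab, of id_blinfun] unit[OF ab] S by (simp add: operator_system_def)
  next
    fix m :: nat and X z assume X: "X \<in> mats m \<A>" "op_matrix_pos m X"
    \<comment> \<open>\<open>Y\<close> is the \<open>m\<close> by \<open>m\<close> matrix
      \<open>X\<close> compressed by the scalars \<open>z\<close> to an \<open>n\<close> by
      \<open>n\<close> matrix. It inherits positivity, so positivity of \<open>t\<close> at the one
      size \<open>n\<close> yields complete positivity of \<open>G\<close> at every size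
      \<open>m\<close>.\<close>
    define Y where "Y = (\<Sum>k<m. \<Sum>l<m. \<Sum>a<n. \<Sum>b<n. (z l b * cnj (z k a)) *\<^sub>C elem_mat a b (X k l))"
    have "quad n m G X z = t Y"
      by (simp add: quad_def Y_def t_sum t_scale G_def mult_ac)
    moreover have "op_matrix_pos n Y"
      unfolding op_matrix_pos_iff
    proof
      fix \<xi> :: "nat \<Rightarrow> 'h"
      let ?q = "\<lambda>Y. tinner n (mat_app n Y \<xi>) \<xi>"
      let ?\<eta> = "\<lambda>i. \<Sum>b<n. z i b *\<^sub>C \<xi> b"
      have q0: "?q 0 = 0"
        by (simp add: mat_app_def tinner_def)
      have q_sum: "?q (\<Sum>i\<in>I. f i) = (\<Sum>i\<in>I. ?q (f i))" for f :: "nat \<Rightarrow> _" and I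
        by (induction I rule: infinite_finite_induct) 
          (simp_all add: q0 mat_app_simps tinner_simps del: plus_fun_apply zero_fun_apply)
      have "?q Y = quad n m (\<lambda>a b T. cinner (blinfun_apply T (\<xi> b)) (\<xi> a)) X z"
        unfolding Y_def q_sum mat_app_simps(4) tinner_simps(6) quad_def
        by (intro sum.cong) (auto simp: tinner_elem_mat)
      also have "\<dots> = tinner m (mat_app m X ?\<eta>) ?\<eta>"
        using X(1) \<A> mats_mono by (intro quad_vector) blast
      also have "\<dots> \<ge> 0"
        using X(2) by (simp add: op_matrix_pos_iff)
      finally show "0 \<le> ?q Y" .
    qed
    ultimately show "0 \<le> quad n m G X z"
      using t_pos by simp
  qed
  then show ?thesis using that G_F by blast
qed

text \<open>Positive maps preserve adjoints: \<open>s_mat_adj\<close> is applied to the encoding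
  functional at a matrix with the single entry \<open>T\<close>, whose adjoint has its entry in the
  transposed position.\<close>

lemma ucp_entries_cadjoint:
  assumes G: "ucp_entries k S G" and S: "operator_system S" and ab: "a < k" "b < k" and T: "T \<in> S"
  shows "G b a (cadjoint T) = cnj (G a b T)"
proof -
  define s where "s X = (\<Sum>a<k. \<Sum>b<k. G a b (X a b))" for X
  have lin: "clinear_on S (G a b)" if "a < k" "b < k" for a b
    using G that by (simp add: ucp_entries_def)
  have G0: "G a b 0 = 0" if "a < k" "b < k" for a b
    using S by (intro clinear_on_zero[OF lin[OF that]]) (simp add: operator_system_def)
  interpret positive_functional k S s
    unfolding s_def using G ab
    by (intro positive_functional_entries S lin) (auto simp: ucp_entries_def)
  have s_elem: "s (elem_mat a b T) = G a b T" if "a < k" "b < k" for a b and T :: "'a \<Rightarrow>\<^sub>L 'a"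
    unfolding s_def by (rule sum_elem_mat[where F = G, OF that G0])
  have "mat_adj (elem_mat a b T) = elem_mat b a (cadjoint T)"
    by (auto simp: mat_adj_def elem_mat_def fun_eq_iff)
  then show ?thesis
    using s_mat_adj[OF elem_mat_in_mats[OF S T], of a b] s_elem ab by simp
qed

section \<open>Transfer between operator systems\<close>

text \<open>The unit has two indices, so that flipping the Boolean is taking adjoints for every index.\<close>

definition gen :: "('d :: finite \<Rightarrow> 'h :: chilbert_space \<Rightarrow>\<^sub>L 'h) \<Rightarrow> 'd option \<times> bool \<Rightarrow> 'h \<Rightarrow>\<^sub>L 'h" where
  "gen A k = (case fst k of None \<Rightarrow> id_blinfun | Some i \<Rightarrow> if snd k then cadjoint (A i) else A i)"

text \<open>Coefficients need not be unique, but the same coefficients make sense for every tuple,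
  so elements of two operator systems can be compared before any map between them is
  available.\<close>

definition lincomb ::
    "('d :: finite \<Rightarrow> 'h :: chilbert_space \<Rightarrow>\<^sub>L 'h) \<Rightarrow> ('d option \<times> bool \<Rightarrow> complex) \<Rightarrow> 'h \<Rightarrow>\<^sub>L 'h" where
  "lincomb A c = (\<Sum>k\<in>UNIV. c k *\<^sub>C gen A k)"

definition adj_coeff :: "('d option \<times> bool \<Rightarrow> complex) \<Rightarrow> 'd option \<times> bool \<Rightarrow> complex" where
  "adj_coeff c k = cnj (c (fst k, \<not> snd k))"

definition unit_coeff :: "'d option \<times> bool \<Rightarrow> 'd option \<times> bool \<Rightarrow> complex" where
  "unit_coeff k j = (if j = k then 1 else 0)"

lemma lincomb_add: "lincomb A (c + c') = lincomb A c + lincomb A c'"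
  by (simp add: lincomb_def scaleC_add_left sum.distrib)

lemma lincomb_scaleC: "lincomb A (z *\<^sub>C c) = z *\<^sub>C lincomb A c"
  by (simp add: lincomb_def scaleC_complex_def complex_vector.scale_sum_right scaleC_scaleC)

lemma lincomb_minus: "lincomb A (- c) = - lincomb A c"
  using lincomb_scaleC[of A "-1" c] by (simp only: scaleC_minus_one)

lemma lincomb_diff: "lincomb A (c - c') = lincomb A c - lincomb A c'"
  using lincomb_add[of A c "- c'"] by (simp add: lincomb_minus)

lemma lincomb_zero: "lincomb A 0 = 0"
  using lincomb_diff[of A 0 0] by simp

lemma lincomb_unit: "lincomb A (unit_coeff k) = gen A k"
proof -
  have "lincomb A (unit_coeff k) = (\<Sum>j\<in>UNIV. if j = k then gen A j else 0)"
    unfolding lincomb_def unit_coeff_def by (intro sum.cong) auto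
  then show ?thesis by simp
qed

lemma gen_simps [simp]: "gen A (None, b) = id_blinfun" "gen A (Some i, False) = A i"
  "gen A (Some i, True) = cadjoint (A i)"
  by (simp_all add: gen_def)

lemma op_system_eq: "op_system A = range (lincomb A)"
proof
  have "complex_vector.subspace (range (lincomb A))"
    unfolding complex_vector.subspace_def
    by (metis (no_types, lifting) lincomb_add lincomb_scaleC lincomb_zero rangeE rangeI)
  moreover have "{id_blinfun} \<union> range A \<union> range (\<lambda>i. cadjoint (A i)) \<subseteq> range (lincomb A)"
  proof -
    have gen: "gen A k \<in> range (lincomb A)" for k
      by (metis lincomb_unit rangeI)
    have "id_blinfun \<in> range (lincomb A)" using gen[of "(None, False)"] by simp
    moreover have "A i \<in> range (lincomb A)" for i using gen[of "(Some i, False)"] by simp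
    moreover have "cadjoint (A i) \<in> range (lincomb A)" for i using gen[of "(Some i, True)"] by simp
    ultimately show ?thesis by auto
  qed
  ultimately show "op_system A \<subseteq> range (lincomb A)"
    unfolding op_system_def by (rule complex_vector.span_minimal[rotated])
  have "gen A k \<in> op_system A" for k
    unfolding op_system_def
    by (rule complex_vector.span_base) (auto simp: gen_def split: option.split)
  then show "range (lincomb A) \<subseteq> op_system A"
    unfolding op_system_def lincomb_def
    by (auto intro!: complex_vector.span_sum complex_vector.span_scale)
qed

lemma generator_in_op_system: "A i \<in> op_system A"
  unfolding op_system_def by (rule complex_vector.span_base) simp

lemma gen_in_operator_system:
  assumes "operator_system S" "\<forall>i. A i \<in> S"
  shows "gen A k \<in> S"
  using assms by (auto simp: gen_def operator_system_def split: option.split)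

lemma lincomb_in_operator_system:
  assumes "operator_system S" "\<forall>i. A i \<in> S"
  shows "lincomb A c \<in> S"
  unfolding lincomb_def using gen_in_operator_system[OF assms] assms(1)
  by (intro complex_vector.subspace_sum complex_vector.subspace_scale)
    (auto simp: operator_system_def)

lemma operator_system_bounded_ops: "operator_system bounded_ops"
  by (intro operator_system_cstar_subalgebra unital_cstar_subalgebra_bounded_ops)

context
  fixes A :: "'d :: finite \<Rightarrow> 'h :: chilbert_space \<Rightarrow>\<^sub>L 'h"
  assumes A: "\<forall>i. A i \<in> bounded_ops"
begin

lemma lincomb_bounded_ops [simp]: "lincomb A c \<in> bounded_ops"
  using lincomb_in_operator_system[OF operator_system_bounded_ops A] .

lemma cadjoint_lincomb: "cadjoint (lincomb A c) = lincomb A (adj_coeff c)"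
proof -
  have gen: "gen A k \<in> bounded_ops" for k
    using gen_in_operator_system[OF operator_system_bounded_ops A] .
  have adj: "cadjoint (gen A k) = gen A (fst k, \<not> snd k)" for k
    using A by (auto simp: gen_def split: option.split)
  have "cadjoint (lincomb A c) = (\<Sum>k\<in>UNIV. cnj (c k) *\<^sub>C gen A (fst k, \<not> snd k))"
    by (simp add: lincomb_def cadjoint_sum cadjoint_scaleC scaleC_bounded_ops gen adj)
  also have "\<dots> = (\<Sum>k\<in>UNIV. adj_coeff c k *\<^sub>C gen A k)"
    by (rule sum.reindex_bij_witness[of _ "\<lambda>k. (fst k, \<not> snd k)" "\<lambda>k. (fst k, \<not> snd k)"])
      (auto simp: adj_coeff_def)
  finally show ?thesis by (simp add: lincomb_def)
qed

lemma operator_system_op_system: "operator_system (op_system A)"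
proof -
  have "complex_vector.subspace (op_system A)"
    unfolding op_system_def by (rule complex_vector.subspace_span)
  moreover have "id_blinfun \<in> op_system A"
    unfolding op_system_def by (rule complex_vector.span_base) simp
  ultimately show ?thesis
    by (auto simp: operator_system_def op_system_eq cadjoint_lincomb)
qed

lemma operator_system_cstar_algebra: "operator_system (cstar_algebra A)"
  using A by (intro operator_system_cstar_subalgebra unital_cstar_subalgebra_cstar_algebra)

lemma cstar_algebra_bounded: "cstar_algebra A \<subseteq> bounded_ops"
  using operator_system_cstar_algebra by (simp add: operator_system_def)

lemma lincomb_in_cstar_algebra: "lincomb A c \<in> cstar_algebra A"
  by (intro lincomb_in_operator_system operator_system_cstar_algebra allI
      generator_in_cstar_algebra)

lemma op_system_subset_cstar_algebra: "op_system A \<subseteq> cstar_algebra A"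
  using lincomb_in_cstar_algebra by (auto simp: op_system_eq)

lemma ucp_entries_lincomb:
  assumes G: "ucp_entries n (cstar_algebra A) G" and ab: "a < n" "b < n"
  shows "G a b (lincomb A c) = (\<Sum>k\<in>UNIV. c k * G a b (gen A k))"
proof -
  note os = operator_system_cstar_algebra
  have "clinear_on (cstar_algebra A) (G a b)"
    using G ab by (simp add: ucp_entries_def)
  moreover have "complex_vector.subspace (cstar_algebra A)"
    using os by (simp add: operator_system_def)
  moreover have "gen A k \<in> cstar_algebra A" for k
    by (intro gen_in_operator_system os allI generator_in_cstar_algebra)
  ultimately show ?thesis
    unfolding lincomb_def by (subst clinear_on_lincomb) (simp_all add: scaleC_complex_def)
qed

end

text \<open>Composing with \<open>\<phi>\<close> leaves positivity at size \<open>n\<close> only,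
  and on the operator system only; \<open>ucp_extension\<close> repairs both without changing the
  values at \<open>A i\<close>.\<close>

theorem n_positive_imp_matrix_range_subset:
  assumes A: "\<forall>i. A i \<in> bounded_ops" and B: "\<forall>i. B i \<in> bounded_ops" and n: "n \<ge> 1"
    and \<phi>: "unital_n_positive_map n (op_system A) (op_system B) \<phi>" "\<forall>i. \<phi> (A i) = B i"
  shows "matrix_range_level n B \<subseteq> matrix_range_level n A"
proof
  fix W assume "W \<in> matrix_range_level n B"
  then obtain F where F: "ucp_entries n (cstar_algebra B) F"
    and W: "W = (\<lambda>i. mat n n (\<lambda>(a, b). F a b (B i)))"
    unfolding matrix_range_level_eq[OF B] by blast
  have \<phi>S: "\<phi> T \<in> cstar_algebra B" if "T \<in> op_system A" for T
    using that \<phi>(1) op_system_subset_cstar_algebra[OF B]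
    by (auto simp: unital_n_positive_map_def unital_linear_map_def)
  obtain G where G: "ucp_entries n (cstar_algebra A) G"
    "\<And>a b T. a < n \<Longrightarrow> b < n \<Longrightarrow> T \<in> op_system A \<Longrightarrow> G a b T = F a b (\<phi> T)"
  proof (rule ucp_extension[of "op_system A" "cstar_algebra A" n "\<lambda>a b T. F a b (\<phi> T)"])
    show "operator_system (op_system A)" "cstar_algebra A \<subseteq> bounded_ops"
      using operator_system_op_system[OF A] cstar_algebra_bounded[OF A] by auto
    show "clinear_on (op_system A) (\<lambda>T. F a b (\<phi> T))" if "a < n" "b < n" for a b
    proof -
      have "clinear_on (cstar_algebra B) (F a b)"
        using F that by (simp add: ucp_entries_def)
      moreover have "clinear_on (op_system A) \<phi>"
        using \<phi>(1) by (simp add: unital_n_positive_map_def unital_linear_map_def)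
      ultimately show ?thesis
        using \<phi>S by (simp add: clinear_on_def)
    qed
    show "F a b (\<phi> id_blinfun) = (if a = b then 1 else 0)" if "a < n" "b < n" for a b
      using F \<phi>(1) that
      by (simp add: ucp_entries_def unital_n_positive_map_def unital_linear_map_def)
    fix X z assume X: "X \<in> mats n (op_system A)" "op_matrix_pos n X"
    have "op_matrix_pos n (\<lambda>i j. \<phi> (X i j))"
      using X \<phi>(1) by (simp add: unital_n_positive_map_def n_positive_on_def mats_def)
    moreover have "(\<lambda>i j. \<phi> (X i j)) \<in> mats n (cstar_algebra B)"
      using X(1) \<phi>S by (simp add: mats_def)
    ultimately have "0 \<le> quad n n F (\<lambda>i j. \<phi> (X i j)) z"
      using F n unfolding ucp_entries_def by blast
    then show "0 \<le> quad n n (\<lambda>a b T. F a b (\<phi> T)) X z"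
      by (simp add: quad_def)
  qed blast
  have "G a b (A i) = F a b (B i)" if "a < n" "b < n" for a b i
    using G(2)[OF that generator_in_op_system] \<phi>(2) by simp
  then have "W = (\<lambda>i. mat n n (\<lambda>(a, b). G a b (A i)))"
    unfolding W by (intro ext cong_mat) auto
  then show "W \<in> matrix_range_level n A"
    unfolding matrix_range_level_eq[OF A] using G(1) by blast
qed

text \<open>Vectors that depend on earlier ones add nothing to \<open>e\<close>, so \<open>m\<close>
  is the dimension of the span and may be smaller than \<open>n\<close>, even 0.\<close>

lemma Gram_Schmidt:
  fixes \<xi> :: "nat \<Rightarrow> 'a :: chilbert_space"
  shows "\<exists>(m :: nat) e. (\<forall>a<m. \<forall>b<m. cinner (e b) (e a) = (if a = b then 1 else 0)) \<and>
    (\<forall>i<n. \<exists>z. \<xi> i = (\<Sum>b<m. z b *\<^sub>C e b))"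
proof (induction n)
  case 0
  show ?case by (rule exI[where x = "0 :: nat"]) simp
next
  case (Suc n)
  then obtain m :: nat and e where on: "\<And>a b. a < m \<Longrightarrow> b < m \<Longrightarrow> cinner (e b) (e a) = (if a = b then 1 else 0)"
    and span: "\<And>i. i < n \<Longrightarrow> \<exists>z. \<xi> i = (\<Sum>b<m. z b *\<^sub>C e b)" by blast
  define p where "p = (\<Sum>b<m. cinner (\<xi> n) (e b) *\<^sub>C e b)"
  define r where "r = \<xi> n - p"
  have orth: "cinner r (e a) = 0" if "a < m" for a
  proof -
    have "cinner p (e a) = (\<Sum>b<m. cinner (\<xi> n) (e b) * (if a = b then 1 else 0))"
      using that by (simp add: p_def cinner_sum_left cinner_simps on)
    also have "\<dots> = (\<Sum>b<m. if a = b then cinner (\<xi> n) (e b) else 0)"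
      by (intro sum.cong) auto
    finally show ?thesis using that by (simp add: r_def cinner_simps)
  qed
  show ?case
  proof (cases "r = 0")
    case True
    then have "\<exists>z. \<xi> n = (\<Sum>b<m. z b *\<^sub>C e b)"
      by (auto simp: r_def p_def)
    then show ?thesis
      using on span by (intro exI[of _ m] exI[of _ e]) (auto simp: less_Suc_eq)
  next
    case False
    define e' where "e' = e(m := complex_of_real (1 / norm r) *\<^sub>C r)"
    have e'_lt: "e' b = e b" if "b < m" for b
      using that by (simp add: e'_def)
    have sum_e': "(\<Sum>b<m. z b *\<^sub>C e' b) = (\<Sum>b<m. z b *\<^sub>C e b)" for z
      by (intro sum.cong) (auto simp: e'_lt)
    have "cinner (e' m) (e' m) = 1"
      using False by (simp add: e'_def cinner_simps cinner_self power2_eq_square norm_scaleC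
          norm_divide)
    moreover have "cinner (e' m) (e' a) = 0" "cinner (e' a) (e' m) = 0" if "a < m" for a
      using orth[OF that] that cinner_commute[of "e a" r]
      by (simp_all add: e'_def cinner_simps)
    ultimately have on': "cinner (e' b) (e' a) = (if a = b then 1 else 0)"
      if "a < Suc m" "b < Suc m" for a b
      using that on[of a b] e'_lt by (auto simp: less_Suc_eq)
    have "\<exists>z. \<xi> i = (\<Sum>b<Suc m. z b *\<^sub>C e' b)" if i: "i < n" for i
    proof -
      obtain z where "\<xi> i = (\<Sum>b<m. z b *\<^sub>C e b)" using span[OF i] by blast
      then have "\<xi> i = (\<Sum>b<Suc m. (z(m := 0)) b *\<^sub>C e' b)"
        by (simp add: sum_e'[symmetric])
      then show ?thesis by blast
    qed
    moreover have "\<exists>z. \<xi> n = (\<Sum>b<Suc m. z b *\<^sub>C e' b)"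
    proof
      let ?z = "(\<lambda>b. cinner (\<xi> n) (e b))(m := complex_of_real (norm r))"
      have "(\<Sum>b<Suc m. ?z b *\<^sub>C e' b) = p + complex_of_real (norm r) *\<^sub>C e' m"
        by (simp add: sum_e' p_def)
      also have "complex_of_real (norm r) *\<^sub>C e' m = r"
        using False by (simp add: e'_def scaleC_scaleC)
      finally show "\<xi> n = (\<Sum>b<Suc m. ?z b *\<^sub>C e' b)" by (simp add: r_def)
    qed
    ultimately show ?thesis
      using on' by (intro exI[of _ "Suc m"] exI[of _ e']) (auto simp: less_Suc_eq)
  qed
qed

lemma Gram_Schmidt_coordinates:
  fixes \<xi> :: "nat \<Rightarrow> 'a :: chilbert_space"
  obtains m :: nat and e z
  where "\<And>a b. a < m \<Longrightarrow> b < m \<Longrightarrow> cinner (e b) (e a) = (if a = b then 1 else 0)"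
    "\<And>i. i < n \<Longrightarrow> \<xi> i = (\<Sum>b<m. z i b *\<^sub>C e b)"
proof -
  obtain m :: nat and e
    where on: "\<And>a b. a < m \<Longrightarrow> b < m \<Longrightarrow> cinner (e b) (e a) = (if a = b then 1 else 0)"
      and "\<forall>i<n. \<exists>z. \<xi> i = (\<Sum>b<m. z b *\<^sub>C e b)"
    using Gram_Schmidt[of n \<xi>] by blast
  then have "\<forall>i. \<exists>z. i < n \<longrightarrow> \<xi> i = (\<Sum>b<m. z b *\<^sub>C e b)" by blast
  from choice[OF this] show ?thesis using that on by blast
qed

text \<open>Orthonormality makes the compression unital; complete positivity is
  \<open>quad_vector\<close>.\<close>

lemma compression_ucp_entries:
  assumes on: "\<And>a b. a < m \<Longrightarrow> b < m \<Longrightarrow> cinner (e b) (e a) = (if a = b then 1 else 0)"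
    and \<A>: "\<A> \<subseteq> bounded_ops"
  shows "ucp_entries m \<A> (\<lambda>a b T. cinner (blinfun_apply T (e b)) (e a))"
  unfolding ucp_entries_def
proof (intro conjI allI impI ballI)
  fix n X z assume "X \<in> mats n \<A>" and pos: "op_matrix_pos n X"
  then have X: "X \<in> mats n bounded_ops" using mats_mono[OF \<A>] by blast
  show "0 \<le> quad m n (\<lambda>a b T. cinner (blinfun_apply T (e b)) (e a)) X z"
    using pos by (simp add: quad_vector[OF X] op_matrix_pos_iff)
qed (simp_all add: clinear_on_def cinner_simps blinfun.add_left on scaleC_complex_def)

section \<open>Transfer of positivity between matrices with the same coefficients\<close>

definition lincomb_mat ::
    "('d :: finite \<Rightarrow> 'h :: chilbert_space \<Rightarrow>\<^sub>L 'h) \<Rightarrow> (nat \<Rightarrow> nat \<Rightarrow> 'd option \<times> bool \<Rightarrow> complex) \<Rightarrow>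
     nat \<Rightarrow> nat \<Rightarrow> 'h \<Rightarrow>\<^sub>L 'h" where
  "lincomb_mat A c i j = lincomb A (c i j)"

text \<open>Stands for the existence of a UCP map taking \<open>A i\<close> to \<open>B i\<close>,
  without mentioning a map.\<close>

definition pos_transfer ::
    "('d :: finite \<Rightarrow> 'h :: chilbert_space \<Rightarrow>\<^sub>L 'h) \<Rightarrow> ('d \<Rightarrow> 'k :: chilbert_space \<Rightarrow>\<^sub>L 'k) \<Rightarrow> bool" where
  "pos_transfer A B \<longleftrightarrow>
     (\<forall>n\<ge>1. \<forall>c. op_matrix_pos n (lincomb_mat A c) \<longrightarrow> op_matrix_pos n (lincomb_mat B c))"

lemma tinner_mat_app_cong:
  assumes "\<And>i j. i < n \<Longrightarrow> j < n \<Longrightarrow> X i j = Y i j" "\<And>i. i < n \<Longrightarrow> \<xi> i = \<eta> i"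
  shows "tinner n (mat_app n X \<xi>) \<xi> = tinner n (mat_app n Y \<eta>) \<eta>"
  using assms by (simp add: tinner_def mat_app_def)

lemma op_matrix_pos_cong:
  assumes "\<And>i j. i < n \<Longrightarrow> j < n \<Longrightarrow> X i j = Y i j"
  shows "op_matrix_pos n X = op_matrix_pos n Y"
  unfolding op_matrix_pos_iff using tinner_mat_app_cong[of n X Y] assms by simp

lemma matrix_range_subset_imp_pos_transfer:
  fixes A :: "'d :: finite \<Rightarrow> 'h :: chilbert_space \<Rightarrow>\<^sub>L 'h"
    and B :: "'d \<Rightarrow> 'k :: chilbert_space \<Rightarrow>\<^sub>L 'k"
  assumes A: "\<forall>i. A i \<in> bounded_ops" and B: "\<forall>i. B i \<in> bounded_ops"
    and sub: "matrix_range B \<subseteq> matrix_range A"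
  shows "pos_transfer A B"
  unfolding pos_transfer_def op_matrix_pos_iff[of _ "lincomb_mat B _"]
proof (intro allI impI)
  fix n :: nat and c and \<xi> :: "nat \<Rightarrow> 'k"
  assume n: "n \<ge> 1" and pos: "op_matrix_pos n (lincomb_mat A c)"
  obtain m :: nat and e z
    where on: "\<And>a b. a < m \<Longrightarrow> b < m \<Longrightarrow> cinner (e b) (e a) = (if a = b then 1 else 0)"
      and z: "\<And>i. i < n \<Longrightarrow> \<xi> i = (\<Sum>b<m. z i b *\<^sub>C e b)"
    using Gram_Schmidt_coordinates[of n \<xi>] by blast
  show "0 \<le> tinner n (mat_app n (lincomb_mat B c) \<xi>) \<xi>"
  proof (cases "m = 0")
    \<comment> \<open>All \<open>\<xi> i\<close> vanish; matrix ranges start at level 1, so there is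
      no level 0 to appeal to.\<close>
    case True
    then show ?thesis using z by (simp add: tinner_def)
  next
    case False
    let ?F = "\<lambda>a b T. cinner (blinfun_apply T (e b)) (e a)"
    have "ucp_entries m (cstar_algebra B) ?F"
      by (rule compression_ucp_entries[OF on cstar_algebra_bounded[OF B]])
    then have "(\<lambda>i. mat m m (\<lambda>(a, b). ?F a b (B i))) \<in> matrix_range_level m B"
      unfolding matrix_range_level_eq[OF B] mem_Collect_eq by (intro exI[of _ ?F] conjI refl)
    then have "(\<lambda>i. mat m m (\<lambda>(a, b). ?F a b (B i))) \<in> matrix_range_level m A"
    proof (rule subsetD[rotated])
      show "matrix_range_level m B \<subseteq> matrix_range_level m A"
        using sub False by (simp add: matrix_range_subset_iff)
    qed
    then obtain G where G: "ucp_entries m (cstar_algebra A) G"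
      and "(\<lambda>i. mat m m (\<lambda>(a, b). ?F a b (B i))) = (\<lambda>i. mat m m (\<lambda>(a, b). G a b (A i)))"
      unfolding matrix_range_level_eq[OF A] mem_Collect_eq by (elim exE conjE)
    then have "mat m m (\<lambda>(a, b). ?F a b (B i)) $$ (a, b) = mat m m (\<lambda>(a, b). G a b (A i)) $$ (a, b)"
      for i a b by metis
    then have GA: "G a b (A i) = ?F a b (B i)" if "a < m" "b < m" for i a b
      using that by (metis (no_types, lifting) index_mat(1) prod.simps(2))
    \<comment> \<open>The matrix range records only the values at the \<open>A i\<close>; those at
      their adjoints follow because UCP maps preserve adjoints.\<close>
    have GA': "G a b (cadjoint (A i)) = ?F a b (cadjoint (B i))" if "a < m" "b < m" for i a b
    proof -
      have "G a b (cadjoint (A i)) = cnj (?F b a (B i))"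
        using ucp_entries_cadjoint[OF G operator_system_cstar_algebra[OF A] that(2,1)
            generator_in_cstar_algebra] GA[OF that(2,1)] by simp
      also have "\<dots> = ?F a b (cadjoint (B i))"
        using cinner_cadjoint_left[of "B i"] B cinner_commute by metis
      finally show ?thesis .
    qed
    have gen: "G a b (gen A k) = ?F a b (gen B k)" if "a < m" "b < m" for k a b
      using that GA GA' G on by (auto simp: gen_def ucp_entries_def split: option.split)
    have lc: "G a b (lincomb A c) = ?F a b (lincomb B c)" if "a < m" "b < m" for a b c
    proof -
      have "G a b (lincomb A c) = (\<Sum>k\<in>UNIV. c k * ?F a b (gen B k))"
        unfolding ucp_entries_lincomb[OF A G that] by (simp add: gen[OF that])
      also have "\<dots> = ?F a b (lincomb B c)"
        by (simp add: lincomb_def blinfun.sum_left cinner_sum_left cinner_simps)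
      finally show ?thesis .
    qed
    have "lincomb_mat A c \<in> mats n (cstar_algebra A)"
      using lincomb_in_cstar_algebra[OF A] by (simp add: mats_def lincomb_mat_def)
    then have "0 \<le> quad m n G (lincomb_mat A c) z"
      using G n pos by (auto simp: ucp_entries_def)
    also have "\<dots> = quad m n ?F (lincomb_mat B c) z"
      by (rule quad_cong) (simp add: lc lincomb_mat_def)
    also have "\<dots> = tinner n (mat_app n (lincomb_mat B c) (\<lambda>i. \<Sum>b<m. z i b *\<^sub>C e b))
        (\<lambda>i. \<Sum>b<m. z i b *\<^sub>C e b)"
      by (rule quad_vector) (use lincomb_bounded_ops[OF B] in \<open>simp add: mats_def lincomb_mat_def\<close>)
    also have "\<dots> = tinner n (mat_app n (lincomb_mat B c) \<xi>) \<xi>"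
      by (rule tinner_mat_app_cong) (simp_all add: z)
    finally show ?thesis .
  qed
qed

text \<open>Polarisation at \<open>x + y\<close> and \<open>x + \<i> *\<^sub>C y\<close>; over the
  reals, a rotation of the plane would be a counterexample.\<close>

lemma bounded_op_zeroI:
  assumes T: "T \<in> bounded_ops" and z: "\<And>x. cinner (blinfun_apply T x) x = 0"
  shows "T = 0"
proof (rule blinfun_eqI, rule cinner_eqI)
  fix x y
  have "cinner (blinfun_apply T x) y + cinner (blinfun_apply T y) x = 0"
    using z[of "x + y"] z[of x] z[of y]
    by (simp add: blinfun.add_right cinner_simps add.commute)
  moreover have "- \<i> * cinner (blinfun_apply T x) y + \<i> * cinner (blinfun_apply T y) x = 0"
    using z[of "x + \<i> *\<^sub>C y"] z[of x] z[of y]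
    by (simp add: blinfun.add_right cinner_simps bounded_opsD[OF T])
  then have "\<i> * (cinner (blinfun_apply T y) x - cinner (blinfun_apply T x) y) = 0"
    by (simp add: algebra_simps)
  ultimately show "cinner (blinfun_apply T x) y = cinner (blinfun_apply 0 x) y"
    by (simp add: eq_neg_iff_add_eq_0)
qed

text \<open>The hypothesis says that every linear relation among the generators of the first system
  holds in the second, so an arbitrary choice of coefficients defines the map.\<close>

lemma linear_map_of_lincomb:
  assumes "\<And>c. lincomb A c = 0 \<Longrightarrow> lincomb B c = 0"
  obtains \<phi> where "unital_linear_map (op_system A) (op_system B) \<phi>"
    "\<And>c. \<phi> (lincomb A c) = lincomb B c" "\<And>i. \<phi> (A i) = B i"
proof -
  define \<phi> where "\<phi> T = lincomb B (SOME c. lincomb A c = T)" for T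
  have \<phi>: "\<phi> (lincomb A c) = lincomb B c" for c
  proof -
    define c' where "c' = (SOME c'. lincomb A c' = lincomb A c)"
    have "lincomb A c' = lincomb A c"
      unfolding c'_def by (rule someI[where P = "\<lambda>c'. lincomb A c' = lincomb A c"]) simp
    then have "lincomb B (c' - c) = 0"
      by (intro assms) (simp add: lincomb_diff)
    then show ?thesis
      by (simp add: \<phi>_def c'_def lincomb_diff)
  qed
  have gen: "\<phi> (gen A k) = gen B k" for k
    using \<phi>[of "unit_coeff k"] by (simp add: lincomb_unit)
  have "clinear_on (op_system A) \<phi>"
    by (auto simp: clinear_on_def op_system_eq \<phi> simp flip: lincomb_add lincomb_scaleC)
  then have "unital_linear_map (op_system A) (op_system B) \<phi>"
    using gen[of "(None, False)"] by (auto simp: unital_linear_map_def op_system_eq \<phi>)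
  then show ?thesis
    using that \<phi> gen[of "(Some _, False)"] by simp
qed

lemma mats_op_system_lincomb_mat:
  assumes "X \<in> mats n (op_system A)"
  obtains c where "\<And>i j. i < n \<Longrightarrow> j < n \<Longrightarrow> X i j = lincomb_mat A c i j"
proof -
  have "\<forall>i j. \<exists>c. i < n \<longrightarrow> j < n \<longrightarrow> X i j = lincomb A c"
    using assms by (auto simp: mats_def op_system_eq)
  then show ?thesis
    using that unfolding lincomb_mat_def by metis
qed

text \<open>The zero operator is positive together with its negative. Transferring both statements
  makes the form of \<open>lincomb B c\<close> vanish, hence the operator.\<close>

lemma pos_transfer_zero:
  assumes B: "\<forall>i. B i \<in> bounded_ops" and tr: "pos_transfer A B" and "lincomb A c = 0"
  shows "lincomb B c = 0"
proof (rule bounded_op_zeroI)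
  have "0 \<le> cinner (blinfun_apply (lincomb B c) x) x" if "lincomb A c = 0" for c x
  proof -
    have "op_matrix_pos 1 (lincomb_mat A (\<lambda>i j. c))"
      using that by (simp add: op_matrix_pos_def lincomb_mat_def)
    then have "op_matrix_pos 1 (lincomb_mat B (\<lambda>i j. c))"
      using tr by (simp add: pos_transfer_def)
    then have "0 \<le> (\<Sum>i<1::nat. cinner (\<Sum>j<1::nat. blinfun_apply (lincomb B c) x) x)"
      unfolding op_matrix_pos_def lincomb_mat_def by (rule allE[of _ "\<lambda>_. x"]) simp
    then show ?thesis by simp
  qed
  from this[of c] this[of "- c"] assms(3)
  show "cinner (blinfun_apply (lincomb B c) x) x = 0" for x
    by (simp add: lincomb_minus blinfun.minus_left antisym)
qed (use B in simp)

lemma pos_transfer_imp_ucp_map: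
  assumes B: "\<forall>i. B i \<in> bounded_ops" and tr: "pos_transfer A B"
  shows "\<exists>\<phi>. ucp_map (op_system A) (op_system B) \<phi> \<and> (\<forall>i. \<phi> (A i) = B i)"
proof -
  obtain \<phi> where \<phi>: "unital_linear_map (op_system A) (op_system B) \<phi>"
    "\<And>c. \<phi> (lincomb A c) = lincomb B c" "\<And>i. \<phi> (A i) = B i"
    by (rule linear_map_of_lincomb[of A B]) (use pos_transfer_zero[OF B tr] in blast)+
  have "n_positive_on op_matrix_pos op_matrix_pos n (op_system A) \<phi>" if n: "n \<ge> 1" for n
    unfolding n_positive_on_def
  proof (intro allI impI)
    fix X assume "\<forall>i<n. \<forall>j<n. X i j \<in> op_system A" and pos: "op_matrix_pos n X"
    then obtain c where c: "\<And>i j. i < n \<Longrightarrow> j < n \<Longrightarrow> X i j = lincomb_mat A c i j"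
      using mats_op_system_lincomb_mat[of X n A] by (auto simp: mats_def)
    have "op_matrix_pos n (lincomb_mat A c)"
      using pos op_matrix_pos_cong[of n X "lincomb_mat A c", OF c] by simp
    then have "op_matrix_pos n (lincomb_mat B c)"
      using tr n by (simp add: pos_transfer_def)
    also have "op_matrix_pos n (lincomb_mat B c) = op_matrix_pos n (\<lambda>i j. \<phi> (X i j))"
      by (rule op_matrix_pos_cong) (simp add: c \<phi>(2) lincomb_mat_def)
    finally show "op_matrix_pos n (\<lambda>i j. \<phi> (X i j))" .
  qed
  then show ?thesis
    using \<phi> by (auto simp: ucp_map_def)
qed

lemma ucp_map_imp_matrix_range_subset:
  assumes "\<forall>i. A i \<in> bounded_ops" "\<forall>i. B i \<in> bounded_ops"
    and "ucp_map (op_system A) (op_system B) \<phi>" "\<forall>i. \<phi> (A i) = B i"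
  shows "matrix_range B \<subseteq> matrix_range A"
  unfolding matrix_range_subset_iff
proof (intro allI impI)
  fix n :: nat assume "n \<ge> 1"
  then have "unital_n_positive_map n (op_system A) (op_system B) \<phi>"
    using assms(3) by (simp add: ucp_map_def unital_n_positive_map_def)
  then show "matrix_range_level n B \<subseteq> matrix_range_level n A"
    by (rule n_positive_imp_matrix_range_subset[OF assms(1,2) \<open>n \<ge> 1\<close> _ assms(4)])
qed

section \<open>Norms, contractions and positivity\<close>

lemma tinner_norm_le: "cmod (tinner n \<xi> \<eta>) \<le> tnorm n \<xi> * tnorm n \<eta>"
proof -
  have "cmod (tinner n \<xi> \<eta>) \<le> (\<Sum>i<n. norm (\<xi> i) * norm (\<eta> i))"
    unfolding tinner_def by (intro order_trans[OF norm_sum] sum_mono norm_cinner_le)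
  also have "\<dots> \<le> tnorm n \<xi> * tnorm n \<eta>"
    using L2_set_mult_ineq[of "\<lambda>i. norm (\<xi> i)" "\<lambda>i. norm (\<eta> i)" "{..<n}"]
    by (simp add: tnorm_def)
  finally show ?thesis .
qed

lemma op_matrix_norm_eq:
  "op_matrix_norm n X = Sup {tnorm n (mat_app n X \<xi>) | \<xi>. tnorm n \<xi> \<le> 1}"
  by (simp add: op_matrix_norm_def tnorm_def mat_app_def)

lemma tnorm_zero [simp]: "tnorm n 0 = 0"
  by (simp add: tnorm_def L2_set_def)

lemma tnorm_1: "tnorm (Suc 0) \<xi> = norm (\<xi> 0)"
  by (simp add: tnorm_def L2_set_def)

lemma op_matrix_norm_upper:
  assumes "tnorm n \<xi> \<le> 1"
  shows "tnorm n (mat_app n X \<xi>) \<le> op_matrix_norm n X"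
  unfolding op_matrix_norm_eq
proof (rule cSup_upper)
  obtain R where R: "R > 0" "\<And>\<xi>. tnorm n (mat_app n X \<xi>) \<le> R * tnorm n \<xi>"
    using mat_app_bounded by blast
  show "bdd_above {tnorm n (mat_app n X \<xi>) | \<xi>. tnorm n \<xi> \<le> 1}"
  proof (rule bdd_aboveI)
    fix r assume "r \<in> {tnorm n (mat_app n X \<xi>) | \<xi>. tnorm n \<xi> \<le> 1}"
    then obtain \<xi> where r: "r = tnorm n (mat_app n X \<xi>)" "tnorm n \<xi> \<le> 1" by blast
    then have "R * tnorm n \<xi> \<le> R * 1"
      using R(1) by (intro mult_left_mono) auto
    then show "r \<le> R" using R(2)[of \<xi>] r(1) by linarith
  qed
qed (use assms in blast)

lemma op_matrix_norm_nonneg: "0 \<le> op_matrix_norm n X"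
  using op_matrix_norm_upper[of n 0 X] by (simp add: order_trans[OF tnorm_nonneg])

lemma tnorm_mat_app_le:
  fixes X :: "nat \<Rightarrow> nat \<Rightarrow> 'a :: chilbert_space \<Rightarrow>\<^sub>L 'a"
  shows "tnorm n (mat_app n X \<xi>) \<le> op_matrix_norm n X * tnorm n \<xi>"
proof (cases "tnorm n \<xi> = 0")
  case True
  obtain R where "\<And>\<xi>. tnorm n (mat_app n X \<xi>) \<le> R * tnorm n \<xi>"
    using mat_app_bounded by blast
  from this[of \<xi>] True show ?thesis by simp
next
  case False
  then have pos: "tnorm n \<xi> > 0" by (simp add: less_le)
  let ?t = "1 / tnorm n \<xi>"
  have t: "tnorm n (?t *\<^sub>R \<eta>) = ?t * tnorm n \<eta>" for \<eta> :: "nat \<Rightarrow> 'a"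
    using pos tuple_form.nrm_scaleR[of n ?t \<eta>] by simp
  have "tnorm n (mat_app n X (?t *\<^sub>R \<xi>)) \<le> op_matrix_norm n X"
    using pos by (intro op_matrix_norm_upper) (simp only: t, simp)
  then have "?t * tnorm n (mat_app n X \<xi>) \<le> op_matrix_norm n X"
    by (simp only: mat_app_scaleR_right t)
  then show ?thesis
    using pos by (simp add: field_simps)
qed

lemma op_matrix_norm_le:
  assumes "0 \<le> C" "\<And>\<xi>. tnorm n (mat_app n X \<xi>) \<le> C * tnorm n \<xi>"
  shows "op_matrix_norm n X \<le> C"
  unfolding op_matrix_norm_eq
proof (rule cSup_least)
  show "{tnorm n (mat_app n X \<xi>) | \<xi>. tnorm n \<xi> \<le> 1} \<noteq> {}"
    using tnorm_zero[of n] by (auto intro!: exI[of _ 0])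
  fix r assume "r \<in> {tnorm n (mat_app n X \<xi>) | \<xi>. tnorm n \<xi> \<le> 1}"
  then obtain \<xi> where r: "r = tnorm n (mat_app n X \<xi>)" "tnorm n \<xi> \<le> 1" by blast
  then have "C * tnorm n \<xi> \<le> C * 1"
    using assms(1) by (intro mult_left_mono)
  then show "r \<le> C" using assms(2)[of \<xi>] r(1) by linarith
qed

lemma op_matrix_norm_cong:
  assumes "\<And>i j. i < n \<Longrightarrow> j < n \<Longrightarrow> X i j = Y i j"
  shows "op_matrix_norm n X = op_matrix_norm n Y"
proof -
  have "tnorm n (mat_app n X \<xi>) = tnorm n (mat_app n Y \<xi>)" for \<xi>
    by (rule tnorm_cong) (simp add: mat_app_def assms)
  then show ?thesis by (simp add: op_matrix_norm_eq)
qed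

lemma tinner_mat_app_scaleC_right:
  assumes "X \<in> mats n bounded_ops"
  shows "tinner n (mat_app n X (c *\<^sub>C \<xi>)) \<eta> = c * tinner n (mat_app n X \<xi>) \<eta>"
proof -
  have "mat_app n X (c *\<^sub>C \<xi>) i = c *\<^sub>C mat_app n X \<xi> i" if "i < n" for i
    using assms that
    by (simp add: mat_app_def mats_def bounded_opsD complex_vector.scale_sum_right)
  then show ?thesis
    by (simp add: tinner_def cinner_simps sum_distrib_left)
qed

text \<open>The form is real at \<open>\<xi> + \<i> *\<^sub>C \<eta>\<close>; the cross terms in its
  imaginary part are the difference of the two sides.\<close>

lemma op_matrix_pos_symmetric:
  assumes X: "X \<in> mats n bounded_ops" and pos: "op_matrix_pos n X"
  shows "Re (tinner n (mat_app n X \<xi>) \<eta>) = Re (tinner n (mat_app n X \<eta>) \<xi>)"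
proof -
  have im: "Im (tinner n (mat_app n X \<zeta>) \<zeta>) = 0" for \<zeta>
    using pos by (simp add: op_matrix_pos_iff less_eq_complex_def)
  have "Im (tinner n (mat_app n X (\<xi> + \<i> *\<^sub>C \<eta>)) (\<xi> + \<i> *\<^sub>C \<eta>)) = 0"
    by (rule im)
  then show ?thesis
    using im[of \<xi>] im[of \<eta>]
    by (simp add: mat_app_add_right tinner_simps tinner_mat_app_scaleC_right[OF X])
qed

text \<open>The operator inequality "the square of \<open>X\<close> is at most \<open>R\<close>
  times \<open>X\<close>", from Cauchy-Schwarz for the form of \<open>X\<close> at the vectors
  \<open>\<xi>\<close> and \<open>mat_app n X \<xi>\<close>.\<close>

lemma tnorm_mat_app_square_le:
  assumes X: "X \<in> mats n bounded_ops" and pos: "op_matrix_pos n X"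
    and R: "\<And>\<xi>. tnorm n (mat_app n X \<xi>) \<le> R * tnorm n \<xi>"
  shows "(tnorm n (mat_app n X \<xi>))\<^sup>2 \<le> R * Re (tinner n (mat_app n X \<xi>) \<xi>)"
proof -
  interpret X: psd_form "\<lambda>\<xi> \<eta>. Re (tinner n (mat_app n X \<xi>) \<eta>)"
  proof
    show "Re (tinner n (mat_app n X \<xi>) \<eta>) = Re (tinner n (mat_app n X \<eta>) \<xi>)" for \<xi> \<eta>
      by (rule op_matrix_pos_symmetric[OF X pos])
    show "0 \<le> Re (tinner n (mat_app n X \<xi>) \<xi>)" for \<xi>
      using pos by (simp add: op_matrix_pos_iff less_eq_complex_def)
  qed (simp_all add: mat_app_add_right mat_app_scaleR_right tinner_simps)
  let ?y = "mat_app n X \<xi>" and ?q = "Re (tinner n (mat_app n X \<xi>) \<xi>)"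
  have "(Re (tinner n ?y ?y))\<^sup>2 \<le> ?q * Re (tinner n (mat_app n X ?y) ?y)"
    by (rule X.Cauchy_Schwarz)
  also have "\<dots> \<le> ?q * (R * (tnorm n ?y)\<^sup>2)"
    using tinner_mat_app_le[of n X R ?y] R X.nonneg[of \<xi>] by (intro mult_left_mono) auto
  finally have le: "(tnorm n ?y)\<^sup>2 * (tnorm n ?y)\<^sup>2 \<le> (tnorm n ?y)\<^sup>2 * (R * ?q)"
    by (simp add: tnorm_square[symmetric] power2_eq_square mult_ac)
  show ?thesis
  proof (cases "tnorm n ?y = 0")
    case True
    have "?q = 0"
      using tuple_form.abs_le_nrm[of n ?y \<xi>] True by simp
    then show ?thesis using True by simp
  next
    case False
    then show ?thesis by (intro mult_left_le_imp_le[OF le]) simp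
  qed
qed

text \<open>A positive matrix of norm at most \<open>R\<close> lies within \<open>cmod c\<close> of \<open>c\<close> whenever \<open>c\<close> is on the
  line with real part \<open>R / 2\<close>. Since the discs around these \<open>c\<close> intersect in \<open>{0..R}\<close>, unital
  contractions preserve positivity.\<close>

lemma tnorm_disc:
  assumes X: "X \<in> mats n bounded_ops" and pos: "op_matrix_pos n X"
    and R: "\<And>\<xi>. tnorm n (mat_app n X \<xi>) \<le> R * tnorm n \<xi>"
  shows "tnorm n (mat_app n (X - Complex (R / 2) b *\<^sub>C id_mat) \<xi>)
    \<le> sqrt (R\<^sup>2 / 4 + b\<^sup>2) * tnorm n \<xi>"
proof -
  let ?c = "Complex (R / 2) b" and ?y = "mat_app n X \<xi>"
  define q where "q = Re (tinner n ?y \<xi>)"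
  have q: "tinner n ?y \<xi> = q"
    using pos by (simp add: q_def op_matrix_pos_iff less_eq_complex_def complex_eq_iff)
  have q': "tinner n \<xi> ?y = q"
    by (subst tinner_commute, subst q) simp
  have "tnorm n (mat_app n (X - ?c *\<^sub>C id_mat) \<xi>) = tnorm n (?y - ?c *\<^sub>C \<xi>)"
    by (rule tnorm_cong) (simp add: mat_app_simps mat_app_id)
  \<comment> \<open>As \<open>q\<close> is real, \<open>b\<close> drops out of the cross term. The
    remaining \<open>(tnorm n ?y)\<^sup>2 - R * q\<close> is nonpositive by
    \<open>tnorm_mat_app_square_le\<close>.\<close>
  moreover have "(tnorm n (?y - ?c *\<^sub>C \<xi>))\<^sup>2
      = (tnorm n ?y)\<^sup>2 - R * q + (R\<^sup>2 / 4 + b\<^sup>2) * (tnorm n \<xi>)\<^sup>2"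
  proof -
    have 1: "tinner n (?y - ?c *\<^sub>C \<xi>) (?y - ?c *\<^sub>C \<xi>)
        = tinner n ?y ?y - cnj ?c * q - ?c * q + ?c * cnj ?c * tinner n \<xi> \<xi>"
      by (simp add: tinner_simps q q' algebra_simps)
    have 2: "?c * cnj ?c = complex_of_real (R\<^sup>2 / 4 + b\<^sup>2)"
      by (simp add: complex_eq_iff power2_eq_square)
    show ?thesis
      unfolding tnorm_square[of n "?y - _"] 1 2
      by (simp add: tinner_self algebra_simps del: of_real_power)
  qed
  ultimately have "(tnorm n (mat_app n (X - ?c *\<^sub>C id_mat) \<xi>))\<^sup>2
      \<le> (sqrt (R\<^sup>2 / 4 + b\<^sup>2) * tnorm n \<xi>)\<^sup>2"
    using tnorm_mat_app_square_le[OF X pos R, of \<xi>] by (simp add: power_mult_distrib flip: q_def)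
  then show ?thesis
    by (rule power2_le_imp_le) simp
qed

text \<open>After squaring, the quadratic terms in \<open>b\<close> cancel and the condition is
  affine in \<open>b\<close> with slope proportional to \<open>Im w\<close>. Validity for all real
  \<open>b\<close> forces \<open>Im w = 0\<close>, and \<open>b = 0\<close> then gives the sign of
  the real part.\<close>

lemma nonneg_of_discs:
  fixes w :: complex
  assumes R: "0 \<le> R" and N: "0 \<le> N"
    and le: "\<And>b. cmod (w - Complex (R / 2) b * complex_of_real N) \<le> sqrt (R\<^sup>2 / 4 + b\<^sup>2) * N"
  shows "0 \<le> w"
proof (cases "N = 0")
  case True
  then show ?thesis using le[of 0] by simp
next
  case False
  define Q where "Q = (Re w)\<^sup>2 - R * N * Re w + (Im w)\<^sup>2"
  have Q: "Q \<le> 2 * b * N * Im w" for b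
  proof -
    have "(cmod (w - Complex (R / 2) b * N))\<^sup>2 \<le> (sqrt (R\<^sup>2 / 4 + b\<^sup>2) * N)\<^sup>2"
      by (rule power_mono[OF le]) simp
    then have "(Re w - R / 2 * N)\<^sup>2 + (Im w - b * N)\<^sup>2 \<le> (R\<^sup>2 / 4 + b\<^sup>2) * N\<^sup>2"
      by (simp add: cmod_power2 power_mult_distrib)
    then show ?thesis
      by (simp add: Q_def power2_eq_square algebra_simps)
  qed
  have Im: "Im w = 0"
  proof (rule ccontr)
    assume "Im w \<noteq> 0"
    then have "2 * ((Q - 1) / (2 * N * Im w)) * N * Im w = Q - 1"
      using False by simp
    then show False using Q[of "(Q - 1) / (2 * N * Im w)"] by linarith
  qed
  have "0 \<le> Re w"
  proof (rule ccontr)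
    assume neg: "\<not> 0 \<le> Re w"
    then have "(Re w)\<^sup>2 > 0" "R * N * Re w \<le> 0"
      using R N by (auto intro: mult_nonneg_nonpos)
    moreover have "(Re w)\<^sup>2 \<le> R * N * Re w"
      using Q[of 0] Im by (simp add: Q_def)
    ultimately show False by linarith
  qed
  then show ?thesis using Im by (simp add: less_eq_complex_def)
qed

lemma unital_contraction_n_positive:
  assumes S: "operator_system S" and \<phi>: "unital_linear_map S S' \<phi>"
    and contr: "\<And>X. X \<in> mats n S \<Longrightarrow> op_matrix_norm n (\<lambda>i j. \<phi> (X i j)) \<le> op_matrix_norm n X"
  shows "n_positive_on op_matrix_pos op_matrix_pos n S \<phi>"
  unfolding n_positive_on_def
proof (intro allI impI)
  fix X assume "\<forall>i<n. \<forall>j<n. X i j \<in> S" and pos: "op_matrix_pos n X"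
  then have XS: "X \<in> mats n S" by (simp add: mats_def)
  have "S \<subseteq> bounded_ops" using S by (simp add: operator_system_def)
  then have X: "X \<in> mats n bounded_ops" using XS mats_mono by blast
  let ?R = "op_matrix_norm n X" and ?\<phi>X = "\<lambda>i j. \<phi> (X i j)"
  have add: "\<phi> (x + y) = \<phi> x + \<phi> y" if "x \<in> S" "y \<in> S" for x y
    using \<phi> that by (simp add: unital_linear_map_def clinear_on_def)
  have scale: "\<phi> (c *\<^sub>C x) = c *\<^sub>C \<phi> x" if "x \<in> S" for c x
    using \<phi> that by (simp add: unital_linear_map_def clinear_on_def)
  have sub: "complex_vector.subspace S" and id: "id_blinfun \<in> S"
    using S by (auto simp: operator_system_def)
  have \<phi>0: "\<phi> 0 = 0"
    using scale[of 0 0] complex_vector.subspace_0[OF sub] by simp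
  have "0 \<le> tinner n (mat_app n ?\<phi>X \<xi>) \<xi>" for \<xi>
  proof (rule nonneg_of_discs[of ?R "(tnorm n \<xi>)\<^sup>2"])
    fix b
    let ?c = "Complex (?R / 2) b"
    let ?Y = "X - ?c *\<^sub>C id_mat"
    have Y: "?Y \<in> mats n S"
      using mats_closed[OF S] XS by simp
    \<comment> \<open>Unitality lets the amplified map commute with subtracting a multiple of the
      identity, so contractivity carries the disc bounds of \<open>X\<close> over to its
      image.\<close>
    have "\<phi> (?Y i j) = (?\<phi>X - ?c *\<^sub>C id_mat) i j" if "i < n" "j < n" for i j
    proof -
      have "X i j \<in> S" using XS that by (simp add: mats_def)
      have "id_mat i j \<in> S" "\<phi> (id_mat i j) = id_mat i j"
        using id \<phi> complex_vector.subspace_0[OF sub] \<phi>0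
        by (auto simp: id_mat_def unital_linear_map_def)
      moreover have "?Y i j = X i j + (- ?c) *\<^sub>C id_mat i j"
        by (simp add: complex_vector.scale_minus_left)
      ultimately show ?thesis
        using add[OF \<open>X i j \<in> S\<close> complex_vector.subspace_scale[OF sub, of "id_mat i j" "- ?c"]]
          scale[of "id_mat i j" "- ?c"]
        by (simp add: complex_vector.scale_minus_left)
    qed
    then have eq: "tinner n (mat_app n (\<lambda>i j. \<phi> (?Y i j)) \<xi>) \<xi>
        = tinner n (mat_app n (?\<phi>X - ?c *\<^sub>C id_mat) \<xi>) \<xi>"
      by (intro tinner_mat_app_cong) auto
    have "cmod (tinner n (mat_app n ?\<phi>X \<xi>) \<xi> - ?c * complex_of_real ((tnorm n \<xi>)\<^sup>2))
        = cmod (tinner n (mat_app n (\<lambda>i j. \<phi> (?Y i j)) \<xi>) \<xi>)"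
      unfolding eq by (simp add: mat_app_simps tinner_simps tinner_self)
    also have "\<dots> \<le> tnorm n (mat_app n (\<lambda>i j. \<phi> (?Y i j)) \<xi>) * tnorm n \<xi>"
      by (rule tinner_norm_le)
    also have "\<dots> \<le> op_matrix_norm n ?Y * tnorm n \<xi> * tnorm n \<xi>"
      by (intro mult_right_mono order_trans[OF tnorm_mat_app_le] contr[OF Y]) simp_all
    also have "\<dots> \<le> sqrt (?R\<^sup>2 / 4 + b\<^sup>2) * tnorm n \<xi> * tnorm n \<xi>"
      by (intro mult_right_mono op_matrix_norm_le tnorm_disc[OF X pos tnorm_mat_app_le]) simp_all
    finally show "cmod (tinner n (mat_app n ?\<phi>X \<xi>) \<xi> - ?c * complex_of_real ((tnorm n \<xi>)\<^sup>2))
        \<le> sqrt (?R\<^sup>2 / 4 + b\<^sup>2) * (tnorm n \<xi>)\<^sup>2"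
      by (simp add: power2_eq_square mult.assoc)
  qed (simp_all add: op_matrix_norm_nonneg)
  then show "op_matrix_pos n ?\<phi>X"
    by (simp add: op_matrix_pos_iff)
qed

section \<open>Complete isometries\<close>

text \<open>The counterpart of \<open>pos_transfer\<close> for norms. Its symmetry in
  \<open>A\<close> and \<open>B\<close> supplies the complete isometry in the opposite
  direction.\<close>

definition norm_transfer ::
    "('d :: finite \<Rightarrow> 'h :: chilbert_space \<Rightarrow>\<^sub>L 'h) \<Rightarrow> ('d \<Rightarrow> 'k :: chilbert_space \<Rightarrow>\<^sub>L 'k) \<Rightarrow> bool" where
  "norm_transfer A B \<longleftrightarrow>
     (\<forall>n\<ge>1. \<forall>c. op_matrix_norm n (lincomb_mat B c) = op_matrix_norm n (lincomb_mat A c))"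

lemma norm_transfer_sym: "norm_transfer A B \<Longrightarrow> norm_transfer B A"
  by (simp add: norm_transfer_def)

text \<open>Tested on each vector of the codomain space, the claim is \<open>s_mat_adj\<close> at
  size 1; equality of the forms then gives equality of the operators.\<close>

lemma n_positive_cadjoint:
  assumes S: "operator_system S" and S': "S' \<subseteq> bounded_ops" and \<phi>: "unital_linear_map S S' \<phi>"
    and pos: "n_positive_on op_matrix_pos op_matrix_pos 1 S \<phi>" and T: "T \<in> S"
  shows "\<phi> (cadjoint T) = cadjoint (\<phi> T)"
proof -
  have \<phi>S: "\<phi> x \<in> bounded_ops" if "x \<in> S" for x
    using that \<phi> S' by (auto simp: unital_linear_map_def)
  have T': "cadjoint T \<in> S" using S T by (simp add: operator_system_def)
  have "\<phi> (cadjoint T) - cadjoint (\<phi> T) = 0"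
  proof (rule bounded_op_zeroI)
    show "\<phi> (cadjoint T) - cadjoint (\<phi> T) \<in> bounded_ops"
      using complex_vector.subspace_diff[OF subspace_bounded_ops \<phi>S[OF T'] cadjoint_bounded_ops[OF \<phi>S[OF T]]] .
    fix x
    define s where "s X = cinner (blinfun_apply (\<phi> (X 0 0)) x) x" for X :: "nat \<Rightarrow> nat \<Rightarrow> _"
    interpret positive_functional 1 S s
    proof
      show "s (X + Y) = s X + s Y" if "X \<in> mats 1 S" "Y \<in> mats 1 S" for X Y
        using that \<phi> by (simp add: s_def mats_def unital_linear_map_def clinear_on_def
            blinfun.add_left cinner_simps)
      show "s (c *\<^sub>C X) = c * s X" if "X \<in> mats 1 S" for c X
        using that \<phi> by (simp add: s_def mats_def unital_linear_map_def clinear_on_def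
            cinner_simps)
      show "0 \<le> s X" if "X \<in> mats 1 S" "op_matrix_pos 1 X" for X
      proof -
        have "op_matrix_pos 1 (\<lambda>i j. \<phi> (X i j))"
          using pos that unfolding n_positive_on_def mats_def by blast
        from this[unfolded op_matrix_pos_def, rule_format, of "\<lambda>_. x"]
        show ?thesis by (simp add: s_def)
      qed
    qed fact
    have "s (mat_adj (\<lambda>_ _. T)) = cnj (s (\<lambda>_ _. T))"
      by (rule s_mat_adj) (simp add: mats_def T)
    then have "cinner (blinfun_apply (\<phi> (cadjoint T)) x) x = cnj (cinner (blinfun_apply (\<phi> T) x) x)"
      by (simp add: s_def mat_adj_def)
    also have "\<dots> = cinner (blinfun_apply (cadjoint (\<phi> T)) x) x"
      by (simp add: cinner_cadjoint_left[OF \<phi>S[OF T]] cinner_commute[symmetric])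
    finally show "cinner (blinfun_apply (\<phi> (cadjoint T) - cadjoint (\<phi> T)) x) x = 0"
      by (simp add: blinfun.diff_left cinner_simps)
  qed
  then show ?thesis by simp
qed

lemma complete_isometry_ucp_map:
  assumes A: "\<forall>i. A i \<in> bounded_ops"
    and \<phi>: "unital_complete_isometry (op_system A) (op_system B) \<phi>"
  shows "ucp_map (op_system A) (op_system B) \<phi>"
proof -
  have lin: "unital_linear_map (op_system A) (op_system B) \<phi>"
    using \<phi> by (simp add: unital_complete_isometry_def)
  have "n_positive_on op_matrix_pos op_matrix_pos n (op_system A) \<phi>" if "n \<ge> 1" for n
  proof (rule unital_contraction_n_positive[OF operator_system_op_system[OF A] lin])
    fix X assume "X \<in> mats n (op_system A)"
    then show "op_matrix_norm n (\<lambda>i j. \<phi> (X i j)) \<le> op_matrix_norm n X"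
      using \<phi> that by (simp add: unital_complete_isometry_def mats_def)
  qed
  then show ?thesis using lin by (simp add: ucp_map_def)
qed

text \<open>\<open>\<phi>\<close> is prescribed at the \<open>A i\<close> only. That it sends their
  adjoints to those of the \<open>B i\<close>, and hence preserves coefficients, comes from its
  positivity.\<close>

lemma complete_isometry_imp_norm_transfer:
  assumes A: "\<forall>i. A i \<in> bounded_ops" and B: "\<forall>i. B i \<in> bounded_ops"
    and \<phi>: "unital_complete_isometry (op_system A) (op_system B) \<phi>" "\<forall>i. \<phi> (A i) = B i"
  shows "norm_transfer A B"
  unfolding norm_transfer_def
proof (intro allI impI)
  fix n :: nat and c assume n: "n \<ge> 1"
  have lin: "unital_linear_map (op_system A) (op_system B) \<phi>"
    using \<phi>(1) by (simp add: unital_complete_isometry_def)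
  have S': "op_system B \<subseteq> bounded_ops"
    using operator_system_op_system[OF B] by (simp add: operator_system_def)
  have pos: "n_positive_on op_matrix_pos op_matrix_pos 1 (op_system A) \<phi>"
    using complete_isometry_ucp_map[OF A \<phi>(1)] by (simp add: ucp_map_def)
  have gen: "\<phi> (gen A k) = gen B k" for k
    using n_positive_cadjoint[OF operator_system_op_system[OF A] S' lin pos generator_in_op_system]
      \<phi>(2) lin by (auto simp: gen_def unital_linear_map_def split: option.split)
  have os: "operator_system (op_system A)" by (rule operator_system_op_system[OF A])
  then have "gen A k \<in> op_system A" for k
    using gen_in_operator_system generator_in_op_system by blast
  then have \<phi>_lc: "\<phi> (lincomb A c) = lincomb B c" for c
    using lin os unfolding lincomb_def
    by (subst clinear_on_lincomb) (auto simp: unital_linear_map_def operator_system_def gen)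
  have "\<forall>i<n. \<forall>j<n. lincomb_mat A c i j \<in> op_system A"
    by (simp add: lincomb_mat_def op_system_eq)
  then have "op_matrix_norm n (\<lambda>i j. \<phi> (lincomb_mat A c i j)) = op_matrix_norm n (lincomb_mat A c)"
    using \<phi>(1) n by (simp add: unital_complete_isometry_def)
  moreover have "(\<lambda>i j. \<phi> (lincomb_mat A c i j)) = lincomb_mat B c"
    by (simp add: lincomb_mat_def \<phi>_lc fun_eq_iff)
  ultimately show "op_matrix_norm n (lincomb_mat B c) = op_matrix_norm n (lincomb_mat A c)"
    by simp
qed

lemma norm_transfer_imp_complete_isometry:
  assumes tr: "norm_transfer A B"
  shows "\<exists>\<phi>. unital_complete_isometry (op_system A) (op_system B) \<phi> \<and> (\<forall>i. \<phi> (A i) = B i)"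
proof -
  have zero: "lincomb B c = 0" if "lincomb A c = 0" for c
  proof (rule blinfun_eqI)
    fix x
    let ?c = "\<lambda>(i :: nat) (j :: nat). c"
    have "op_matrix_norm 1 (lincomb_mat A ?c) \<le> 0"
      by (rule op_matrix_norm_le) (simp_all add: lincomb_mat_def that mat_app_def tnorm_def L2_set_def)
    then have "op_matrix_norm 1 (lincomb_mat B ?c) \<le> 0"
      using tr by (simp add: norm_transfer_def)
    then have "tnorm 1 (mat_app 1 (lincomb_mat B ?c) (\<lambda>_. x)) \<le> 0"
      using tnorm_mat_app_le[of 1 "lincomb_mat B ?c" "\<lambda>_. x"]
        mult_right_mono[of "op_matrix_norm 1 (lincomb_mat B ?c)" 0 "tnorm 1 (\<lambda>_. x)"] by simp
    then show "blinfun_apply (lincomb B c) x = blinfun_apply 0 x"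
      by (simp add: tnorm_1 mat_app_def lincomb_mat_def)
  qed
  obtain \<phi> where \<phi>: "unital_linear_map (op_system A) (op_system B) \<phi>"
    "\<And>c. \<phi> (lincomb A c) = lincomb B c" "\<And>i. \<phi> (A i) = B i"
    by (rule linear_map_of_lincomb[of A B]) (use zero in blast)+
  have "op_matrix_norm n (\<lambda>i j. \<phi> (X i j)) = op_matrix_norm n X"
    if n: "n \<ge> 1" and X: "\<forall>i<n. \<forall>j<n. X i j \<in> op_system A" for n X
  proof -
    obtain c where c: "\<And>i j. i < n \<Longrightarrow> j < n \<Longrightarrow> X i j = lincomb_mat A c i j"
      using mats_op_system_lincomb_mat[of X n A] X by (auto simp: mats_def)
    have "op_matrix_norm n (\<lambda>i j. \<phi> (X i j)) = op_matrix_norm n (lincomb_mat B c)"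
      by (rule op_matrix_norm_cong) (simp add: c lincomb_mat_def \<phi>(2))
    also have "\<dots> = op_matrix_norm n (lincomb_mat A c)"
      using tr n by (simp add: norm_transfer_def)
    also have "\<dots> = op_matrix_norm n X"
      by (rule op_matrix_norm_cong) (simp add: c)
    finally show ?thesis .
  qed
  then show ?thesis
    using \<phi> by (auto simp: unital_complete_isometry_def)
qed

section \<open>Block matrices and complete contractivity\<close>

lemma sum_lessThan_add: "(\<Sum>i<n + m. f i) = (\<Sum>i<n. f i) + (\<Sum>i<m. f (n + i :: nat) :: 'b :: comm_monoid_add)"
  by (induction m) (simp_all add: add.assoc)

lemma tinner_block:
  fixes \<zeta> :: "nat \<Rightarrow> 'a :: chilbert_space"
  shows "tinner (n + n) (mat_app (n + n) Z \<zeta>) \<zeta> =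
    tinner n (mat_app n Z \<zeta>) \<zeta> +
    tinner n (mat_app n (\<lambda>i j. Z i (n + j)) (\<lambda>i. \<zeta> (n + i))) \<zeta> +
    tinner n (mat_app n (\<lambda>i. Z (n + i)) \<zeta>) (\<lambda>i. \<zeta> (n + i)) +
    tinner n (mat_app n (\<lambda>i j. Z (n + i) (n + j)) (\<lambda>i. \<zeta> (n + i))) (\<lambda>i. \<zeta> (n + i))"
  by (simp add: tinner_def mat_app_def sum_lessThan_add cinner_simps sum.distrib)

text \<open>If \<open>X\<close> has coefficients \<open>c\<close>, these are the coefficients of the block matrix with diagonal
  blocks \<open>R\<close> and off-diagonal blocks \<open>X\<close>, \<open>X\<^sup>*\<close>, which is positive if and only if \<open>X\<close> has norm
  at most \<open>R\<close>.\<close>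

definition block_coeff ::
    "nat \<Rightarrow> real \<Rightarrow> (nat \<Rightarrow> nat \<Rightarrow> 'd option \<times> bool \<Rightarrow> complex) \<Rightarrow>
     nat \<Rightarrow> nat \<Rightarrow> 'd option \<times> bool \<Rightarrow> complex" where
  "block_coeff n R c i j =
     (if i < n \<longleftrightarrow> j < n then if i = j then complex_of_real R *\<^sub>C unit_coeff (None, False) else 0
      else if i < n then c i (j - n) else adj_coeff (c j (i - n)))"

lemma tinner_block_coeff:
  fixes A :: "'d :: finite \<Rightarrow> 'h :: chilbert_space \<Rightarrow>\<^sub>L 'h"
  assumes A: "\<forall>i. A i \<in> bounded_ops"
  shows "tinner (n + n) (mat_app (n + n) (lincomb_mat A (block_coeff n R c)) \<zeta>) \<zeta> =
    complex_of_real (R * (tnorm n \<zeta>)\<^sup>2 + R * (tnorm n (\<lambda>i. \<zeta> (n + i)))\<^sup>2 +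
      2 * Re (tinner n (mat_app n (lincomb_mat A c) (\<lambda>i. \<zeta> (n + i))) \<zeta>))"
proof -
  let ?Z = "lincomb_mat A (block_coeff n R c)" and ?X = "lincomb_mat A c"
  let ?\<beta> = "\<lambda>i. \<zeta> (n + i)"
  have id: "lincomb A (complex_of_real R *\<^sub>C unit_coeff (None, False)) = R *\<^sub>R id_blinfun"
    by (metis lincomb_scaleC lincomb_unit gen_simps(1) scaleC_of_real)
  have X: "?X \<in> mats n bounded_ops"
    using lincomb_bounded_ops[OF A] by (simp add: mats_def lincomb_mat_def)
  have cong: "tinner n (mat_app n Y \<xi>) \<eta> = tinner n (mat_app n Y' \<xi>) \<eta>"
    if "\<And>i j. i < n \<Longrightarrow> j < n \<Longrightarrow> Y i j = Y' i j" for Y Y' and \<xi> \<eta> :: "nat \<Rightarrow> 'h"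
    using that by (simp add: tinner_def mat_app_def)
  have "tinner n (mat_app n ?Z \<zeta>) \<zeta> = tinner n (mat_app n (R *\<^sub>R id_mat) \<zeta>) \<zeta>"
    by (rule cong) (auto simp: lincomb_mat_def block_coeff_def id id_mat_def lincomb_zero)
  moreover have "tinner n (mat_app n (\<lambda>i j. ?Z i (n + j)) ?\<beta>) \<zeta> = tinner n (mat_app n ?X ?\<beta>) \<zeta>"
    by (rule cong) (auto simp: lincomb_mat_def block_coeff_def)
  moreover have "tinner n (mat_app n (\<lambda>i. ?Z (n + i)) \<zeta>) ?\<beta> = tinner n (mat_app n (mat_adj ?X) \<zeta>) ?\<beta>"
    by (rule cong) (auto simp: lincomb_mat_def block_coeff_def mat_adj_def cadjoint_lincomb[OF A])
  moreover have "tinner n (mat_app n (\<lambda>i j. ?Z (n + i) (n + j)) ?\<beta>) ?\<beta>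
      = tinner n (mat_app n (R *\<^sub>R id_mat) ?\<beta>) ?\<beta>"
    by (rule cong) (auto simp: lincomb_mat_def block_coeff_def id id_mat_def lincomb_zero)
  moreover have "tinner n \<zeta> (mat_app n ?X ?\<beta>) = cnj (tinner n (mat_app n ?X ?\<beta>) \<zeta>)"
    by (rule tinner_commute)
  ultimately show ?thesis
    unfolding tinner_block
    by (simp add: tinner_mat_adj[OF X] mat_app_simps tinner_simps tinner_self complex_eq_iff)
qed

text \<open>For \<open>A\<close> the block matrix with diagonal \<open>?R\<close> is positive by the
  norm bound; its positivity for \<open>B\<close>, at size \<open>n + n\<close>, bounds the norm at
  each \<open>\<beta>\<close> through one well-chosen tuple.\<close>

lemma pos_transfer_norm_le:
  fixes A :: "'d :: finite \<Rightarrow> 'h :: chilbert_space \<Rightarrow>\<^sub>L 'h"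
    and B :: "'d \<Rightarrow> 'k :: chilbert_space \<Rightarrow>\<^sub>L 'k"
  assumes A: "\<forall>i. A i \<in> bounded_ops" and B: "\<forall>i. B i \<in> bounded_ops"
    and tr: "pos_transfer A B" and n: "n \<ge> 1"
  shows "op_matrix_norm n (lincomb_mat B c) \<le> op_matrix_norm n (lincomb_mat A c)"
proof (rule op_matrix_norm_le)
  let ?R = "op_matrix_norm n (lincomb_mat A c)" and ?X = "lincomb_mat B c"
  show "0 \<le> ?R" by (rule op_matrix_norm_nonneg)
  have "op_matrix_pos (n + n) (lincomb_mat A (block_coeff n ?R c))"
    unfolding op_matrix_pos_iff
  proof
    fix \<zeta> :: "nat \<Rightarrow> 'h"
    let ?\<beta> = "\<lambda>i. \<zeta> (n + i)"
    let ?t = "tinner n (mat_app n (lincomb_mat A c) ?\<beta>) \<zeta>"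
    have "\<bar>Re ?t\<bar> \<le> tnorm n (mat_app n (lincomb_mat A c) ?\<beta>) * tnorm n \<zeta>"
      using tinner_norm_le abs_Re_le_cmod order_trans by blast
    also have "\<dots> \<le> ?R * tnorm n ?\<beta> * tnorm n \<zeta>"
      by (intro mult_right_mono tnorm_mat_app_le) simp
    finally have "2 * \<bar>Re ?t\<bar> \<le> ?R * (2 * tnorm n \<zeta> * tnorm n ?\<beta>)"
      by (simp add: mult_ac)
    also have "\<dots> \<le> ?R * ((tnorm n \<zeta>)\<^sup>2 + (tnorm n ?\<beta>)\<^sup>2)"
      by (intro mult_left_mono sum_squares_bound op_matrix_norm_nonneg)
    finally have "0 \<le> ?R * (tnorm n \<zeta>)\<^sup>2 + ?R * (tnorm n ?\<beta>)\<^sup>2 + 2 * Re ?t"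
      by (simp add: algebra_simps)
    then show "0 \<le> tinner (n + n) (mat_app (n + n) (lincomb_mat A (block_coeff n ?R c)) \<zeta>) \<zeta>"
      unfolding tinner_block_coeff[OF A] by (simp add: less_eq_complex_def)
  qed
  then have pos: "op_matrix_pos (n + n) (lincomb_mat B (block_coeff n ?R c))"
    using tr n unfolding pos_transfer_def by simp
  fix \<beta> :: "nat \<Rightarrow> 'k"
  let ?y = "mat_app n ?X \<beta>"
  show "tnorm n ?y \<le> ?R * tnorm n \<beta>"
  proof (cases "tnorm n ?y = 0 \<or> tnorm n \<beta> = 0")
    case True
    then show ?thesis
      using tnorm_mat_app_le[of n ?X \<beta>] op_matrix_norm_nonneg[of n "lincomb_mat A c"] by auto
  next
    case False
    then have y: "tnorm n ?y > 0" and b: "tnorm n \<beta> > 0" by (simp_all add: less_le)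
    \<comment> \<open>The first block of \<open>\<zeta>\<close> is opposite in direction to
      \<open>?y\<close> and as long as \<open>\<beta>\<close>, which makes the cross term as
      negative as possible.\<close>
    define t where "t = tnorm n \<beta> / tnorm n ?y"
    define \<zeta> where "\<zeta> i = (if i < n then ((- t) *\<^sub>R ?y) i else \<beta> (i - n))" for i
    have \<beta>: "(\<lambda>i. \<zeta> (n + i)) = \<beta>" by (simp add: \<zeta>_def)
    have "tnorm n \<zeta> = tnorm n ((- t) *\<^sub>R ?y)"
      by (rule tnorm_cong) (simp add: \<zeta>_def)
    also have "\<dots> = tnorm n \<beta>"
      using tuple_form.nrm_scaleR[of n "- t" ?y] y b by (simp add: t_def)
    finally have \<zeta>: "tnorm n \<zeta> = tnorm n \<beta>" .
    have "tinner n ?y \<zeta> = tinner n ?y ((- t) *\<^sub>R ?y)"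
      by (simp add: tinner_def \<zeta>_def)
    also have "\<dots> = - complex_of_real (tnorm n \<beta> * tnorm n ?y)"
      using y by (simp only: tinner_simps(9) tinner_self) (simp add: t_def power2_eq_square)
    finally have ip: "tinner n ?y \<zeta> = - complex_of_real (tnorm n \<beta> * tnorm n ?y)" .
    have "0 \<le> tinner (n + n) (mat_app (n + n) (lincomb_mat B (block_coeff n ?R c)) \<zeta>) \<zeta>"
      using pos by (simp add: op_matrix_pos_iff)
    then have "0 \<le> ?R * (tnorm n \<beta>)\<^sup>2 + ?R * (tnorm n \<beta>)\<^sup>2 - 2 * (tnorm n \<beta> * tnorm n ?y)"
      unfolding tinner_block_coeff[OF B] by (simp add: less_eq_complex_def \<beta> \<zeta> ip)
    then have "tnorm n \<beta> * tnorm n ?y \<le> tnorm n \<beta> * (?R * tnorm n \<beta>)"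
      by (simp add: power2_eq_square mult_ac)
    then show ?thesis using b by (simp add: mult_le_cancel_left)
  qed
qed

lemma complete_isometry_iff_matrix_range_eq:
  assumes A: "\<forall>i. A i \<in> bounded_ops" and B: "\<forall>i. B i \<in> bounded_ops"
  shows "(\<exists>\<phi>. unital_complete_isometry (op_system A) (op_system B) \<phi> \<and> (\<forall>i. \<phi> (A i) = B i)) \<longleftrightarrow>
    matrix_range B = matrix_range A"
proof
  assume "\<exists>\<phi>. unital_complete_isometry (op_system A) (op_system B) \<phi> \<and> (\<forall>i. \<phi> (A i) = B i)"
  then obtain \<phi> where \<phi>: "unital_complete_isometry (op_system A) (op_system B) \<phi>" "\<forall>i. \<phi> (A i) = B i"
    by blast
  obtain \<psi> where \<psi>: "unital_complete_isometry (op_system B) (op_system A) \<psi>" "\<forall>i. \<psi> (B i) = A i"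
    using norm_transfer_imp_complete_isometry[OF norm_transfer_sym]
      complete_isometry_imp_norm_transfer[OF A B \<phi>] by blast
  show "matrix_range B = matrix_range A"
    using ucp_map_imp_matrix_range_subset[OF A B complete_isometry_ucp_map[OF A \<phi>(1)] \<phi>(2)]
      ucp_map_imp_matrix_range_subset[OF B A complete_isometry_ucp_map[OF B \<psi>(1)] \<psi>(2)]
    by blast
next
  assume "matrix_range B = matrix_range A"
  then have "pos_transfer A B" "pos_transfer B A"
    using matrix_range_subset_imp_pos_transfer[OF A B] matrix_range_subset_imp_pos_transfer[OF B A]
    by auto
  then have "norm_transfer A B"
    unfolding norm_transfer_def
    using pos_transfer_norm_le[OF A B] pos_transfer_norm_le[OF B A] by (auto intro: antisym)
  then show "\<exists>\<phi>. unital_complete_isometry (op_system A) (op_system B) \<phi> \<and> (\<forall>i. \<phi> (A i) = B i)"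
    by (rule norm_transfer_imp_complete_isometry)
qed

section \<open>Characters\<close>

text \<open>If the bound failed, \<open>T\<close> could be rescaled to \<open>T'\<close> with
  \<open>norm T' < 1\<close> and \<open>\<omega> T' = 1\<close>. Applying \<open>\<omega>\<close> to
  a solution of \<open>S = T' + T' S\<close> would give
  \<open>\<omega> S = 1 + \<omega> S\<close>.\<close>

lemma character_norm_le:
  assumes \<A>: "unital_cstar_subalgebra \<A>" and \<omega>: "character_on \<A> \<omega>" and T: "T \<in> \<A>"
  shows "cmod (\<omega> T) \<le> norm T"
proof (rule ccontr)
  assume "\<not> cmod (\<omega> T) \<le> norm T"
  then have less: "norm T < cmod (\<omega> T)" by simp
  then have ne: "\<omega> T \<noteq> 0" using norm_ge_zero[of T] by auto
  define T' where "T' = (1 / \<omega> T) *\<^sub>C T"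
  have sub: "complex_vector.subspace \<A>" and comp: "\<And>S T. S \<in> \<A> \<Longrightarrow> T \<in> \<A> \<Longrightarrow> S o\<^sub>L T \<in> \<A>"
    using \<A> by (auto simp: unital_cstar_subalgebra_def)
  have T': "T' \<in> \<A>" unfolding T'_def by (intro complex_vector.subspace_scale sub T)
  have "norm T' \<le> norm T / cmod (\<omega> T)"
  proof (rule norm_blinfun_bound)
    show "norm (blinfun_apply T' x) \<le> norm T / cmod (\<omega> T) * norm x" for x
      using norm_blinfun[of T x] ne by (simp add: T'_def norm_scaleC norm_divide field_simps)
  qed simp
  moreover have "norm T / cmod (\<omega> T) < 1" using less ne by simp
  ultimately have "norm T' < 1" by linarith
  text \<open>The fixed point is the Neumann series of \<open>T' (1 - T')\<^sup>-\<^sup>1\<close>.\<close>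
  have "\<exists>!S\<in>\<A>. T' + (T' o\<^sub>L S) = S"
  proof (rule Banach_fix[of \<A> "norm T'" "\<lambda>S. T' + (T' o\<^sub>L S)"])
    show "complete \<A>" using \<A> by (simp add: unital_cstar_subalgebra_def complete_eq_closed)
    show "(\<lambda>S. T' + (T' o\<^sub>L S)) ` \<A> \<subseteq> \<A>"
      using T' comp by (auto intro: complex_vector.subspace_add[OF sub])
    show "dist (T' + (T' o\<^sub>L S)) (T' + (T' o\<^sub>L S')) \<le> norm T' * dist S S'" for S S'
    proof -
      have "T' + (T' o\<^sub>L S) - (T' + (T' o\<^sub>L S')) = T' o\<^sub>L (S - S')"
        by (rule blinfun_eqI) (simp add: blinfun.diff_left blinfun.diff_right blinfun.add_left)
      then show ?thesis
        by (simp add: dist_norm norm_blinfun_compose)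
    qed
  qed (use \<open>norm T' < 1\<close> T' in auto)
  then obtain S where S: "S \<in> \<A>" "T' + (T' o\<^sub>L S) = S" by blast
  have "\<omega> T' = 1"
    using \<omega> T ne by (simp add: T'_def character_on_def clinear_on_def scaleC_complex_def)
  moreover have "\<omega> S = \<omega> T' + \<omega> T' * \<omega> S"
    using \<omega> S T' comp unfolding character_on_def clinear_on_def by metis
  ultimately show False by simp
qed

text \<open>By \<open>character_norm_le\<close> a character is a unital contraction, so the disc
  argument applies to it as well.\<close>

lemma character_nonneg:
  assumes \<A>: "unital_cstar_subalgebra \<A>" and \<omega>: "character_on \<A> \<omega>" and T: "T \<in> \<A>"
    and pos: "\<And>x. 0 \<le> cinner (blinfun_apply T x) x"
  shows "0 \<le> \<omega> T"
proof (rule nonneg_of_discs[of "norm T" 1])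
  fix b
  let ?c = "Complex (norm T / 2) b" and ?X = "\<lambda>(i :: nat) (j :: nat). T"
  have sub: "complex_vector.subspace \<A>" and id: "id_blinfun \<in> \<A>" and "T \<in> bounded_ops"
    using \<A> T by (auto simp: unital_cstar_subalgebra_def)
  have in_\<A>: "T + (- ?c) *\<^sub>C id_blinfun \<in> \<A>"
    by (intro complex_vector.subspace_add complex_vector.subspace_scale sub T id)
  have X: "?X \<in> mats 1 bounded_ops" "op_matrix_pos 1 ?X"
    using \<open>T \<in> bounded_ops\<close> pos by (simp_all add: mats_def op_matrix_pos_def)
  have "norm (T + (- ?c) *\<^sub>C id_blinfun) \<le> sqrt ((norm T)\<^sup>2 / 4 + b\<^sup>2)"
  proof (rule norm_blinfun_bound)
    fix x
    have "tnorm 1 (mat_app 1 (?X - ?c *\<^sub>C id_mat) (\<lambda>_. x))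
        \<le> sqrt ((norm T)\<^sup>2 / 4 + b\<^sup>2) * tnorm 1 (\<lambda>_. x)"
      by (rule tnorm_disc[OF X]) (simp add: tnorm_1 mat_app_def norm_blinfun)
    then show "norm (blinfun_apply (T + (- ?c) *\<^sub>C id_blinfun) x)
        \<le> sqrt ((norm T)\<^sup>2 / 4 + b\<^sup>2) * norm x"
      by (simp add: tnorm_1 mat_app_def id_mat_def blinfun.diff_left blinfun.add_left
          complex_vector.scale_minus_left)
  qed simp
  then have "cmod (\<omega> (T + (- ?c) *\<^sub>C id_blinfun)) \<le> sqrt ((norm T)\<^sup>2 / 4 + b\<^sup>2)"
    using character_norm_le[OF \<A> \<omega> in_\<A>] by linarith
  moreover have \<omega>_add: "\<omega> (T + d *\<^sub>C id_blinfun) = \<omega> T + d" for d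
    using \<omega> T id complex_vector.subspace_scale[OF sub id, of d]
    by (simp add: character_on_def clinear_on_def scaleC_complex_def)
  ultimately have "cmod (\<omega> T + (- ?c)) \<le> sqrt ((norm T)\<^sup>2 / 4 + b\<^sup>2)"
    by (simp only: \<omega>_add)
  then show "cmod (\<omega> T - ?c * complex_of_real 1) \<le> sqrt ((norm T)\<^sup>2 / 4 + b\<^sup>2) * 1"
    by simp
qed simp_all

text \<open>For scalar values complete positivity reduces to positivity: the form at
  \<open>z\<close> is \<open>\<omega>\<close> of the single operator \<open>T\<close> obtained by
  compressing \<open>X\<close> with \<open>z\<close>.\<close>

lemma character_ucp_entries:
  assumes \<A>: "unital_cstar_subalgebra \<A>" and \<omega>: "character_on \<A> \<omega>"
  shows "ucp_entries 1 \<A> (\<lambda>a b. \<omega>)"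
  unfolding ucp_entries_def
proof (intro conjI allI impI ballI)
  fix n :: nat and X and z :: "nat \<Rightarrow> nat \<Rightarrow> complex"
  assume X: "X \<in> mats n \<A>" and pos: "op_matrix_pos n X"
  define T where "T = (\<Sum>i<n. \<Sum>j<n. (z j 0 * cnj (z i 0)) *\<^sub>C X i j)"
  have sub: "complex_vector.subspace \<A>" using \<A> by (simp add: unital_cstar_subalgebra_def)
  have lin: "clinear_on \<A> \<omega>" using \<omega> by (simp add: character_on_def)
  have Xij: "X i j \<in> \<A>" if "i < n" "j < n" for i j using X that by (simp add: mats_def)
  have row: "(\<Sum>j<n. (z j 0 * cnj (z i 0)) *\<^sub>C X i j) \<in> \<A>" if "i < n" for i
    using Xij that by (intro complex_vector.subspace_sum complex_vector.subspace_scale sub) auto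
  have "\<omega> T = (\<Sum>i<n. \<omega> (\<Sum>j<n. (z j 0 * cnj (z i 0)) *\<^sub>C X i j))"
    unfolding T_def by (rule clinear_on_sum[OF lin sub]) (simp add: row)
  also have "\<dots> = quad 1 n (\<lambda>a b. \<omega>) X z"
    unfolding quad_def using Xij
    by (intro sum.cong refl, subst clinear_on_lincomb[OF lin sub])
      (auto simp: scaleC_complex_def mult_ac)
  finally have "quad 1 n (\<lambda>a b. \<omega>) X z = \<omega> T" ..
  moreover have "0 \<le> \<omega> T"
  proof (rule character_nonneg[OF \<A> \<omega>])
    show "T \<in> \<A>"
      unfolding T_def by (intro complex_vector.subspace_sum sub row) auto
    fix x
    have "\<A> \<subseteq> bounded_ops" using \<A> by (simp add: unital_cstar_subalgebra_def)
    then have Xb: "X \<in> mats n bounded_ops" using X mats_mono by blast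
    have "cinner (blinfun_apply T x) x = quad 1 n (\<lambda>a b T. cinner (blinfun_apply T x) x) X z"
      by (simp add: T_def quad_def blinfun.sum_left cinner_sum_left cinner_simps mult_ac)
    also have "\<dots> \<ge> 0"
      using quad_vector[OF Xb, of 1 "\<lambda>_. x" z] pos by (simp add: op_matrix_pos_iff)
    finally show "0 \<le> cinner (blinfun_apply T x) x" .
  qed
  ultimately show "0 \<le> quad 1 n (\<lambda>a b. \<omega>) X z" by simp
qed (use \<omega> in \<open>auto simp: character_on_def\<close>)

lemma scalar_tuple_eq: "scalar_tuple z = (\<lambda>i. mat 1 1 (\<lambda>(a, b). z i))"
  by (simp add: scalar_tuple_def split_def)

lemma joint_spectrum_subset_matrix_range:
  assumes B: "\<forall>i. B i \<in> bounded_ops"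
  shows "scalar_tuple ` joint_spectrum B \<subseteq> matrix_range_level 1 B"
proof
  fix W assume "W \<in> scalar_tuple ` joint_spectrum B"
  then obtain \<omega> where \<omega>: "character_on (cstar_algebra B) \<omega>" and W: "W = scalar_tuple (\<lambda>i. \<omega> (B i))"
    by (auto simp: joint_spectrum_def)
  have "ucp_entries 1 (cstar_algebra B) (\<lambda>a b. \<omega>)"
    by (rule character_ucp_entries[OF unital_cstar_subalgebra_cstar_algebra[OF B] \<omega>])
  then show "W \<in> matrix_range_level 1 B"
    unfolding matrix_range_level_eq[OF B] W scalar_tuple_eq mem_Collect_eq
    by (intro exI[of _ "\<lambda>a b. \<omega>"] conjI refl)
qed

section \<open>Fuglede's theorem\<close>

lemma coeff_1_le_Cauchy:
  fixes p :: "complex poly"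
  assumes "r > 0" "\<And>u. cmod u = r \<Longrightarrow> cmod (poly p u) \<le> C"
  shows "cmod (coeff p 1) \<le> C / r"
proof -
  have "norm ((deriv ^^ 1) (poly p) 0) \<le> fact 1 * C / r ^ 1"
    by (rule Cauchy_inequality) (use assms in \<open>auto intro!: holomorphic_intros continuous_intros\<close>)
  moreover have "deriv (poly p) 0 = coeff p 1"
    by (simp add: DERIV_imp_deriv[OF poly_DERIV] poly_0_coeff_0 coeff_pderiv)
  ultimately show ?thesis by simp
qed

text \<open>A weak notion of a vector-valued polynomial in \<open>u\<close>, keeping track of the
  constant and linear coefficients. The linear one is what Cauchy's inequality controls.\<close>

definition poly_jet :: "(complex \<Rightarrow> 'a :: chilbert_space) \<Rightarrow> 'a \<Rightarrow> 'a \<Rightarrow> bool" where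
  "poly_jet G a b \<longleftrightarrow>
     (\<forall>y. \<exists>p. (\<forall>u. cinner (G u) y = poly p u) \<and> coeff p 0 = cinner a y \<and> coeff p 1 = cinner b y)"

definition affine_op :: "('a :: chilbert_space \<Rightarrow>\<^sub>L 'a) \<Rightarrow> complex \<Rightarrow> 'a \<Rightarrow> 'a" where
  "affine_op S u x = x + u *\<^sub>C blinfun_apply S x"

lemma poly_jet_const: "poly_jet (\<lambda>_. x) x 0"
  unfolding poly_jet_def by (intro allI exI[of _ "[:cinner x _:]"]) simp

lemma poly_jet_apply:
  assumes "poly_jet G a b" "T \<in> bounded_ops"
  shows "poly_jet (\<lambda>u. blinfun_apply T (G u)) (blinfun_apply T a) (blinfun_apply T b)"
  using assms(1) unfolding poly_jet_def cinner_cadjoint_right[OF assms(2), symmetric] by blast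

text \<open>The product rule at \<open>u = 0\<close>, where \<open>affine_op\<close> is the
  identity.\<close>

lemma poly_jet_affine_op:
  assumes G: "poly_jet G a b" and S: "S \<in> bounded_ops"
  shows "poly_jet (\<lambda>u. affine_op S (c * u) (G u)) a (b + c *\<^sub>C blinfun_apply S a)"
  unfolding poly_jet_def
proof
  fix y
  obtain p where p: "\<And>u. cinner (G u) y = poly p u" "coeff p 0 = cinner a y" "coeff p 1 = cinner b y"
    using G unfolding poly_jet_def by blast
  obtain q where q: "\<And>u. cinner (blinfun_apply S (G u)) y = poly q u"
    "coeff q 0 = cinner (blinfun_apply S a) y"
    using poly_jet_apply[OF G S] unfolding poly_jet_def by blast
  show "\<exists>p. (\<forall>u. cinner (affine_op S (c * u) (G u)) y = poly p u) \<and> coeff p 0 = cinner a y \<and>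
      coeff p 1 = cinner (b + c *\<^sub>C blinfun_apply S a) y"
    by (intro exI[of _ "p + Polynomial.smult c (pCons 0 q)"])
      (simp add: affine_op_def p q p(3)[unfolded One_nat_def] cinner_simps algebra_simps)
qed

lemma poly_jet_affine_op_funpow:
  assumes G: "poly_jet G a b" and S: "S \<in> bounded_ops"
  shows "poly_jet (\<lambda>u. (affine_op S (c * u) ^^ k) (G u)) a (b + (of_nat k * c) *\<^sub>C blinfun_apply S a)"
proof (induction k)
  case (Suc k)
  from poly_jet_affine_op[OF Suc S, of c] show ?case
    by (simp add: scaleC_add_left algebra_simps)
qed (simp add: G)

lemma affine_op_commute:
  assumes "S \<in> bounded_ops" "N \<in> bounded_ops" "S o\<^sub>L N = N o\<^sub>L S"
  shows "affine_op S u (affine_op N v x) = affine_op N v (affine_op S u x)"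
proof -
  have "blinfun_apply S (blinfun_apply N x) = blinfun_apply N (blinfun_apply S x)"
    using assms(3) by (metis blinfun_apply_blinfun_compose)
  then show ?thesis
    by (simp add: affine_op_def blinfun.add_right bounded_opsD[OF assms(1)] bounded_opsD[OF assms(2)]
        scaleC_add_right scaleC_scaleC mult.commute add_ac)
qed

lemma funpow_commute: "(\<And>x. f (h x) = h (f x)) \<Longrightarrow> (f ^^ k) (h x) = h ((f ^^ k) x)"
  by (induction k) simp_all

text \<open>\<open>affine_op (cadjoint N) u\<close> is the adjoint of the normal operator
  \<open>affine_op N (cnj u)\<close>, and a normal operator and its adjoint give every vector the
  same norm. The two commute, so the factors of a power can be exchanged one by one.\<close>

lemma norm_affine_op_adjoint:
  assumes N: "N \<in> bounded_ops" and normal: "normal_op N"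
  shows "norm ((affine_op (cadjoint N) u ^^ k) x) = norm ((affine_op N (cnj u) ^^ k) x)"
proof (induction k arbitrary: x)
  case (Suc k)
  have comm: "cadjoint N o\<^sub>L N = N o\<^sub>L cadjoint N"
    using normal by (simp add: normal_op_def)
  have one: "norm (affine_op (cadjoint N) u z) = norm (affine_op N (cnj u) z)" for z
  proof -
    have "cinner (blinfun_apply (cadjoint N) z) (blinfun_apply (cadjoint N) z)
        = cinner (blinfun_apply (N o\<^sub>L cadjoint N) z) z"
      by (simp add: cinner_cadjoint_right[OF N])
    also have "\<dots> = cinner (blinfun_apply N z) (blinfun_apply N z)"
      unfolding comm[symmetric] by (simp add: cinner_cadjoint_left[OF N])
    finally have eq: "cinner (blinfun_apply (cadjoint N) z) (blinfun_apply (cadjoint N) z)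
        = cinner (blinfun_apply N z) (blinfun_apply N z)" .
    have ips: "cinner (blinfun_apply (cadjoint N) z) z = cinner z (blinfun_apply N z)"
      "cinner z (blinfun_apply (cadjoint N) z) = cinner (blinfun_apply N z) z"
      by (simp_all add: cinner_cadjoint_left[OF N] cinner_cadjoint_right[OF N])
    have "(norm (affine_op (cadjoint N) u z))\<^sup>2 = (norm (affine_op N (cnj u) z))\<^sup>2"
      unfolding norm_square_eq_cinner affine_op_def
      by (simp add: cinner_simps eq ips cinner_commute[of z "blinfun_apply N z"] algebra_simps)
    then show ?thesis
      by (simp add: power2_eq_iff_nonneg)
  qed
  have "norm ((affine_op (cadjoint N) u ^^ Suc k) x)
      = norm (affine_op N (cnj u) ((affine_op (cadjoint N) u ^^ k) x))"
    by (simp add: one)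
  also have "\<dots> = norm ((affine_op (cadjoint N) u ^^ k) (affine_op N (cnj u) x))"
    by (subst funpow_commute) (simp_all add: affine_op_commute N comm)
  also have "\<dots> = norm ((affine_op N (cnj u) ^^ Suc k) x)"
    unfolding Suc.IH by (simp add: funpow_swap1)
  finally show ?case .
qed simp

text \<open>With \<open>S\<close> the adjoint of \<open>N\<close>, the vector \<open>(1 + u S)\<^sup>k T (1 - u S)\<^sup>k x\<close> is polynomial in
  \<open>u\<close>, and its linear coefficient is \<open>k\<close> times the commutator. Normality of \<open>N\<close> allows replacing
  \<open>S\<close> by \<open>N\<close> in norms, which moves \<open>T\<close> out of the way; hence a bound that does not
  depend on \<open>k\<close> on the circle of radius \<open>1 / sqrt k\<close>.\<close>

lemma Fuglede:
  fixes N T :: "'a :: chilbert_space \<Rightarrow>\<^sub>L 'a"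
  assumes N: "N \<in> bounded_ops" and normal: "normal_op N" and T: "T \<in> bounded_ops"
    and comm: "N o\<^sub>L T = T o\<^sub>L N"
  shows "cadjoint N o\<^sub>L T = T o\<^sub>L cadjoint N"
proof (rule blinfun_eqI, rule cinner_eqI)
  fix x y :: 'a
  let ?S = "cadjoint N"
  have S: "?S \<in> bounded_ops" using N by simp
  define L where "L u k = (affine_op ?S u ^^ k)" for u and k :: nat
  define d where "d = blinfun_apply ?S (blinfun_apply T x) - blinfun_apply T (blinfun_apply ?S x)"
  define C where "C = norm T * exp ((norm ?S)\<^sup>2) * norm x * norm y"
  have NT: "affine_op N v (blinfun_apply T z) = blinfun_apply T (affine_op N v z)" for v z
    using comm by (simp add: affine_op_def blinfun.add_right bounded_opsD[OF T])
      (metis blinfun_apply_blinfun_compose)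
  have LT: "norm (L u k (blinfun_apply T z)) \<le> norm T * norm (L u k z)" for u k z
  proof -
    have "norm (L u k (blinfun_apply T z)) = norm (blinfun_apply T ((affine_op N (cnj u) ^^ k) z))"
      unfolding L_def norm_affine_op_adjoint[OF N normal] by (subst funpow_commute) (simp_all add: NT)
    also have "\<dots> \<le> norm T * norm ((affine_op N (cnj u) ^^ k) z)"
      by (rule norm_blinfun)
    finally show ?thesis
      unfolding L_def norm_affine_op_adjoint[OF N normal] .
  qed
  \<comment> \<open>The product of \<open>1 + u S\<close> and \<open>1 - u S\<close> has no linear
    term in \<open>u\<close>. So at \<open>cmod u = 1 / sqrt k\<close> the \<open>k\<close>-th power
    stays below \<open>exp ((norm ?S)\<^sup>2)\<close>.\<close>
  have LL: "norm (L u k (L (- u) k z)) \<le> (1 + (cmod u)\<^sup>2 * (norm ?S)\<^sup>2) ^ k * norm z" for u k z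
  proof (induction k arbitrary: z)
    case (Suc k)
    let ?w = "L u k (L (- u) k z)"
    have "L u (Suc k) (L (- u) (Suc k) z) = affine_op ?S u (affine_op ?S (- u) ?w)"
      unfolding L_def funpow.simps o_def
      by (subst funpow_commute) (simp_all add: affine_op_commute S)
    also have "\<dots> = ?w - (u * u) *\<^sub>C blinfun_apply ?S (blinfun_apply ?S ?w)"
      by (simp add: affine_op_def blinfun.add_right blinfun.minus_right bounded_opsD[OF S]
          scaleC_scaleC complex_vector.scale_minus_left scaleC_add_right
          complex_vector.scale_minus_right complex_vector.scale_right_diff_distrib blinfun.diff_right)
    finally have "norm (L u (Suc k) (L (- u) (Suc k) z))
        \<le> norm ?w + (cmod u)\<^sup>2 * norm (blinfun_apply ?S (blinfun_apply ?S ?w))"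
      using norm_triangle_ineq4 by (metis norm_scaleC norm_mult power2_eq_square)
    also have "\<dots> \<le> norm ?w + (cmod u)\<^sup>2 * (norm ?S * (norm ?S * norm ?w))"
      by (intro add_left_mono mult_left_mono order_trans[OF norm_blinfun] norm_blinfun) auto
    also have "\<dots> = (1 + (cmod u)\<^sup>2 * (norm ?S)\<^sup>2) * norm ?w"
      by (simp add: power2_eq_square algebra_simps)
    also have "\<dots> \<le> (1 + (cmod u)\<^sup>2 * (norm ?S)\<^sup>2) * ((1 + (cmod u)\<^sup>2 * (norm ?S)\<^sup>2) ^ k * norm z)"
      by (intro mult_left_mono Suc.IH) simp
    finally show ?case by (simp add: mult.assoc)
  qed (simp add: L_def)
  have bound: "sqrt (real k) * cmod (cinner d y) \<le> C" if "k \<ge> 1" for k :: nat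
  proof -
    have "poly_jet (\<lambda>u. L u k (blinfun_apply T (L (- u) k x))) (blinfun_apply T x) (of_nat k *\<^sub>C d)"
      using poly_jet_affine_op_funpow[OF poly_jet_apply[OF
            poly_jet_affine_op_funpow[OF poly_jet_const[of x] S, where c = "-1" and k = k] T] S,
          where c = 1 and k = k]
      by (simp add: L_def d_def bounded_opsD[OF T] complex_vector.scale_right_diff_distrib
          blinfun.minus_right complex_vector.scale_minus_left)
    then obtain p where p: "\<And>u. cinner (L u k (blinfun_apply T (L (- u) k x))) y = poly p u"
      "coeff p 1 = cinner (of_nat k *\<^sub>C d) y"
      unfolding poly_jet_def by blast
    \<comment> \<open>Cauchy's inequality on this circle costs a factor \<open>sqrt k\<close>, while
      the linear coefficient carries the factor \<open>k\<close>; the surplus \<open>sqrt k\<close>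
      forces \<open>cinner d y = 0\<close> as \<open>k\<close> grows.\<close>
    have "cmod (coeff p 1) \<le> C / (1 / sqrt (real k))"
    proof (rule coeff_1_le_Cauchy)
      fix u assume u: "cmod u = 1 / sqrt (real k)"
      have "(1 + (cmod u)\<^sup>2 * (norm ?S)\<^sup>2) ^ k \<le> exp ((norm ?S)\<^sup>2 / real k) ^ k"
        using exp_ge_add_one_self[of "(norm ?S)\<^sup>2 / real k"] that
        by (intro power_mono) (simp_all add: u power_divide)
      also have "\<dots> = exp ((norm ?S)\<^sup>2)"
        using that by (simp flip: exp_of_nat_mult)
      finally have e: "(1 + (cmod u)\<^sup>2 * (norm ?S)\<^sup>2) ^ k \<le> exp ((norm ?S)\<^sup>2)" .
      have "cmod (poly p u) \<le> norm (L u k (blinfun_apply T (L (- u) k x))) * norm y"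
        unfolding p(1)[symmetric] by (rule norm_cinner_le)
      also have "\<dots> \<le> (norm T * (exp ((norm ?S)\<^sup>2) * norm x)) * norm y"
        by (intro mult_right_mono order_trans[OF LT] mult_left_mono order_trans[OF LL] e) simp_all
      finally show "cmod (poly p u) \<le> C" by (simp add: C_def mult_ac)
    qed (use that in simp)
    then have "cmod (cinner (of_nat k *\<^sub>C d) y) \<le> C * sqrt (real k)"
      unfolding p(2) by simp
    then have "real k * cmod (cinner d y) \<le> C * sqrt (real k)"
      by (simp add: cinner_simps norm_mult)
    then have "sqrt (real k) * (sqrt (real k) * cmod (cinner d y)) \<le> sqrt (real k) * C"
      by (simp add: mult_ac flip: mult.assoc)
    then show ?thesis using that by simp
  qed
  have "cinner d y = 0"
  proof (rule ccontr)
    assume "cinner d y \<noteq> 0"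
    then have pos: "cmod (cinner d y) > 0" by simp
    obtain k :: nat where k: "(C / cmod (cinner d y))\<^sup>2 + 1 < real k"
      using reals_Archimedean2 by blast
    then have "0 < real k" using zero_le_power2[of "C / cmod (cinner d y)"] by linarith
    then have "k \<ge> 1" by simp
    have "C / cmod (cinner d y) < sqrt (real k)"
      using k by (intro real_less_rsqrt) simp
    then show False using bound[OF \<open>k \<ge> 1\<close>] pos by (simp add: field_simps)
  qed
  then show "cinner (blinfun_apply (?S o\<^sub>L T) x) y = cinner (blinfun_apply (T o\<^sub>L ?S) x) y"
    by (simp add: d_def cinner_simps)
qed

section \<open>Approximate joint eigenvectors\<close>

context psd_form
begin

definition bounded_symmetric :: "('v \<Rightarrow> 'v) \<Rightarrow> bool" where
  "bounded_symmetric h \<longleftrightarrow> linear h \<and> (\<forall>x y. g (h x) y = g x (h y)) \<and>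
     (\<exists>C. \<forall>x. nrm (h x) \<le> C * nrm x)"

definition approx_eigenvectors :: "(('v \<Rightarrow> 'v) \<Rightarrow> real) \<Rightarrow> ('v \<Rightarrow> 'v) set \<Rightarrow> real \<Rightarrow> 'v set" where
  "approx_eigenvectors \<Lambda> F e = {x. nrm x = 1 \<and> (\<forall>h\<in>F. nrm (h x - \<Lambda> h *\<^sub>R x) \<le> e)}"

text \<open>The new eigenvalue \<open>l\<close> is the least value asymptotically taken by the form of \<open>k\<close> on the
  approximate eigenvectors. If \<open>x\<close> almost attains it, then moving \<open>x\<close> in the direction of
  \<open>y = k x - l x\<close>, which stays among the approximate eigenvectors, cannot decrease the form
  by much, so \<open>y\<close> is small.\<close>

lemma approx_eigenvalue_step:
  assumes ne: "\<And>e. e > 0 \<Longrightarrow> approx_eigenvectors \<Lambda> F e \<noteq> {}"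
    and lin: "\<And>h. h \<in> F \<Longrightarrow> linear h"
    and comm: "\<And>h x. h \<in> F \<Longrightarrow> h (k x) = k (h x)"
    and k: "bounded_symmetric k"
  obtains l where "\<And>e. e > 0 \<Longrightarrow> \<exists>x\<in>approx_eigenvectors \<Lambda> F e. nrm (k x - l *\<^sub>R x) \<le> e"
    "\<And>x. (\<And>e. e > 0 \<Longrightarrow> x \<in> approx_eigenvectors \<Lambda> F e) \<Longrightarrow> l \<le> g (k x) x"
proof -
  have k_lin: "linear k" and k_sym: "\<And>x y. g (k x) y = g x (k y)"
    using k by (auto simp: bounded_symmetric_def)
  obtain C0 where C0: "\<And>x. nrm (k x) \<le> C0 * nrm x"
    using k by (auto simp: bounded_symmetric_def)
  define C where "C = max C0 0"
  have C: "nrm (k x) \<le> C * nrm x" for x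
    using C0[of x] mult_right_mono[of C0 C "nrm x"] nrm_nonneg[of x] by (simp add: C_def)
  let ?U = "approx_eigenvectors \<Lambda> F"
  have form_bound: "\<bar>g (k x) x\<bar> \<le> C" if "x \<in> ?U e" for x e
    using abs_le_nrm[of "k x" x] C[of x] that by (simp add: approx_eigenvectors_def)
  define M where "M e = (INF x\<in>?U e. g (k x) x)" for e
  have bdd: "bdd_below ((\<lambda>x. g (k x) x) ` ?U e)" for e
    by (rule bdd_belowI2[of _ "- C"]) (use form_bound in fastforce)
  have M_le: "M e \<le> g (k x) x" if "x \<in> ?U e" for e x
    unfolding M_def by (rule cINF_lower[OF bdd that])
  have M_le_C: "M e \<le> C" if "e > 0" for e
    using ne[OF that] M_le form_bound by fastforce
  define l where "l = (SUP e\<in>{0<..}. M e)"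
  have bddM: "bdd_above (M ` {0<..})"
    by (rule bdd_aboveI2[of _ _ C]) (use M_le_C in auto)
  have M_le_l: "M e \<le> l" if "e > 0" for e
    unfolding l_def using that by (intro cSUP_upper bddM) auto
  define D where "D = C + \<bar>l\<bar> + 1"
  have D: "D \<ge> 1" by (simp add: D_def C_def)
  define k' where "k' z = k z - l *\<^sub>R z" for z
  have k'_lin: "k' (x - t *\<^sub>R y) = k' x - t *\<^sub>R k' y" for x y t
    by (simp add: k'_def linear_diff[OF k_lin] linear_scale[OF k_lin] algebra_simps)
  have k'_bound: "nrm (k' z) \<le> D * nrm z" for z
  proof -
    have "nrm (k' z) \<le> nrm (k z) + nrm (l *\<^sub>R z)"
      unfolding k'_def by (rule nrm_triangle_diff)
    also have "\<dots> \<le> C * nrm z + \<bar>l\<bar> * nrm z"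
      using C[of z] by (simp add: nrm_scaleR)
    also have "\<dots> \<le> D * nrm z"
      using nrm_nonneg[of z] by (simp add: D_def algebra_simps)
    finally show ?thesis .
  qed
  have k'_sym: "g (k' x) y = g x (k' y)" for x y
    by (simp add: k'_def diff_left diff_right scaleR_left scaleR_right k_sym)
  show ?thesis
  proof (rule that)
    fix e :: real assume e: "e > 0"
    \<comment> \<open>At the end \<open>\<eta> + 9 / 4 * \<eta> = 13 / 4 * \<eta>\<close> bounds
      \<open>3 / (4 * D) * (nrm y)\<^sup>2\<close>; the constant 5 turns this into
      \<open>13 / 15\<close> of the square of \<open>e\<close>.\<close>
    define \<eta> where "\<eta> = e\<^sup>2 / (5 * D)"
    have \<eta>: "\<eta> > 0" using e D by (simp add: \<eta>_def)
    have "{0 :: real<..} \<noteq> {}" using e by auto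
    then obtain d0 where d0: "d0 > 0" "l - \<eta> < M d0"
      using less_cSUP_iff[OF _ bddM, of "l - \<eta>"] \<eta> by (auto simp: l_def)
    \<comment> \<open>Passing from \<open>x\<close> to \<open>v\<close> multiplies the defect by at
      most 3: by 3/2 for the move along \<open>y\<close> and by 2 for the normalisation.\<close>
    define d where "d = min e (d0 / 3)"
    have d: "d > 0" using e d0 by (simp add: d_def)
    obtain x where x: "x \<in> ?U d" "g (k x) x < l + \<eta>"
      using cINF_less_iff[OF ne[OF d] bdd, of "l + \<eta>"] M_le_l[OF d] \<eta> by (auto simp: M_def)
    have nx: "nrm x = 1" using x(1) by (simp add: approx_eigenvectors_def)
    define y where "y = k' x"
    have y_D: "nrm y \<le> D" using k'_bound[of x] by (simp add: y_def nx)
    \<comment> \<open>This step keeps \<open>nrm z\<close> between 1/2 and 3/2, and the second-order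
      term of the form is at most a quarter of the first-order decrease
      \<open>2 * t * g y y\<close>.\<close>
    define t where "t = 1 / (2 * D)"
    have t: "t > 0" "t * D = 1 / 2" using D by (simp_all add: t_def)
    define z where "z = x - t *\<^sub>R y"
    have "t * nrm y \<le> t * D"
      using t(1) by (intro mult_left_mono y_D) simp
    then have "t * nrm y \<le> 1 / 2" using t(2) by simp
    then have nz: "nrm z \<ge> 1 / 2" "nrm z \<le> 3 / 2"
      using nrm_diff_ge[of x "t *\<^sub>R y"] nrm_triangle_diff[of x "t *\<^sub>R y"] t(1)
      by (simp_all add: z_def nx nrm_scaleR)
    define v where "v = (1 / nrm z) *\<^sub>R z"
    have "v \<in> ?U d0"
      unfolding approx_eigenvectors_def
    proof (intro CollectI conjI ballI)
      show "nrm v = 1" using nz by (simp add: v_def nrm_scaleR)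
      fix h assume h: "h \<in> F"
      note hl = linear_diff[OF lin[OF h]] linear_scale[OF lin[OF h]]
      let ?w = "h x - \<Lambda> h *\<^sub>R x"
      \<comment> \<open>Since \<open>h\<close> commutes with \<open>k'\<close>, the defect of
        \<open>y\<close> is the image under \<open>k'\<close> of the defect \<open>?w\<close> of
        \<open>x\<close>, and so is controlled by it.\<close>
      have y: "h y - \<Lambda> h *\<^sub>R y = k' ?w"
        by (simp add: y_def k'_def hl comm[OF h] linear_diff[OF k_lin] linear_scale[OF k_lin]
            algebra_simps)
      have "h z - \<Lambda> h *\<^sub>R z = ?w - t *\<^sub>R (h y - \<Lambda> h *\<^sub>R y)"
        by (simp add: z_def hl algebra_simps)
      then have "h z - \<Lambda> h *\<^sub>R z = ?w - t *\<^sub>R k' ?w"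
        by (simp only: y)
      then have "nrm (h z - \<Lambda> h *\<^sub>R z) \<le> nrm ?w + t * nrm (k' ?w)"
        using nrm_triangle_diff[of ?w "t *\<^sub>R k' ?w"] t(1) by (simp add: nrm_scaleR)
      also have "\<dots> \<le> nrm ?w + t * (D * nrm ?w)"
        using t(1) by (intro add_left_mono mult_left_mono k'_bound) auto
      also have "\<dots> = 3 / 2 * nrm ?w"
        using t(2) by (simp flip: mult.assoc)
      also have "\<dots> \<le> 3 / 2 * d"
        using x(1) h by (simp add: approx_eigenvectors_def)
      finally have "nrm (h z - \<Lambda> h *\<^sub>R z) \<le> 3 / 2 * d" .
      moreover have "nrm (h v - \<Lambda> h *\<^sub>R v) = (1 / nrm z) * nrm (h z - \<Lambda> h *\<^sub>R z)"
      proof -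
        have "h v - \<Lambda> h *\<^sub>R v = (1 / nrm z) *\<^sub>R (h z - \<Lambda> h *\<^sub>R z)"
          by (simp add: v_def hl algebra_simps)
        then show ?thesis using nz by (simp only: nrm_scaleR) simp
      qed
      ultimately have "nrm (h v - \<Lambda> h *\<^sub>R v) \<le> (1 / nrm z) * (3 / 2 * d)"
        using nz by (simp only:) (intro mult_left_mono, simp_all)
      also have "\<dots> \<le> 2 * (3 / 2 * d)"
        using nz d by (intro mult_right_mono) (simp_all add: field_simps)
      also have "\<dots> \<le> d0" by (simp add: d_def)
      finally show "nrm (h v - \<Lambda> h *\<^sub>R v) \<le> d0" .
    qed
    then have "M d0 \<le> g (k v) v" by (rule M_le)
    also have "g (k v) v = g (k z) z / (nrm z)\<^sup>2"
      using nz by (simp add: v_def linear_scale[OF k_lin] scaleR_left scaleR_right power2_eq_square)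
    finally have "M d0 * (nrm z)\<^sup>2 \<le> g (k z) z"
      using nz by (simp add: pos_le_divide_eq)
    moreover have "g (k' z) z = g (k z) z - l * (nrm z)\<^sup>2"
      by (simp add: k'_def diff_left scaleR_left nrm_square)
    ultimately have "(M d0 - l) * (nrm z)\<^sup>2 \<le> g (k' z) z"
      by (simp add: algebra_simps)
    moreover have "- \<eta> * (9 / 4) \<le> (M d0 - l) * (nrm z)\<^sup>2"
    proof -
      have "(nrm z)\<^sup>2 \<le> (3 / 2)\<^sup>2" using nz by (intro power_mono) auto
      then have "\<eta> * (nrm z)\<^sup>2 \<le> \<eta> * (9 / 4)"
        using \<eta> by (intro mult_left_mono) (simp_all add: power2_eq_square)
      moreover have "(- \<eta>) * (nrm z)\<^sup>2 \<le> (M d0 - l) * (nrm z)\<^sup>2"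
        using d0(2) by (intro mult_right_mono) auto
      ultimately show ?thesis by simp
    qed
    moreover have "g (k' z) z \<le> \<eta> - 3 / (4 * D) * (nrm y)\<^sup>2"
    proof -
      have "g (k' z) z = g (k' x) x - 2 * t * g y y + t\<^sup>2 * g (k' y) y"
        using k'_sym[of y x]
        by (simp add: z_def k'_lin diff_left diff_right scaleR_left scaleR_right y_def[symmetric]
            power2_eq_square algebra_simps)
      also have "g (k' x) x \<le> \<eta>"
        using x(2) nx by (simp add: k'_def diff_left scaleR_left flip: nrm_square)
      also have "g (k' y) y \<le> D * g y y"
      proof -
        have "g (k' y) y \<le> nrm (k' y) * nrm y" using abs_le_nrm[of "k' y" y] by simp
        also have "\<dots> \<le> D * nrm y * nrm y"
          by (intro mult_right_mono k'_bound nrm_nonneg)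
        finally show ?thesis by (simp add: nrm_square[symmetric] power2_eq_square mult.assoc)
      qed
      finally have "g (k' z) z \<le> \<eta> - 2 * t * g y y + t\<^sup>2 * (D * g y y)"
        by (simp add: mult_left_mono)
      also have "t\<^sup>2 * (D * g y y) = t / 2 * g y y"
        using t(2) by (simp add: power2_eq_square)
      also have "\<eta> - 2 * t * g y y + t / 2 * g y y = \<eta> - 3 / (4 * D) * (nrm y)\<^sup>2"
        by (simp add: t_def nrm_square field_simps)
      finally show ?thesis .
    qed
    ultimately have "3 / (4 * D) * (nrm y)\<^sup>2 \<le> 13 / 4 * \<eta>" by linarith
    then have "3 * (nrm y)\<^sup>2 \<le> 13 / 5 * e\<^sup>2"
      using D by (simp add: \<eta>_def field_simps)
    then have "(nrm y)\<^sup>2 \<le> e\<^sup>2"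
      using zero_le_power2[of e] by linarith
    then have "nrm y \<le> e" by (rule power2_le_imp_le) (use e in simp)
    moreover have "x \<in> ?U e"
      using x(1) by (auto simp: approx_eigenvectors_def d_def)
    ultimately show "\<exists>x\<in>?U e. nrm (k x - l *\<^sub>R x) \<le> e"
      by (auto simp: y_def k'_def)
  next
    fix x assume "\<And>e. e > 0 \<Longrightarrow> x \<in> ?U e"
    then show "l \<le> g (k x) x"
      unfolding l_def by (intro cSUP_least M_le) auto
  qed
qed

text \<open>\<open>k\<close> is treated first, without other constraints, so its eigenvalue bounds
  its form from below on all unit vectors. The members of \<open>F\<close> are added one by one and
  leave that eigenvalue unchanged.\<close>

lemma joint_approx_eigenvectors:
  assumes fin: "finite F" and unit: "nrm v = 1"
    and sym: "\<And>h. h \<in> insert k F \<Longrightarrow> bounded_symmetric h"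
    and comm: "\<And>h h' x. h \<in> insert k F \<Longrightarrow> h' \<in> insert k F \<Longrightarrow> h (h' x) = h' (h x)"
  obtains \<Lambda> x where "\<And>m :: nat. nrm (x m) = 1"
    "\<And>h. h \<in> insert k F \<Longrightarrow> (\<lambda>m. nrm (h (x m) - \<Lambda> h *\<^sub>R x m)) \<longlonglongrightarrow> 0"
    "\<And>v. nrm v = 1 \<Longrightarrow> \<Lambda> k \<le> g (k v) v"
proof -
  have lin: "linear h" if "h \<in> insert k F" for h
    using sym[OF that] by (simp add: bounded_symmetric_def)
  obtain l where l: "\<And>e. e > 0 \<Longrightarrow> \<exists>x\<in>approx_eigenvectors (\<lambda>_. 0) {} e. nrm (k x - l *\<^sub>R x) \<le> e"
    "\<And>x. (\<And>e. e > 0 \<Longrightarrow> x \<in> approx_eigenvectors (\<lambda>_. 0) {} e) \<Longrightarrow> l \<le> g (k x) x"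
    by (rule approx_eigenvalue_step[of "\<lambda>_. 0" "{}" k])
      (use unit sym in \<open>auto simp: approx_eigenvectors_def\<close>)
  have "\<exists>\<Lambda>. \<Lambda> k = l \<and> (\<forall>e>0. approx_eigenvectors \<Lambda> (insert k E) e \<noteq> {})" if "E \<subseteq> F" for E
    using finite_subset[OF that fin] that
  proof (induction E rule: finite_induct)
    case empty
    have "approx_eigenvectors (\<lambda>_. l) {k} e \<noteq> {}" if "e > 0" for e
      using l(1)[OF that] by (auto simp: approx_eigenvectors_def)
    then show ?case by (intro exI[of _ "\<lambda>_. l"]) auto
  next
    case (insert h E)
    then obtain \<Lambda> where \<Lambda>: "\<Lambda> k = l" "\<And>e. e > 0 \<Longrightarrow> approx_eigenvectors \<Lambda> (insert k E) e \<noteq> {}"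
      by auto
    show ?case
    proof (cases "h = k")
      case True
      then show ?thesis using \<Lambda> by (intro exI[of _ \<Lambda>]) auto
    next
      case False
      obtain l' where l': "\<And>e. e > 0 \<Longrightarrow>
          \<exists>x\<in>approx_eigenvectors \<Lambda> (insert k E) e. nrm (h x - l' *\<^sub>R x) \<le> e"
        by (rule approx_eigenvalue_step[OF \<Lambda>(2), of h])
          (use insert.prems lin sym comm in auto)
      have "approx_eigenvectors (\<Lambda>(h := l')) (insert k (insert h E)) e \<noteq> {}" if e: "e > 0" for e
      proof -
        obtain x where "x \<in> approx_eigenvectors \<Lambda> (insert k E) e" "nrm (h x - l' *\<^sub>R x) \<le> e"
          using l'[OF e] by blast
        then have "x \<in> approx_eigenvectors (\<Lambda>(h := l')) (insert k (insert h E)) e"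
          using insert.hyps False by (auto simp: approx_eigenvectors_def)
        then show ?thesis by blast
      qed
      moreover have "(\<Lambda>(h := l')) k = l" using \<Lambda>(1) False by simp
      ultimately show ?thesis by blast
    qed
  qed
  then obtain \<Lambda> where \<Lambda>: "\<Lambda> k = l" "\<And>e. e > 0 \<Longrightarrow> approx_eigenvectors \<Lambda> (insert k F) e \<noteq> {}"
    by blast
  have "\<exists>x. x \<in> approx_eigenvectors \<Lambda> (insert k F) (1 / real (Suc m))" for m
    using \<Lambda>(2)[of "1 / real (Suc m)"] by auto
  then obtain x where x: "\<And>m. x m \<in> approx_eigenvectors \<Lambda> (insert k F) (1 / real (Suc m))"
    by metis
  show ?thesis
  proof (rule that)
    show "nrm (x m) = 1" for m using x[of m] by (simp add: approx_eigenvectors_def)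
    show "(\<lambda>m. nrm (h (x m) - \<Lambda> h *\<^sub>R x m)) \<longlonglongrightarrow> 0" if "h \<in> insert k F" for h
    proof (rule tendsto_sandwich[OF _ _ tendsto_const LIMSEQ_inverse_real_of_nat])
      show "\<forall>\<^sub>F m in sequentially. nrm (h (x m) - \<Lambda> h *\<^sub>R x m) \<le> inverse (real (Suc m))"
      proof (intro always_eventually allI)
        show "nrm (h (x m) - \<Lambda> h *\<^sub>R x m) \<le> inverse (real (Suc m))" for m
          using x[of m] that by (auto simp: approx_eigenvectors_def inverse_eq_divide)
      qed
    qed (simp add: nrm_nonneg)
    show "\<Lambda> k \<le> g (k v) v" if "nrm v = 1" for v
      unfolding \<Lambda>(1) using that by (intro l(2)) (simp add: approx_eigenvectors_def)
  qed
qed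

end

section \<open>Characters from approximate joint eigenvectors\<close>

definition diag_app :: "('a :: chilbert_space \<Rightarrow>\<^sub>L 'a) \<Rightarrow> (nat \<Rightarrow> 'a) \<Rightarrow> nat \<Rightarrow> 'a" where
  "diag_app T \<xi> i = blinfun_apply T (\<xi> i)"

lemma tnorm_triangle: "tnorm n (\<xi> + \<eta>) \<le> tnorm n \<xi> + tnorm n \<eta>"
  using tuple_form.nrm_triangle[of n \<xi> \<eta>] by simp

lemma tnorm_minus: "tnorm n (- \<xi>) = tnorm n \<xi>"
  by (simp add: tnorm_def)

lemma tnorm_diag_app_le: "tnorm n (diag_app T \<xi>) \<le> norm T * tnorm n \<xi>"
proof -
  have "tnorm n (diag_app T \<xi>) \<le> L2_set (\<lambda>i. norm T * norm (\<xi> i)) {..<n}"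
    unfolding tnorm_def diag_app_def by (intro L2_set_mono norm_blinfun) simp
  also have "\<dots> = norm T * tnorm n \<xi>"
    by (simp add: tnorm_def L2_set_right_distrib)
  finally show ?thesis .
qed

locale unit_tuples =
  fixes n :: nat and x :: "nat \<Rightarrow> nat \<Rightarrow> 'k :: chilbert_space"
  assumes unit: "\<And>m. tnorm n (x m) = 1"
begin

definition eigen :: "('k \<Rightarrow>\<^sub>L 'k) \<Rightarrow> complex \<Rightarrow> bool" where
  "eigen T l \<longleftrightarrow> (\<lambda>m. tnorm n (diag_app T (x m) - l *\<^sub>C x m)) \<longlonglongrightarrow> 0"

lemma eigenI:
  assumes "\<And>m. tnorm n (diag_app T (x m) - l *\<^sub>C x m) \<le> r m" "r \<longlonglongrightarrow> 0"
  shows "eigen T l"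
  unfolding eigen_def
  by (rule tendsto_sandwich[OF _ _ tendsto_const assms(2)]) (simp_all add: assms(1))

lemma eigen_id: "eigen id_blinfun 1"
  by (rule eigenI[of _ _ "\<lambda>_. 0"]) (simp_all add: tnorm_def diag_app_def L2_set_def)

lemma eigen_add:
  assumes "eigen S l" "eigen T l'"
  shows "eigen (S + T) (l + l')"
proof (rule eigenI)
  fix m
  have "diag_app (S + T) (x m) - (l + l') *\<^sub>C x m
      = (diag_app S (x m) - l *\<^sub>C x m) + (diag_app T (x m) - l' *\<^sub>C x m)"
    by (simp add: diag_app_def fun_eq_iff blinfun.add_left scaleC_add_left)
  then show "tnorm n (diag_app (S + T) (x m) - (l + l') *\<^sub>C x m)
      \<le> tnorm n (diag_app S (x m) - l *\<^sub>C x m) + tnorm n (diag_app T (x m) - l' *\<^sub>C x m)"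
    by (simp only: tnorm_triangle)
  show "(\<lambda>m. tnorm n (diag_app S (x m) - l *\<^sub>C x m) + tnorm n (diag_app T (x m) - l' *\<^sub>C x m))
      \<longlonglongrightarrow> 0"
    using tendsto_add[OF assms[unfolded eigen_def]] by simp
qed

lemma eigen_scaleC:
  assumes "eigen T l"
  shows "eigen (c *\<^sub>C T) (c * l)"
proof (rule eigenI)
  fix m
  have "diag_app (c *\<^sub>C T) (x m) - (c * l) *\<^sub>C x m = c *\<^sub>C (diag_app T (x m) - l *\<^sub>C x m)"
    by (simp add: diag_app_def fun_eq_iff complex_vector.scale_right_diff_distrib scaleC_scaleC)
  then show "tnorm n (diag_app (c *\<^sub>C T) (x m) - (c * l) *\<^sub>C x m)
      \<le> cmod c * tnorm n (diag_app T (x m) - l *\<^sub>C x m)"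
    by (simp only: tnorm_scaleC)
  show "(\<lambda>m. cmod c * tnorm n (diag_app T (x m) - l *\<^sub>C x m)) \<longlonglongrightarrow> 0"
    using tendsto_mult_left[OF assms[unfolded eigen_def], of "cmod c"] by simp
qed

lemma eigen_compose:
  assumes "S \<in> bounded_ops" "eigen S l" "eigen T l'"
  shows "eigen (S o\<^sub>L T) (l * l')"
proof (rule eigenI)
  fix m
  have "diag_app (S o\<^sub>L T) (x m) - (l * l') *\<^sub>C x m
      = diag_app S (diag_app T (x m) - l' *\<^sub>C x m) + l' *\<^sub>C (diag_app S (x m) - l *\<^sub>C x m)"
    by (simp add: diag_app_def fun_eq_iff blinfun.diff_right bounded_opsD[OF assms(1)]
        complex_vector.scale_right_diff_distrib scaleC_scaleC mult.commute)
  then have "tnorm n (diag_app (S o\<^sub>L T) (x m) - (l * l') *\<^sub>C x m)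
      \<le> tnorm n (diag_app S (diag_app T (x m) - l' *\<^sub>C x m))
        + tnorm n (l' *\<^sub>C (diag_app S (x m) - l *\<^sub>C x m))"
    by (simp only: tnorm_triangle)
  then show "tnorm n (diag_app (S o\<^sub>L T) (x m) - (l * l') *\<^sub>C x m)
      \<le> norm S * tnorm n (diag_app T (x m) - l' *\<^sub>C x m)
        + cmod l' * tnorm n (diag_app S (x m) - l *\<^sub>C x m)"
    using tnorm_diag_app_le[of n S "diag_app T (x m) - l' *\<^sub>C x m"] by (simp only: tnorm_scaleC)
  show "(\<lambda>m. norm S * tnorm n (diag_app T (x m) - l' *\<^sub>C x m)
      + cmod l' * tnorm n (diag_app S (x m) - l *\<^sub>C x m)) \<longlonglongrightarrow> 0"
    using tendsto_add[OF tendsto_mult_left[OF assms(3)[unfolded eigen_def], of "norm S"]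
        tendsto_mult_left[OF assms(2)[unfolded eigen_def], of "cmod l'"]] by simp
qed

text \<open>The error is uniform in \<open>m\<close>; this permits the passage to norm limits of
  operators in \<open>eigen_lim\<close>.\<close>

lemma eigen_perturb:
  "tnorm n (diag_app S (x m) - l *\<^sub>C x m)
    \<le> tnorm n (diag_app T (x m) - l' *\<^sub>C x m) + norm (S - T) + cmod (l - l')"
proof -
  let ?t = "diag_app T (x m) - l' *\<^sub>C x m" and ?d = "diag_app (S - T) (x m)"
  have "diag_app S (x m) - l *\<^sub>C x m = ?t + ?d + (l' - l) *\<^sub>C x m"
    by (simp add: diag_app_def fun_eq_iff blinfun.diff_left complex_vector.scale_left_diff_distrib)
  then have "tnorm n (diag_app S (x m) - l *\<^sub>C x m)
      \<le> tnorm n ?t + tnorm n ?d + tnorm n ((l' - l) *\<^sub>C x m)"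
    using tnorm_triangle[of n ?t ?d] tnorm_triangle[of n "?t + ?d" "(l' - l) *\<^sub>C x m"] by simp
  then show ?thesis
    using tnorm_diag_app_le[of n "S - T" "x m"] by (simp add: tnorm_scaleC unit norm_minus_commute)
qed

text \<open>For \<open>S = T\<close> this is uniqueness of the eigenvalue; for a convergent sequence
  of operators it makes the eigenvalues a Cauchy sequence.\<close>

lemma eigen_dist_le:
  assumes "eigen S l" "eigen T l'"
  shows "cmod (l - l') \<le> norm (S - T)"
proof -
  let ?s = "\<lambda>m. tnorm n (diag_app S (x m) - l *\<^sub>C x m)"
  let ?t = "\<lambda>m. tnorm n (diag_app T (x m) - l' *\<^sub>C x m)"
  have "cmod (l - l') \<le> norm (S - T) + ?t m + ?s m" for m
  proof -
    have eq: "(l - l') *\<^sub>C x m = (diag_app S (x m) - l' *\<^sub>C x m) + - (diag_app S (x m) - l *\<^sub>C x m)"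
      by (simp add: complex_vector.scale_left_diff_distrib)
    have "tnorm n ((l - l') *\<^sub>C x m) \<le> tnorm n (diag_app S (x m) - l' *\<^sub>C x m) + ?s m"
      unfolding eq using tnorm_triangle by (metis tnorm_minus)
    then show ?thesis
      using eigen_perturb[of S m l' T l'] by (simp add: tnorm_scaleC unit)
  qed
  moreover have "(\<lambda>m. norm (S - T) + ?t m + ?s m) \<longlonglongrightarrow> norm (S - T) + 0 + 0"
    using assms unfolding eigen_def by (intro tendsto_add tendsto_const)
  ultimately have "cmod (l - l') \<le> norm (S - T) + 0 + 0"
    by (intro LIMSEQ_le_const) auto
  then show ?thesis by simp
qed

lemma eigen_unique: "eigen T l \<Longrightarrow> eigen T l' \<Longrightarrow> l = l'"
  using eigen_dist_le[of T l T l'] by simp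

lemma eigen_lim:
  assumes T: "T \<longlonglongrightarrow> S" and l: "l \<longlonglongrightarrow> l'" and e: "\<And>p. eigen (T p) (l p)"
  shows "eigen S l'"
  unfolding eigen_def
proof (rule LIMSEQ_I)
  fix r :: real assume "r > 0"
  then have r3: "r / 3 > 0" by simp
  obtain p where p: "norm (T p - S) < r / 3" "cmod (l p - l') < r / 3"
  proof -
    obtain p1 where "\<And>p. p \<ge> p1 \<Longrightarrow> norm (T p - S) < r / 3"
      using LIMSEQ_D[OF T r3] by blast
    moreover obtain p2 where "\<And>p. p \<ge> p2 \<Longrightarrow> cmod (l p - l') < r / 3"
      using LIMSEQ_D[OF l r3] by blast
    ultimately show thesis
      using that[of "max p1 p2"] by simp
  qed
  obtain m0 where m0: "\<And>m. m \<ge> m0 \<Longrightarrow> tnorm n (diag_app (T p) (x m) - l p *\<^sub>C x m) < r / 3"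
    using LIMSEQ_D[OF e[of p, unfolded eigen_def] r3] by auto
  have "norm (tnorm n (diag_app S (x m) - l' *\<^sub>C x m) - 0) < r" if "m \<ge> m0" for m
    using eigen_perturb[of S m l' "T p" "l p"] m0[OF that] p by (simp add: norm_minus_commute)
  then show "\<exists>m0. \<forall>m\<ge>m0. norm (tnorm n (diag_app S (x m) - l' *\<^sub>C x m) - 0) < r" by blast
qed

text \<open>The condition on the adjoint is built in, since approximate eigenvectors of an operator
  need not be ones of its adjoint.\<close>

definition eigen_algebra :: "('k \<Rightarrow>\<^sub>L 'k) set" where
  "eigen_algebra = {T \<in> bounded_ops. \<exists>l. eigen T l \<and> eigen (cadjoint T) (cnj l)}"

lemma unital_cstar_subalgebra_eigen_algebra: "unital_cstar_subalgebra eigen_algebra"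
  unfolding unital_cstar_subalgebra_def
proof (intro conjI ballI)
  show "id_blinfun \<in> eigen_algebra"
    by (auto simp: eigen_algebra_def intro!: exI[of _ 1] eigen_id)
  have zero: "0 \<in> eigen_algebra"
    using eigen_scaleC[OF eigen_id, of 0]
    by (auto simp: eigen_algebra_def intro!: exI[of _ 0])
  show "complex_vector.subspace eigen_algebra"
    unfolding complex_vector.subspace_def
  proof (intro conjI ballI allI)
    show "0 \<in> eigen_algebra" by (rule zero)
    show "S + T \<in> eigen_algebra" if ST: "S \<in> eigen_algebra" "T \<in> eigen_algebra" for S T
    proof -
      obtain l l' where "eigen S l" "eigen (cadjoint S) (cnj l)" "eigen T l'" "eigen (cadjoint T) (cnj l')"
        using ST by (auto simp: eigen_algebra_def)
      then have "eigen (S + T) (l + l')" "eigen (cadjoint S + cadjoint T) (cnj (l + l'))"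
        using eigen_add by simp_all
      then show ?thesis
        using that cadjoint_add[of S T] by (auto simp: eigen_algebra_def add_bounded_ops)
    qed
    show "c *\<^sub>C T \<in> eigen_algebra" if T: "T \<in> eigen_algebra" for c T
    proof -
      obtain l where "eigen T l" "eigen (cadjoint T) (cnj l)"
        using T by (auto simp: eigen_algebra_def)
      then have "eigen (c *\<^sub>C T) (c * l)" "eigen (cnj c *\<^sub>C cadjoint T) (cnj (c * l))"
        using eigen_scaleC by simp_all
      then show ?thesis
        using that cadjoint_scaleC[of T c] by (auto simp: eigen_algebra_def scaleC_bounded_ops)
    qed
  qed
  show "S o\<^sub>L T \<in> eigen_algebra" if in_alg: "S \<in> eigen_algebra" "T \<in> eigen_algebra" for S T
  proof -
    have ST: "S \<in> bounded_ops" "T \<in> bounded_ops" using that by (auto simp: eigen_algebra_def)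
    obtain l l' where "eigen S l" "eigen (cadjoint S) (cnj l)" "eigen T l'" "eigen (cadjoint T) (cnj l')"
      using in_alg by (auto simp: eigen_algebra_def)
    then have "eigen (S o\<^sub>L T) (l * l')" "eigen (cadjoint T o\<^sub>L cadjoint S) (cnj (l * l'))"
      using eigen_compose[OF ST(1)] eigen_compose[OF cadjoint_bounded_ops[OF ST(2)]]
      by (simp_all add: mult.commute[of "cnj l"])
    then show ?thesis
      using ST cadjoint_compose[of S T] by (auto simp: eigen_algebra_def compose_bounded_ops)
  qed
  show "cadjoint T \<in> eigen_algebra" if T: "T \<in> eigen_algebra" for T
  proof -
    obtain l where "eigen T l" "eigen (cadjoint T) (cnj l)"
      using T by (auto simp: eigen_algebra_def)
    then show ?thesis
      using T by (auto simp: eigen_algebra_def intro!: exI[of _ "cnj l"])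
  qed
  show "closed eigen_algebra"
    unfolding closed_sequential_limits
  proof (intro allI impI, elim conjE)
    fix T S assume T: "\<forall>p. T p \<in> eigen_algebra" and lim: "T \<longlonglongrightarrow> S"
    have Tb: "T p \<in> bounded_ops" for p using T by (auto simp: eigen_algebra_def)
    then have Sb: "S \<in> bounded_ops"
      using closed_sequentially[OF closed_bounded_ops _ lim] by blast
    obtain l where l: "\<And>p. eigen (T p) (l p)" "\<And>p. eigen (cadjoint (T p)) (cnj (l p))"
      using T unfolding eigen_algebra_def by (simp, metis)
    have "Cauchy l"
    proof (rule CauchyI)
      fix r :: real assume "r > 0"
      then obtain M where "\<And>p q. p \<ge> M \<Longrightarrow> q \<ge> M \<Longrightarrow> norm (T p - T q) < r"
        using CauchyD[OF LIMSEQ_imp_Cauchy[OF lim]] by blast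
      then show "\<exists>M. \<forall>p\<ge>M. \<forall>q\<ge>M. norm (l p - l q) < r"
        using eigen_dist_le[OF l(1) l(1)] by (meson le_less_trans)
    qed
    then obtain l' where l': "l \<longlonglongrightarrow> l'"
      using Cauchy_convergent convergent_def by blast
    have "(\<lambda>p. cadjoint (T p)) \<longlonglongrightarrow> cadjoint S"
    proof (rule LIMSEQ_I)
      fix r :: real assume "r > 0"
      then obtain M where M: "\<And>p. p \<ge> M \<Longrightarrow> norm (T p - S) < r"
        using LIMSEQ_D[OF lim] by blast
      have "norm (cadjoint (T p) - cadjoint S) \<le> norm (T p - S)" for p
      proof -
        have "T p - S \<in> bounded_ops"
          by (rule complex_vector.subspace_diff[OF subspace_bounded_ops Tb Sb])
        then show ?thesis
          using norm_cadjoint_le cadjoint_diff[OF Tb Sb] by metis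
      qed
      then show "\<exists>M. \<forall>p\<ge>M. norm (cadjoint (T p) - cadjoint S) < r"
        using M by (meson le_less_trans)
    qed
    then have "eigen (cadjoint S) (cnj l')"
      by (rule eigen_lim[OF _ tendsto_cnj[OF l'] l(2)])
    moreover have "eigen S l'"
      by (rule eigen_lim[OF lim l' l(1)])
    ultimately show "S \<in> eigen_algebra"
      using Sb by (auto simp: eigen_algebra_def)
  qed
qed (auto simp: eigen_algebra_def)

text \<open>Eigenvalues along the fixed sequence are unique, so they inherit the additivity and
  multiplicativity of \<open>eigen\<close>.\<close>

lemma character_of_eigen:
  assumes \<A>: "unital_cstar_subalgebra \<A>" and sub: "\<A> \<subseteq> eigen_algebra"
  obtains \<omega> where "character_on \<A> \<omega>" "\<And>T. T \<in> \<A> \<Longrightarrow> eigen T (\<omega> T)"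
proof -
  define \<omega> where "\<omega> T = (SOME l. eigen T l)" for T
  have \<omega>: "eigen T (\<omega> T)" if T: "T \<in> \<A>" for T
  proof -
    obtain l where "eigen T l"
      using T sub by (auto simp: eigen_algebra_def)
    then show ?thesis
      unfolding \<omega>_def by (rule someI)
  qed
  have eqI: "\<omega> T = l" if "T \<in> \<A>" "eigen T l" for T l
    using eigen_unique[OF \<omega>] that by blast
  have "\<A> \<subseteq> bounded_ops" and sp: "complex_vector.subspace \<A>" and "id_blinfun \<in> \<A>"
    and comp: "\<And>S T. S \<in> \<A> \<Longrightarrow> T \<in> \<A> \<Longrightarrow> S o\<^sub>L T \<in> \<A>"
    using \<A> by (auto simp: unital_cstar_subalgebra_def)
  have "character_on \<A> \<omega>"
    unfolding character_on_def clinear_on_def scaleC_complex_def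
  proof (intro conjI ballI allI)
    show "\<omega> (S + T) = \<omega> S + \<omega> T" if "S \<in> \<A>" "T \<in> \<A>" for S T
      using that by (intro eqI eigen_add \<omega> complex_vector.subspace_add sp)
    show "\<omega> (c *\<^sub>C T) = c * \<omega> T" if "T \<in> \<A>" for c T
      using that by (intro eqI eigen_scaleC \<omega> complex_vector.subspace_scale sp)
    show "\<omega> (S o\<^sub>L T) = \<omega> S * \<omega> T" if "S \<in> \<A>" "T \<in> \<A>" for S T
      using that \<open>\<A> \<subseteq> bounded_ops\<close> by (intro eqI eigen_compose \<omega> comp) auto
    show "\<omega> id_blinfun = 1"
      by (intro eqI eigen_id) fact
  qed
  then show ?thesis using that \<omega> by blast
qed

end

section \<open>Commuting normal tuples\<close>

text \<open>Twice the real part of \<open>B i\<close> for \<open>True\<close>, and minus twice its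
  imaginary part for \<open>False\<close>; \<open>B i\<close> and its adjoint are combinations of
  these two.\<close>

definition hermitian_part :: "('d :: finite \<Rightarrow> 'k :: chilbert_space \<Rightarrow>\<^sub>L 'k) \<Rightarrow> 'd \<times> bool \<Rightarrow> 'k \<Rightarrow>\<^sub>L 'k" where
  "hermitian_part B p = (if snd p then B (fst p) + cadjoint (B (fst p))
     else \<i> *\<^sub>C (B (fst p) - cadjoint (B (fst p))))"

text \<open>Fuglede's theorem is needed for the pairs of one generator with the adjoint of another;
  two adjoints commute by taking adjoints.\<close>

lemma gen_commute:
  fixes B :: "'d :: finite \<Rightarrow> 'k :: chilbert_space \<Rightarrow>\<^sub>L 'k"
  assumes B: "\<forall>i. B i \<in> bounded_ops" and normal: "\<forall>i. normal_op (B i)"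
    and comm: "\<forall>i j. B i o\<^sub>L B j = B j o\<^sub>L B i"
  shows "gen B k o\<^sub>L gen B k' = gen B k' o\<^sub>L gen B k"
proof -
  have 1: "cadjoint (B i) o\<^sub>L B j = B j o\<^sub>L cadjoint (B i)" for i j
    using B normal comm by (intro Fuglede) auto
  have 2: "cadjoint (B i) o\<^sub>L cadjoint (B j) = cadjoint (B j) o\<^sub>L cadjoint (B i)" for i j
    using cadjoint_compose[of "B i" "B j"] cadjoint_compose[of "B j" "B i"] B comm by simp
  have id: "id_blinfun o\<^sub>L T = T o\<^sub>L id_blinfun" for T :: "'k \<Rightarrow>\<^sub>L 'k"
    by (rule blinfun_eqI) simp
  show ?thesis
    using comm[rule_format] 1[symmetric] 2 by (auto simp: gen_def id split: option.split)
qed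

lemma lincomb_commute:
  assumes B: "\<forall>i. B i \<in> bounded_ops" and normal: "\<forall>i. normal_op (B i)"
    and comm: "\<forall>i j. B i o\<^sub>L B j = B j o\<^sub>L B i"
  shows "blinfun_apply (lincomb B c) (blinfun_apply (lincomb B c') x)
    = blinfun_apply (lincomb B c') (blinfun_apply (lincomb B c) x)"
proof -
  have gen_b: "gen B k \<in> bounded_ops" for k
    using gen_in_operator_system[OF operator_system_bounded_ops B] .
  have gg: "blinfun_apply (gen B k) (blinfun_apply (gen B k') x)
      = blinfun_apply (gen B k') (blinfun_apply (gen B k) x)" for k k'
    using gen_commute[OF B normal comm, of k k'] by (metis blinfun_apply_blinfun_compose)
  have "blinfun_apply (lincomb B c) (blinfun_apply (lincomb B c') x)
      = (\<Sum>k\<in>UNIV. \<Sum>k'\<in>UNIV. (c k * c' k') *\<^sub>C blinfun_apply (gen B k) (blinfun_apply (gen B k') x))"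
    by (simp add: lincomb_def blinfun.sum_left bounded_ops_sum_right[OF gen_b]
        complex_vector.scale_sum_right scaleC_scaleC)
  also have "\<dots> = (\<Sum>k'\<in>UNIV. \<Sum>k\<in>UNIV. (c' k' * c k) *\<^sub>C blinfun_apply (gen B k') (blinfun_apply (gen B k) x))"
    by (subst sum.swap) (simp add: gg mult.commute)
  also have "\<dots> = blinfun_apply (lincomb B c') (blinfun_apply (lincomb B c) x)"
    by (simp add: lincomb_def blinfun.sum_left bounded_ops_sum_right[OF gen_b]
        complex_vector.scale_sum_right scaleC_scaleC)
  finally show ?thesis .
qed

text \<open>In orthonormal coordinates for the \<open>\<xi> i\<close>, the sum splits into one
  scalar form of \<open>W\<close> for each coordinate.\<close>

lemma scalar_matrix_accretive:
  fixes \<xi> :: "nat \<Rightarrow> 'k :: chilbert_space"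
  assumes pos: "\<And>z :: nat \<Rightarrow> complex. 0 \<le> Re (\<Sum>i<n. \<Sum>j<n. W i j * z j * cnj (z i))"
  shows "0 \<le> Re (\<Sum>i<n. \<Sum>j<n. W i j * cinner (\<xi> j) (\<xi> i))"
proof -
  obtain m :: nat and e z
    where on: "\<And>a b. a < m \<Longrightarrow> b < m \<Longrightarrow> cinner (e b) (e a) = (if a = b then 1 else 0)"
      and z: "\<And>i. i < n \<Longrightarrow> \<xi> i = (\<Sum>b<m. z i b *\<^sub>C e b)"
    using Gram_Schmidt_coordinates[of n \<xi>] by blast
  have ip: "cinner (\<xi> j) (\<xi> i) = (\<Sum>b<m. z j b * cnj (z i b))" if "i < n" "j < n" for i j
  proof -
    have "cinner (\<xi> j) (\<xi> i) = (\<Sum>b<m. \<Sum>a<m. if a = b then z j b * cnj (z i a) else 0)"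
      unfolding z[OF that(1)] z[OF that(2)] cinner_sum_left cinner_sum_right
      by (intro sum.cong) (auto simp: cinner_simps on)
    then show ?thesis by simp
  qed
  have "(\<Sum>i<n. \<Sum>j<n. W i j * cinner (\<xi> j) (\<xi> i))
      = (\<Sum>i<n. \<Sum>j<n. \<Sum>b<m. W i j * z j b * cnj (z i b))"
    by (intro sum.cong) (auto simp: ip sum_distrib_left mult.assoc)
  also have "\<dots> = (\<Sum>b<m. \<Sum>i<n. \<Sum>j<n. W i j * z j b * cnj (z i b))"
    by (subst (2) sum.swap, subst sum.swap) simp
  finally show ?thesis
    using pos by (simp add: sum_nonneg)
qed

lemma bounded_symmetric_diag_app:
  assumes T: "T \<in> bounded_ops" and "cadjoint T = T"
  shows "tuple_form.bounded_symmetric n (diag_app T)"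
  unfolding tuple_form.bounded_symmetric_def tuple_form_nrm
proof (intro conjI allI exI)
  show "linear (diag_app T)"
    by (rule linearI) (simp_all add: diag_app_def fun_eq_iff blinfun.add_right blinfun.scaleR_right)
  show "Re (tinner n (diag_app T \<xi>) \<eta>) = Re (tinner n \<xi> (diag_app T \<eta>))" for \<xi> \<eta>
    using cinner_cadjoint_right[OF T] by (simp add: assms(2) tinner_def diag_app_def)
  show "tnorm n (diag_app T \<xi>) \<le> norm T * tnorm n \<xi>" for \<xi>
    by (rule tnorm_diag_app_le)
qed

lemma accretive_of_characters:
  fixes B :: "'d :: finite \<Rightarrow> 'k :: chilbert_space \<Rightarrow>\<^sub>L 'k"
  assumes B: "\<forall>i. B i \<in> bounded_ops" and normal: "\<forall>i. normal_op (B i)"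
    and comm: "\<forall>i j. B i o\<^sub>L B j = B j o\<^sub>L B i"
    and pos: "\<And>\<omega> z. character_on (cstar_algebra B) \<omega> \<Longrightarrow>
      0 \<le> Re (\<Sum>i<n. \<Sum>j<n. \<omega> (lincomb_mat B c i j) * z j * cnj (z i))"
  shows "accretive n (lincomb_mat B c)"
  unfolding accretive_def
proof
  fix \<xi> :: "nat \<Rightarrow> 'k"
  let ?X = "lincomb_mat B c"
  have X: "?X \<in> mats n bounded_ops"
    using lincomb_bounded_ops[OF B] by (simp add: mats_def lincomb_mat_def)
  \<comment> \<open>\<open>Y\<close> is symmetric, as approximate eigenvectors require, and its form
    has twice the real part of that of \<open>?X\<close>.\<close>
  define Y where "Y = lincomb_mat B (\<lambda>i j. c i j + adj_coeff (c j i))"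
  have Y_eq: "Y = ?X + mat_adj ?X"
    by (simp add: Y_def lincomb_mat_def mat_adj_def fun_eq_iff lincomb_add cadjoint_lincomb[OF B])
  have Yform: "Re (tinner n (mat_app n Y \<eta>) \<zeta>)
      = Re (tinner n (mat_app n ?X \<eta>) \<zeta>) + Re (tinner n (mat_app n ?X \<zeta>) \<eta>)" for \<eta> \<zeta>
    by (simp add: Y_eq mat_app_simps tinner_simps tinner_mat_adj[OF X] tuple_form.sym)
  show "0 \<le> Re (tinner n (mat_app n ?X \<xi>) \<xi>)"
  proof (cases "tnorm n \<xi> = 0")
    \<comment> \<open>This covers the zero space, which has no characters.\<close>
    case True
    then show ?thesis
      using tinner_norm_le[of n "mat_app n ?X \<xi>" \<xi>] by simp
  next
    case False
    then have pos\<xi>: "tnorm n \<xi> > 0" by (simp add: less_le)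
    define v where "v = (1 / tnorm n \<xi>) *\<^sub>R \<xi>"
    have v: "tnorm n v = 1"
      using tuple_form.nrm_scaleR[of n "1 / tnorm n \<xi>" \<xi>] pos\<xi> by (simp add: v_def)
    let ?F = "range (\<lambda>p. diag_app (hermitian_part B p))"
    let ?k = "mat_app n Y"
    have herm: "\<exists>c. hermitian_part B p = lincomb B c" for p
    proof -
      have "B i = lincomb B (unit_coeff (Some i, False))"
        "cadjoint (B i) = lincomb B (unit_coeff (Some i, True))" for i
        by (simp_all add: lincomb_unit)
      then show ?thesis
        by (simp only: hermitian_part_def lincomb_add[symmetric] lincomb_diff[symmetric]
            lincomb_scaleC[symmetric])
          (metis (full_types))
    qed
    have herm_adj: "cadjoint (hermitian_part B p) = hermitian_part B p" for p
      using B by (simp add: hermitian_part_def cadjoint_add cadjoint_diff cadjoint_scaleC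
          scaleC_bounded_ops add.commute
          complex_vector.scale_minus_left complex_vector.scale_right_diff_distrib)
    have k_sym: "tuple_form.bounded_symmetric n ?k"
      unfolding tuple_form.bounded_symmetric_def tuple_form_nrm
    proof (intro conjI allI)
      show "linear ?k"
        by (rule linearI) (simp_all add: mat_app_add_right mat_app_scaleR_right)
      show "Re (tinner n (?k \<eta>) \<zeta>) = Re (tinner n \<eta> (?k \<zeta>))" for \<eta> \<zeta>
        using tuple_form.sym[of n \<eta> "?k \<zeta>"] by (simp add: Yform)
      show "\<exists>C. \<forall>\<eta>. tnorm n (?k \<eta>) \<le> C * tnorm n \<eta>"
        using mat_app_bounded by blast
    qed
    have sym: "tuple_form.bounded_symmetric n h" if "h \<in> insert ?k ?F" for h
    proof -
      have "hermitian_part B p \<in> bounded_ops" for p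
        using herm[of p] lincomb_bounded_ops[OF B] by auto
      then show ?thesis
        using that k_sym bounded_symmetric_diag_app[OF _ herm_adj] by auto
    qed
    note lc = lincomb_commute[OF B normal comm]
    have comm': "h (h' \<eta>) = h' (h \<eta>)" if "h \<in> insert ?k ?F" "h' \<in> insert ?k ?F" for h h' \<eta>
    proof -
      have 1: "diag_app (lincomb B c1) (diag_app (lincomb B c2) \<eta>)
          = diag_app (lincomb B c2) (diag_app (lincomb B c1) \<eta>)" for c1 c2 and \<eta> :: "nat \<Rightarrow> 'k"
        by (simp add: diag_app_def fun_eq_iff lc)
      have 2: "diag_app (lincomb B c1) (?k \<eta>) = ?k (diag_app (lincomb B c1) \<eta>)" for c1 \<eta>
        by (simp add: diag_app_def fun_eq_iff mat_app_def blinfun.sum_right Y_def lincomb_mat_def lc)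
      obtain f where f: "\<And>p. hermitian_part B p = lincomb B (f p)"
        using herm by metis
      show ?thesis
        using that by (auto simp: f 1 2)
    qed
    obtain \<Lambda> x where x: "\<And>m :: nat. tnorm n (x m) = 1"
      and lim: "\<And>h. h \<in> insert ?k ?F \<Longrightarrow> (\<lambda>m. tnorm n (h (x m) - \<Lambda> h *\<^sub>R x m)) \<longlonglongrightarrow> 0"
      and least: "\<And>v. tnorm n v = 1 \<Longrightarrow> \<Lambda> ?k \<le> Re (tinner n (?k v) v)"
      by (rule tuple_form.joint_approx_eigenvectors[of ?F n v ?k, unfolded tuple_form_nrm, OF _ v],
          simp, erule sym, erule (1) comm', blast)
    interpret unit_tuples n x
      by unfold_locales (rule x)
    have "eigen (hermitian_part B p) (\<Lambda> (diag_app (hermitian_part B p)))" for p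
      using lim[of "diag_app (hermitian_part B p)"] by (simp add: eigen_def scaleC_of_real)
    note eh = eigen_scaleC[OF this]
    have "B i \<in> eigen_algebra" for i
    proof -
      let ?P = "hermitian_part B (i, True)" and ?Q = "hermitian_part B (i, False)"
      let ?p = "complex_of_real (\<Lambda> (diag_app ?P))" and ?q = "complex_of_real (\<Lambda> (diag_app ?Q))"
      have "B i = (1 / 2) *\<^sub>C ?P + (- \<i> / 2) *\<^sub>C ?Q"
        "cadjoint (B i) = (1 / 2) *\<^sub>C ?P + (\<i> / 2) *\<^sub>C ?Q"
      proof -
        have half: "(1 / 2) *\<^sub>C X + (1 / 2) *\<^sub>C X = X" for X :: "'k \<Rightarrow>\<^sub>L 'k"
          by (simp flip: scaleC_add_left)
        show "B i = (1 / 2) *\<^sub>C ?P + (- \<i> / 2) *\<^sub>C ?Q"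
          "cadjoint (B i) = (1 / 2) *\<^sub>C ?P + (\<i> / 2) *\<^sub>C ?Q"
          by (simp_all add: hermitian_part_def scaleC_add_right scaleC_scaleC half
              complex_vector.scale_right_diff_distrib)
      qed
      moreover have "eigen ((1 / 2) *\<^sub>C ?P + (- \<i> / 2) *\<^sub>C ?Q) (1 / 2 * ?p + - \<i> / 2 * ?q)"
        "eigen ((1 / 2) *\<^sub>C ?P + (\<i> / 2) *\<^sub>C ?Q) (1 / 2 * ?p + \<i> / 2 * ?q)"
        by (intro eigen_add eh)+
      moreover have "1 / 2 * ?p + \<i> / 2 * ?q = cnj (1 / 2 * ?p + - \<i> / 2 * ?q)" by simp
      ultimately show ?thesis
        using B unfolding eigen_algebra_def by (metis (no_types, lifting) mem_Collect_eq)
    qed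
    then have "cstar_algebra B \<subseteq> eigen_algebra"
      by (intro cstar_algebra_minimal unital_cstar_subalgebra_eigen_algebra) auto
    then obtain \<omega> where \<omega>: "character_on (cstar_algebra B) \<omega>"
      and eig: "\<And>T. T \<in> cstar_algebra B \<Longrightarrow> eigen T (\<omega> T)"
      using character_of_eigen[OF unital_cstar_subalgebra_cstar_algebra[OF B]] by blast
    \<comment> \<open>Bounds the change of the form at \<open>x m\<close> when each operator entry
      of \<open>?X\<close> is replaced by the scalar \<open>\<omega>\<close> assigns to it.\<close>
    define err where "err m = (\<Sum>i<n. \<Sum>j<n. tnorm n (diag_app (?X i j) (x m) - \<omega> (?X i j) *\<^sub>C x m))" for m
    have "err \<longlonglongrightarrow> (\<Sum>i<n. \<Sum>j<n. 0)"
      unfolding err_def using eig lincomb_in_cstar_algebra[OF B]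
      by (intro tendsto_sum) (auto simp: eigen_def lincomb_mat_def)
    then have err: "err \<longlonglongrightarrow> 0" by simp
    have ge: "- err m \<le> Re (tinner n (mat_app n ?X (x m)) (x m))" for m
    proof -
      let ?W = "\<Sum>i<n. \<Sum>j<n. \<omega> (?X i j) * cinner (x m j) (x m i)"
      have "cmod (tinner n (mat_app n ?X (x m)) (x m) - ?W)
          = cmod (\<Sum>i<n. \<Sum>j<n. cinner (?X i j (x m j) - \<omega> (?X i j) *\<^sub>C x m j) (x m i))"
        by (simp add: tinner_def mat_app_def cinner_sum_left cinner_simps sum_subtractf)
      also have "\<dots> \<le> err m"
        unfolding err_def
      proof (intro order_trans[OF norm_sum] sum_mono)
        fix i j assume ij: "i \<in> {..<n}" "j \<in> {..<n}"
        have "cmod (cinner (?X i j (x m j) - \<omega> (?X i j) *\<^sub>C x m j) (x m i))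
            \<le> norm (?X i j (x m j) - \<omega> (?X i j) *\<^sub>C x m j) * norm (x m i)"
          by (rule norm_cinner_le)
        also have "\<dots> \<le> tnorm n (diag_app (?X i j) (x m) - \<omega> (?X i j) *\<^sub>C x m) * tnorm n (x m)"
          using ij norm_le_tnorm[of j n "diag_app (?X i j) (x m) - \<omega> (?X i j) *\<^sub>C x m"]
          by (intro mult_mono norm_le_tnorm) (auto simp: diag_app_def)
        finally show "cmod (cinner (?X i j (x m j) - \<omega> (?X i j) *\<^sub>C x m j) (x m i))
            \<le> tnorm n (diag_app (?X i j) (x m) - \<omega> (?X i j) *\<^sub>C x m)"
          by (simp add: x)
      qed
      finally have "\<bar>Re (tinner n (mat_app n ?X (x m)) (x m) - ?W)\<bar> \<le> err m"
        using abs_Re_le_cmod order_trans by blast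
      moreover have "0 \<le> Re ?W"
        by (rule scalar_matrix_accretive) (rule pos[OF \<omega>])
      ultimately show ?thesis by simp
    qed
    \<comment> \<open>Along \<open>x m\<close> the form of \<open>Y\<close> tends to
      \<open>\<Lambda> ?k\<close> and is at least \<open>- (2 * err m)\<close>. Hence
      \<open>\<Lambda> ?k\<close> is nonnegative in the limit, and it bounds the form of
      \<open>Y\<close> from below on all unit tuples.\<close>
    have "- (2 * err m) - tnorm n (?k (x m) - \<Lambda> ?k *\<^sub>R x m) \<le> \<Lambda> ?k" for m
    proof -
      have "\<bar>Re (tinner n (?k (x m) - \<Lambda> ?k *\<^sub>R x m) (x m))\<bar> \<le> tnorm n (?k (x m) - \<Lambda> ?k *\<^sub>R x m)"
        using tuple_form.abs_le_nrm[of n "?k (x m) - \<Lambda> ?k *\<^sub>R x m" "x m"] by (simp add: x)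
      moreover have "Re (tinner n (?k (x m) - \<Lambda> ?k *\<^sub>R x m) (x m))
          = 2 * Re (tinner n (mat_app n ?X (x m)) (x m)) - \<Lambda> ?k"
        by (simp add: tinner_simps Yform tinner_self x)
      ultimately show ?thesis using ge[of m] by linarith
    qed
    moreover have "(\<lambda>m. - (2 * err m) - tnorm n (?k (x m) - \<Lambda> ?k *\<^sub>R x m)) \<longlonglongrightarrow> - (2 * 0) - 0"
      by (intro tendsto_diff tendsto_minus tendsto_mult tendsto_const err lim) simp
    ultimately have "- (2 * 0) - 0 \<le> \<Lambda> ?k"
      by (intro LIMSEQ_le_const2) auto
    also have "\<dots> \<le> Re (tinner n (?k v) v)"
      by (rule least[OF v])
    also have "\<dots> = 2 * Re (tinner n (mat_app n ?X v) v)"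
      by (simp add: Yform)
    also have "\<dots> = 2 * (Re (tinner n (mat_app n ?X \<xi>) \<xi>) / (tnorm n \<xi>)\<^sup>2)"
      by (simp add: v_def mat_app_scaleR_right tinner_simps power2_eq_square)
    finally show ?thesis
      using pos\<xi> by (simp add: zero_le_divide_iff)
  qed
qed

text \<open>Each character of the algebra of \<open>B\<close> agrees on coefficients with some UCP
  functional of the algebra of \<open>A\<close>, so it turns the matrix over \<open>B\<close> into a
  positive scalar matrix. Characters then detect positivity by
  \<open>accretive_of_characters\<close>.\<close>

lemma spectrum_subset_imp_pos_transfer:
  assumes A: "\<forall>i. A i \<in> bounded_ops" and B: "\<forall>i. B i \<in> bounded_ops"
    and normal: "\<forall>i. normal_op (B i)" and comm: "\<forall>i j. B i o\<^sub>L B j = B j o\<^sub>L B i"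
    and sub: "scalar_tuple ` joint_spectrum B \<subseteq> matrix_range_level 1 A"
  shows "pos_transfer A B"
  unfolding pos_transfer_def
proof (intro allI impI)
  fix n :: nat and c
  assume n: "n \<ge> 1" and pos: "op_matrix_pos n (lincomb_mat A c)"
  have nonneg: "0 \<le> (\<Sum>i<n. \<Sum>j<n. \<omega> (lincomb_mat B c i j) * z j * cnj (z i))"
    if \<omega>: "character_on (cstar_algebra B) \<omega>" for \<omega> and z :: "nat \<Rightarrow> complex"
  proof -
    have W: "ucp_entries 1 (cstar_algebra B) (\<lambda>a b. \<omega>)"
      by (rule character_ucp_entries[OF unital_cstar_subalgebra_cstar_algebra[OF B] \<omega>])
    have "scalar_tuple (\<lambda>i. \<omega> (B i)) \<in> matrix_range_level 1 A"
      using sub \<omega> by (auto simp: joint_spectrum_def)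
    then obtain G where G: "ucp_entries 1 (cstar_algebra A) G"
      and eq: "scalar_tuple (\<lambda>i. \<omega> (B i)) = (\<lambda>i. mat 1 1 (\<lambda>(a, b). G a b (A i)))"
      unfolding matrix_range_level_eq[OF A] mem_Collect_eq by (elim exE conjE)
    have GA: "G 0 0 (A i) = \<omega> (B i)" for i
      using fun_cong[OF eq, of i] arg_cong[of _ _ "\<lambda>M. M $$ (0, 0)"]
      by (metis (no_types, lifting) scalar_tuple_eq index_mat(1) less_one prod.simps(2))
    have "G 0 0 (cadjoint (A i)) = \<omega> (cadjoint (B i))" for i
      using ucp_entries_cadjoint[OF G operator_system_cstar_algebra[OF A] _ _ generator_in_cstar_algebra[of A i], of 0 0]
        ucp_entries_cadjoint[OF W operator_system_cstar_algebra[OF B] _ _ generator_in_cstar_algebra[of B i], of 0 0]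
      by (simp add: GA)
    then have gen: "G 0 0 (gen A k) = \<omega> (gen B k)" for k
      using GA G \<omega> by (auto simp: gen_def ucp_entries_def character_on_def split: option.split)
    have lc: "G 0 0 (lincomb A c) = \<omega> (lincomb B c)" for c
      using ucp_entries_lincomb[OF A G, of 0 0 c] ucp_entries_lincomb[OF B W, of 0 0 c]
      by (simp add: gen)
    have "lincomb_mat A c \<in> mats n (cstar_algebra A)"
      using lincomb_in_cstar_algebra[OF A] by (simp add: mats_def lincomb_mat_def)
    then have "0 \<le> quad 1 n G (lincomb_mat A c) (\<lambda>j _. z j)"
      using G n pos by (auto simp: ucp_entries_def)
    then show ?thesis
      by (simp add: quad_def lincomb_mat_def lc)
  qed
  \<comment> \<open>The factors 1, \<open>\<i>\<close> and \<open>- \<i>\<close> are what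
    \<open>op_matrix_pos_iff_accretive\<close> asks for.\<close>
  have "accretive n (lincomb_mat B (\<lambda>i j. d *\<^sub>C c i j))" if d: "Re d \<ge> 0" for d
  proof (rule accretive_of_characters[OF B normal comm])
    fix \<omega> and z :: "nat \<Rightarrow> complex" assume \<omega>: "character_on (cstar_algebra B) \<omega>"
    have "\<omega> (lincomb B (d *\<^sub>C c')) = d * \<omega> (lincomb B c')" for c'
      using \<omega> lincomb_in_cstar_algebra[OF B, of c']
      by (simp add: lincomb_scaleC character_on_def clinear_on_def scaleC_complex_def)
    then have "(\<Sum>i<n. \<Sum>j<n. \<omega> (lincomb_mat B (\<lambda>i j. d *\<^sub>C c i j) i j) * z j * cnj (z i))
        = d * (\<Sum>i<n. \<Sum>j<n. \<omega> (lincomb_mat B c i j) * z j * cnj (z i))"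
      by (simp add: lincomb_mat_def sum_distrib_left mult.assoc)
    moreover have "0 \<le> Re (d * w)" if "0 \<le> w" for w
      using that d by (simp add: less_eq_complex_def)
    from this[OF nonneg[OF \<omega>]] have "0 \<le> Re (d * (\<Sum>i<n. \<Sum>j<n. \<omega> (lincomb_mat B c i j) * z j * cnj (z i)))" .
    ultimately show "0 \<le> Re (\<Sum>i<n. \<Sum>j<n. \<omega> (lincomb_mat B (\<lambda>i j. d *\<^sub>C c i j) i j) * z j * cnj (z i))"
      by (simp only:)
  qed
  moreover have "lincomb_mat B (\<lambda>i j. d *\<^sub>C c i j) = d *\<^sub>C lincomb_mat B c" for d
    by (simp add: lincomb_mat_def fun_eq_iff lincomb_scaleC)
  ultimately have "accretive n (d *\<^sub>C lincomb_mat B c)" if "Re d \<ge> 0" for d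
    using that by simp
  from this[of 1] this[of "\<i>"] this[of "- \<i>"] show "op_matrix_pos n (lincomb_mat B c)"
    by (simp add: op_matrix_pos_iff_accretive)
qed

theorem theorem5p1:
  fixes A :: "'d :: finite \<Rightarrow> 'h :: chilbert_space \<Rightarrow>\<^sub>L 'h"
    and B :: "'d \<Rightarrow> 'k :: chilbert_space \<Rightarrow>\<^sub>L 'k"
  assumes "\<forall>i. A i \<in> bounded_ops" and "\<forall>i. B i \<in> bounded_ops"
  shows
    "(\<forall>n\<ge>1. (\<exists>\<phi>. unital_n_positive_map n (op_system A) (op_system B) \<phi> \<and> (\<forall>i. \<phi> (A i) = B i)) \<longrightarrow>
        matrix_range_level n B \<subseteq> matrix_range_level n A) \<and>
     ((\<exists>\<phi>. ucp_map (op_system A) (op_system B) \<phi> \<and> (\<forall>i. \<phi> (A i) = B i)) \<longleftrightarrow>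
        matrix_range B \<subseteq> matrix_range A) \<and>
     ((\<forall>i. normal_op (B i)) \<and> (\<forall>i j. B i o\<^sub>L B j = B j o\<^sub>L B i) \<longrightarrow>
        (matrix_range B \<subseteq> matrix_range A \<longleftrightarrow>
           scalar_tuple ` joint_spectrum B \<subseteq> matrix_range_level 1 A) \<and>
        (scalar_tuple ` joint_spectrum B \<subseteq> matrix_range_level 1 A \<longleftrightarrow>
           matrix_range_level 1 B \<subseteq> matrix_range_level 1 A)) \<and>
     ((\<exists>\<phi>. unital_complete_isometry (op_system A) (op_system B) \<phi> \<and> (\<forall>i. \<phi> (A i) = B i)) \<longleftrightarrow>
        matrix_range B = matrix_range A)"
proof (intro conjI allI impI)
  fix n :: nat
  assume n: "n \<ge> 1"
    and "\<exists>\<phi>. unital_n_positive_map n (op_system A) (op_system B) \<phi> \<and> (\<forall>i. \<phi> (A i) = B i)"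
  then obtain \<phi> where "unital_n_positive_map n (op_system A) (op_system B) \<phi>" "\<forall>i. \<phi> (A i) = B i"
    by blast
  then show "matrix_range_level n B \<subseteq> matrix_range_level n A"
    by (rule n_positive_imp_matrix_range_subset[OF assms n])
next
  have tr: "matrix_range B \<subseteq> matrix_range A" if "pos_transfer A B"
    using pos_transfer_imp_ucp_map[OF assms(2) that] ucp_map_imp_matrix_range_subset[OF assms] by blast
  show "(\<exists>\<phi>. ucp_map (op_system A) (op_system B) \<phi> \<and> (\<forall>i. \<phi> (A i) = B i)) \<longleftrightarrow>
      matrix_range B \<subseteq> matrix_range A"
    using pos_transfer_imp_ucp_map[OF assms(2) matrix_range_subset_imp_pos_transfer[OF assms]]
      ucp_map_imp_matrix_range_subset[OF assms] by blast
  assume "(\<forall>i. normal_op (B i)) \<and> (\<forall>i j. B i o\<^sub>L B j = B j o\<^sub>L B i)"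
  \<comment> \<open>The three conditions form a cycle: the spectral one implies inclusion at all
    levels, which restricts to level 1, and the spectrum of \<open>B\<close> lies in its first
    matrix range.\<close>
  then have "matrix_range B \<subseteq> matrix_range A"
    if "scalar_tuple ` joint_spectrum B \<subseteq> matrix_range_level 1 A"
    using that by (intro tr spectrum_subset_imp_pos_transfer[OF assms]) auto
  moreover have "matrix_range_level 1 B \<subseteq> matrix_range_level 1 A"
    if "matrix_range B \<subseteq> matrix_range A"
    using that unfolding matrix_range_subset_iff by blast
  moreover note joint_spectrum_subset_matrix_range[OF assms(2)]
  ultimately show "matrix_range B \<subseteq> matrix_range A \<longleftrightarrow>
      scalar_tuple ` joint_spectrum B \<subseteq> matrix_range_level 1 A"
    "scalar_tuple ` joint_spectrum B \<subseteq> matrix_range_level 1 A \<longleftrightarrow>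
      matrix_range_level 1 B \<subseteq> matrix_range_level 1 A"
    by (blast intro: order_trans)+
qed (rule complete_isometry_iff_matrix_range_eq[OF assms])

end
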